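(* Suppose the following statement $\mathsf{FS}$ holds: for every recursively enumerable theory $S$ including $\mathbf{PA}$, in the first-order language of arithmetic augmented by a modal operator $\Box$, such that (1) $\vdash_S\Box A\supset\Box\Box A$ for every formula $A$; (2) $\vdash_S A\supset\Box A$ for every $\Delta_0$ formula $A$; (3) $\vdash_S\Box(\Box A\supset A)$ for every $\Delta_0$ formula $A$; (4) if $\vdash_S\Box A$ then $\vdash_S A$, for every formula $A$; (5) if $A_1,\dots,A_n\vdash_S B$ then $\vdash_S(\Box A_1\wedge\cdots\wedge\Box A_n)\supset\Box B$ for arbitrary formulas $A_1,\dots,A_n,B$ ($n\ge 0$), the theory $S$ has the modal disjunction property if and only if it has the modal numerical existence property. Then the following statement $\mathsf{F}$ holds: every recursively enumerable extension of $\mathbf{HA}$ which has the disjunction property also has the numerical existence property.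
   Context: $\mathbf{PA}$ is Peano arithmetic and $\mathbf{HA}$ Heyting arithmetic. $\Delta_0$ formulas are arithmetical formulas with only bounded quantifiers and no occurrence of $\Box$. For a natural number $n$, $\mathbf{n}$ is its numeral. A modal theory $S$ has the modal disjunction property if whenever $S\vdash\Box A\vee\Box B$, either $S\vdash\Box A$ or $S\vdash\Box B$; it has the modal numerical existence property if whenever $S\vdash\exists x\Box A(x)$, there is $n$ with $S\vdash\Box A(\mathbf{n})$. An extension $T$ of $\mathbf{HA}$ has the disjunction property if whenever $T\vdash A\vee B$, either $T\vdash A$ or $T\vdash B$; it has the numerical existence property if whenever $T\vdash\exists xA(x)$, there is $n$ with $T\vdash A(\mathbf{n})$. *)

theory Defs
  imports Main "HOL-Library.Nat_Bijection"
begin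

section \<open>Recursively enumerable sets\<close>

text \<open>
  \<open>total_recursive k f\<close>: \<open>f\<close>, restricted to lists of length \<open>k\<close>, is a (total) recursive
  \<open>k\<close>-ary function. Values on lists of other lengths are irrelevant.
\<close>

inductive total_recursive :: "nat \<Rightarrow> (nat list \<Rightarrow> nat) \<Rightarrow> bool" where
  zero: "total_recursive k (\<lambda>_. 0)"
| succ: "total_recursive 1 (\<lambda>xs. Suc (hd xs))"
| proj: "i < k \<Longrightarrow> total_recursive k (\<lambda>xs. xs ! i)"
| comp: "total_recursive (length gs) f \<Longrightarrow> \<forall>g\<in>set gs. total_recursive k g
    \<Longrightarrow> total_recursive k (\<lambda>xs. f (map (\<lambda>g. g xs) gs))"
| prec: "total_recursive k f \<Longrightarrow> total_recursive (k + 2) g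
    \<Longrightarrow> total_recursive (Suc k)
          (\<lambda>xs. rec_nat (f (tl xs)) (\<lambda>n r. g (n # r # tl xs)) (hd xs))"
| minim: "total_recursive (Suc k) f \<Longrightarrow> \<forall>xs. length xs = k \<longrightarrow> (\<exists>y. f (y # xs) = 0)
    \<Longrightarrow> total_recursive k (\<lambda>xs. LEAST y. f (y # xs) = 0)"

definition rec_enum :: "nat set \<Rightarrow> bool" where
  "rec_enum X \<longleftrightarrow> X = {} \<or> (\<exists>f. total_recursive 1 f \<and> X = range (\<lambda>n. f [n]))"


section \<open>Terms\<close>

text \<open>
  Variables are de Bruijn indices. Substitutions are simultaneous: \<open>\<sigma> n\<close> is put for the
  variable \<open>n\<close>, and \<open>up \<sigma>\<close> is \<open>\<sigma>\<close> moved below a quantifier.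
\<close>

datatype tm = Var nat | Zero | Succ tm | Add tm tm | Mul tm tm

primrec tsubst :: "(nat \<Rightarrow> tm) \<Rightarrow> tm \<Rightarrow> tm" where
  "tsubst \<sigma> (Var n) = \<sigma> n"
| "tsubst \<sigma> Zero = Zero"
| "tsubst \<sigma> (Succ t) = Succ (tsubst \<sigma> t)"
| "tsubst \<sigma> (Add s t) = Add (tsubst \<sigma> s) (tsubst \<sigma> t)"
| "tsubst \<sigma> (Mul s t) = Mul (tsubst \<sigma> s) (tsubst \<sigma> t)"

definition shift :: "nat \<Rightarrow> tm" where
  "shift n = Var (Suc n)"

definition up :: "(nat \<Rightarrow> tm) \<Rightarrow> nat \<Rightarrow> tm" where
  "up \<sigma> = case_nat (Var 0) (\<lambda>n. tsubst shift (\<sigma> n))"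

text \<open>\<open>inst t\<close> instantiates the outermost quantified variable by \<open>t\<close>.\<close>

definition inst :: "tm \<Rightarrow> nat \<Rightarrow> tm" where
  "inst t = case_nat t Var"

primrec tfv :: "tm \<Rightarrow> nat set" where
  "tfv (Var n) = {n}"
| "tfv Zero = {}"
| "tfv (Succ t) = tfv t"
| "tfv (Add s t) = tfv s \<union> tfv t"
| "tfv (Mul s t) = tfv s \<union> tfv t"

primrec numeral_tm :: "nat \<Rightarrow> tm" where
  "numeral_tm 0 = Zero"
| "numeral_tm (Suc n) = Succ (numeral_tm n)"

primrec tcode :: "tm \<Rightarrow> nat" where
  "tcode (Var n) = prod_encode (0, n)"
| "tcode Zero = prod_encode (1, 0)"
| "tcode (Succ t) = prod_encode (2, tcode t)"
| "tcode (Add s t) = prod_encode (3, prod_encode (tcode s, tcode t))"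
| "tcode (Mul s t) = prod_encode (4, prod_encode (tcode s, tcode t))"


section \<open>Arithmetical formulas and intuitionistic logic\<close>

datatype fm =
    Eq tm tm | Leq tm tm | Bot
  | And fm fm | Or fm fm | Imp fm fm
  | Forall fm | Exists fm

primrec subst :: "(nat \<Rightarrow> tm) \<Rightarrow> fm \<Rightarrow> fm" where
  "subst \<sigma> (Eq s t) = Eq (tsubst \<sigma> s) (tsubst \<sigma> t)"
| "subst \<sigma> (Leq s t) = Leq (tsubst \<sigma> s) (tsubst \<sigma> t)"
| "subst \<sigma> Bot = Bot"
| "subst \<sigma> (And A B) = And (subst \<sigma> A) (subst \<sigma> B)"
| "subst \<sigma> (Or A B) = Or (subst \<sigma> A) (subst \<sigma> B)"
| "subst \<sigma> (Imp A B) = Imp (subst \<sigma> A) (subst \<sigma> B)"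
| "subst \<sigma> (Forall A) = Forall (subst (up \<sigma>) A)"
| "subst \<sigma> (Exists A) = Exists (subst (up \<sigma>) A)"

primrec fv :: "fm \<Rightarrow> nat set" where
  "fv (Eq s t) = tfv s \<union> tfv t"
| "fv (Leq s t) = tfv s \<union> tfv t"
| "fv Bot = {}"
| "fv (And A B) = fv A \<union> fv B"
| "fv (Or A B) = fv A \<union> fv B"
| "fv (Imp A B) = fv A \<union> fv B"
| "fv (Forall A) = {n. Suc n \<in> fv A}"
| "fv (Exists A) = {n. Suc n \<in> fv A}"

definition sentence :: "fm \<Rightarrow> bool" where
  "sentence A \<longleftrightarrow> fv A = {}"

primrec code :: "fm \<Rightarrow> nat" where
  "code (Eq s t) = prod_encode (0, prod_encode (tcode s, tcode t))"
| "code (Leq s t) = prod_encode (1, prod_encode (tcode s, tcode t))"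
| "code Bot = prod_encode (2, 0)"
| "code (And A B) = prod_encode (3, prod_encode (code A, code B))"
| "code (Or A B) = prod_encode (4, prod_encode (code A, code B))"
| "code (Imp A B) = prod_encode (5, prod_encode (code A, code B))"
| "code (Forall A) = prod_encode (6, code A)"
| "code (Exists A) = prod_encode (7, code A)"

text \<open>
  Natural deduction with equality. The eigenvariable conditions are expressed by shifting the
  free variables of the context, so free variables of assumptions are never generalized.
\<close>

inductive iprov :: "fm set \<Rightarrow> fm \<Rightarrow> bool" (infix "\<turnstile>\<^sub>i" 50) where
  Assm: "A \<in> \<Gamma> \<Longrightarrow> \<Gamma> \<turnstile>\<^sub>i A"
| BotE: "\<Gamma> \<turnstile>\<^sub>i Bot \<Longrightarrow> \<Gamma> \<turnstile>\<^sub>i A"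
| AndI: "\<Gamma> \<turnstile>\<^sub>i A \<Longrightarrow> \<Gamma> \<turnstile>\<^sub>i B \<Longrightarrow> \<Gamma> \<turnstile>\<^sub>i And A B"
| AndE1: "\<Gamma> \<turnstile>\<^sub>i And A B \<Longrightarrow> \<Gamma> \<turnstile>\<^sub>i A"
| AndE2: "\<Gamma> \<turnstile>\<^sub>i And A B \<Longrightarrow> \<Gamma> \<turnstile>\<^sub>i B"
| OrI1: "\<Gamma> \<turnstile>\<^sub>i A \<Longrightarrow> \<Gamma> \<turnstile>\<^sub>i Or A B"
| OrI2: "\<Gamma> \<turnstile>\<^sub>i B \<Longrightarrow> \<Gamma> \<turnstile>\<^sub>i Or A B"
| OrE: "\<Gamma> \<turnstile>\<^sub>i Or A B \<Longrightarrow> insert A \<Gamma> \<turnstile>\<^sub>i C \<Longrightarrow> insert B \<Gamma> \<turnstile>\<^sub>i C \<Longrightarrow> \<Gamma> \<turnstile>\<^sub>i C"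
| ImpI: "insert A \<Gamma> \<turnstile>\<^sub>i B \<Longrightarrow> \<Gamma> \<turnstile>\<^sub>i Imp A B"
| ImpE: "\<Gamma> \<turnstile>\<^sub>i Imp A B \<Longrightarrow> \<Gamma> \<turnstile>\<^sub>i A \<Longrightarrow> \<Gamma> \<turnstile>\<^sub>i B"
| ForallI: "subst shift ` \<Gamma> \<turnstile>\<^sub>i A \<Longrightarrow> \<Gamma> \<turnstile>\<^sub>i Forall A"
| ForallE: "\<Gamma> \<turnstile>\<^sub>i Forall A \<Longrightarrow> \<Gamma> \<turnstile>\<^sub>i subst (inst t) A"
| ExistsI: "\<Gamma> \<turnstile>\<^sub>i subst (inst t) A \<Longrightarrow> \<Gamma> \<turnstile>\<^sub>i Exists A"
| ExistsE: "\<Gamma> \<turnstile>\<^sub>i Exists A \<Longrightarrow> insert A (subst shift ` \<Gamma>) \<turnstile>\<^sub>i subst shift B \<Longrightarrow> \<Gamma> \<turnstile>\<^sub>i B"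
| EqRefl: "\<Gamma> \<turnstile>\<^sub>i Eq t t"
| EqSubst: "\<Gamma> \<turnstile>\<^sub>i Eq s t \<Longrightarrow> \<Gamma> \<turnstile>\<^sub>i subst (inst s) A \<Longrightarrow> \<Gamma> \<turnstile>\<^sub>i subst (inst t) A"


section \<open>Arithmetic\<close>

text \<open>
  The non-logical axioms shared by Heyting and Peano arithmetic. The order is a primitive symbol,
  governed by its usual definition, so that bounded quantifiers can be recognised syntactically.
\<close>

inductive arith_axiom :: "fm \<Rightarrow> bool" where
  Succ_neq_Zero: "arith_axiom (Imp (Eq (Succ (Var 0)) Zero) Bot)"
| Succ_inject: "arith_axiom (Imp (Eq (Succ (Var 0)) (Succ (Var 1))) (Eq (Var 0) (Var 1)))"
| Add_Zero: "arith_axiom (Eq (Add (Var 0) Zero) (Var 0))"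
| Add_Succ: "arith_axiom (Eq (Add (Var 0) (Succ (Var 1))) (Succ (Add (Var 0) (Var 1))))"
| Mul_Zero: "arith_axiom (Eq (Mul (Var 0) Zero) Zero)"
| Mul_Succ: "arith_axiom (Eq (Mul (Var 0) (Succ (Var 1))) (Add (Mul (Var 0) (Var 1)) (Var 0)))"
| Leq_D: "arith_axiom (Imp (Leq (Var 0) (Var 1)) (Exists (Eq (Add (Var 0) (Var 1)) (Var 2))))"
| Leq_I: "arith_axiom (Imp (Exists (Eq (Add (Var 0) (Var 1)) (Var 2))) (Leq (Var 0) (Var 1)))"
| Induction: "arith_axiom
    (Imp (And (subst (inst Zero) A)
              (Forall (Imp A (subst (case_nat (Succ (Var 0)) shift) A))))
         (Forall A))"

text \<open>The universal closures of the axioms.\<close>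

definition peano_axioms :: "fm set" where
  "peano_axioms = {(Forall ^^ n) A | n A. arith_axiom A \<and> sentence ((Forall ^^ n) A)}"

text \<open>A theory is given by a set of sentences; its theorems are the formulas derivable from it.\<close>

definition extends_HA :: "fm set \<Rightarrow> bool" where
  "extends_HA T \<longleftrightarrow> (\<forall>A\<in>T. sentence A) \<and> (\<forall>A\<in>peano_axioms. T \<turnstile>\<^sub>i A)"

definition re_theory :: "fm set \<Rightarrow> bool" where
  "re_theory T \<longleftrightarrow> rec_enum (code ` T)"

definition disjunction_property :: "fm set \<Rightarrow> bool" where
  "disjunction_property T \<longleftrightarrow>
     (\<forall>A B. sentence (Or A B) \<longrightarrow> T \<turnstile>\<^sub>i Or A B \<longrightarrow> T \<turnstile>\<^sub>i A \<or> T \<turnstile>\<^sub>i B)"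

definition numerical_existence_property :: "fm set \<Rightarrow> bool" where
  "numerical_existence_property T \<longleftrightarrow>
     (\<forall>A. sentence (Exists A) \<longrightarrow> T \<turnstile>\<^sub>i Exists A
        \<longrightarrow> (\<exists>n. T \<turnstile>\<^sub>i subst (inst (numeral_tm n)) A))"

text \<open>In a bounded quantifier the bound \<open>t\<close> does not contain the quantified variable.\<close>

inductive Delta0 :: "fm \<Rightarrow> bool" where
  "Delta0 (Eq s t)"
| "Delta0 (Leq s t)"
| "Delta0 Bot"
| "Delta0 A \<Longrightarrow> Delta0 B \<Longrightarrow> Delta0 (And A B)"
| "Delta0 A \<Longrightarrow> Delta0 B \<Longrightarrow> Delta0 (Or A B)"
| "Delta0 A \<Longrightarrow> Delta0 B \<Longrightarrow> Delta0 (Imp A B)"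
| "Delta0 A \<Longrightarrow> Delta0 (Forall (Imp (Leq (Var 0) (tsubst shift t)) A))"
| "Delta0 A \<Longrightarrow> Delta0 (Exists (And (Leq (Var 0) (tsubst shift t)) A))"


section \<open>Modal arithmetic\<close>

datatype mfm =
    MEq tm tm | MLeq tm tm | MBot
  | MAnd mfm mfm | MOr mfm mfm | MImp mfm mfm
  | MForall mfm | MExists mfm
  | Box mfm

primrec msubst :: "(nat \<Rightarrow> tm) \<Rightarrow> mfm \<Rightarrow> mfm" where
  "msubst \<sigma> (MEq s t) = MEq (tsubst \<sigma> s) (tsubst \<sigma> t)"
| "msubst \<sigma> (MLeq s t) = MLeq (tsubst \<sigma> s) (tsubst \<sigma> t)"
| "msubst \<sigma> MBot = MBot"
| "msubst \<sigma> (MAnd A B) = MAnd (msubst \<sigma> A) (msubst \<sigma> B)"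
| "msubst \<sigma> (MOr A B) = MOr (msubst \<sigma> A) (msubst \<sigma> B)"
| "msubst \<sigma> (MImp A B) = MImp (msubst \<sigma> A) (msubst \<sigma> B)"
| "msubst \<sigma> (MForall A) = MForall (msubst (up \<sigma>) A)"
| "msubst \<sigma> (MExists A) = MExists (msubst (up \<sigma>) A)"
| "msubst \<sigma> (Box A) = Box (msubst \<sigma> A)"

primrec mfv :: "mfm \<Rightarrow> nat set" where
  "mfv (MEq s t) = tfv s \<union> tfv t"
| "mfv (MLeq s t) = tfv s \<union> tfv t"
| "mfv MBot = {}"
| "mfv (MAnd A B) = mfv A \<union> mfv B"
| "mfv (MOr A B) = mfv A \<union> mfv B"
| "mfv (MImp A B) = mfv A \<union> mfv B"
| "mfv (MForall A) = {n. Suc n \<in> mfv A}"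
| "mfv (MExists A) = {n. Suc n \<in> mfv A}"
| "mfv (Box A) = mfv A"

definition msentence :: "mfm \<Rightarrow> bool" where
  "msentence A \<longleftrightarrow> mfv A = {}"

primrec mcode :: "mfm \<Rightarrow> nat" where
  "mcode (MEq s t) = prod_encode (0, prod_encode (tcode s, tcode t))"
| "mcode (MLeq s t) = prod_encode (1, prod_encode (tcode s, tcode t))"
| "mcode MBot = prod_encode (2, 0)"
| "mcode (MAnd A B) = prod_encode (3, prod_encode (mcode A, mcode B))"
| "mcode (MOr A B) = prod_encode (4, prod_encode (mcode A, mcode B))"
| "mcode (MImp A B) = prod_encode (5, prod_encode (mcode A, mcode B))"
| "mcode (MForall A) = prod_encode (6, mcode A)"
| "mcode (MExists A) = prod_encode (7, mcode A)"
| "mcode (Box A) = prod_encode (8, mcode A)"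

primrec embed :: "fm \<Rightarrow> mfm" where
  "embed (Eq s t) = MEq s t"
| "embed (Leq s t) = MLeq s t"
| "embed Bot = MBot"
| "embed (And A B) = MAnd (embed A) (embed B)"
| "embed (Or A B) = MOr (embed A) (embed B)"
| "embed (Imp A B) = MImp (embed A) (embed B)"
| "embed (Forall A) = MForall (embed A)"
| "embed (Exists A) = MExists (embed A)"

text \<open>
  Classical first-order logic over the modal language. No rule concerns \<open>Box\<close>: all modal
  principles, necessitation included, are properties of the individual theories. As in
  \<open>iprov\<close>, free variables of assumptions are not generalized.
\<close>

inductive mprov :: "mfm set \<Rightarrow> mfm \<Rightarrow> bool" (infix "\<turnstile>\<^sub>m" 50) where
  Assm: "A \<in> \<Gamma> \<Longrightarrow> \<Gamma> \<turnstile>\<^sub>m A"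
| DNE: "\<Gamma> \<turnstile>\<^sub>m MImp (MImp A MBot) MBot \<Longrightarrow> \<Gamma> \<turnstile>\<^sub>m A"
| BotE: "\<Gamma> \<turnstile>\<^sub>m MBot \<Longrightarrow> \<Gamma> \<turnstile>\<^sub>m A"
| AndI: "\<Gamma> \<turnstile>\<^sub>m A \<Longrightarrow> \<Gamma> \<turnstile>\<^sub>m B \<Longrightarrow> \<Gamma> \<turnstile>\<^sub>m MAnd A B"
| AndE1: "\<Gamma> \<turnstile>\<^sub>m MAnd A B \<Longrightarrow> \<Gamma> \<turnstile>\<^sub>m A"
| AndE2: "\<Gamma> \<turnstile>\<^sub>m MAnd A B \<Longrightarrow> \<Gamma> \<turnstile>\<^sub>m B"
| OrI1: "\<Gamma> \<turnstile>\<^sub>m A \<Longrightarrow> \<Gamma> \<turnstile>\<^sub>m MOr A B"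
| OrI2: "\<Gamma> \<turnstile>\<^sub>m B \<Longrightarrow> \<Gamma> \<turnstile>\<^sub>m MOr A B"
| OrE: "\<Gamma> \<turnstile>\<^sub>m MOr A B \<Longrightarrow> insert A \<Gamma> \<turnstile>\<^sub>m C \<Longrightarrow> insert B \<Gamma> \<turnstile>\<^sub>m C \<Longrightarrow> \<Gamma> \<turnstile>\<^sub>m C"
| ImpI: "insert A \<Gamma> \<turnstile>\<^sub>m B \<Longrightarrow> \<Gamma> \<turnstile>\<^sub>m MImp A B"
| ImpE: "\<Gamma> \<turnstile>\<^sub>m MImp A B \<Longrightarrow> \<Gamma> \<turnstile>\<^sub>m A \<Longrightarrow> \<Gamma> \<turnstile>\<^sub>m B"
| ForallI: "msubst shift ` \<Gamma> \<turnstile>\<^sub>m A \<Longrightarrow> \<Gamma> \<turnstile>\<^sub>m MForall A"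
| ForallE: "\<Gamma> \<turnstile>\<^sub>m MForall A \<Longrightarrow> \<Gamma> \<turnstile>\<^sub>m msubst (inst t) A"
| ExistsI: "\<Gamma> \<turnstile>\<^sub>m msubst (inst t) A \<Longrightarrow> \<Gamma> \<turnstile>\<^sub>m MExists A"
| ExistsE: "\<Gamma> \<turnstile>\<^sub>m MExists A \<Longrightarrow> insert A (msubst shift ` \<Gamma>) \<turnstile>\<^sub>m msubst shift B \<Longrightarrow> \<Gamma> \<turnstile>\<^sub>m B"
| EqRefl: "\<Gamma> \<turnstile>\<^sub>m MEq t t"
| EqSubst: "\<Gamma> \<turnstile>\<^sub>m MEq s t \<Longrightarrow> \<Gamma> \<turnstile>\<^sub>m msubst (inst s) A \<Longrightarrow> \<Gamma> \<turnstile>\<^sub>m msubst (inst t) A"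

text \<open>
  Since \<open>mprov\<close> is classical, deriving the axioms suffices for deriving every theorem of Peano
  arithmetic. Induction is only demanded for arithmetical formulas.
\<close>

definition includes_PA :: "mfm set \<Rightarrow> bool" where
  "includes_PA S \<longleftrightarrow> (\<forall>A\<in>S. msentence A) \<and> (\<forall>A\<in>peano_axioms. S \<turnstile>\<^sub>m embed A)"

definition re_mtheory :: "mfm set \<Rightarrow> bool" where
  "re_mtheory S \<longleftrightarrow> rec_enum (mcode ` S)"

fun mconj :: "mfm list \<Rightarrow> mfm" where
  "mconj [] = MImp MBot MBot"
| "mconj [A] = A"
| "mconj (A # B # As) = MAnd A (mconj (B # As))"

definition modal_disjunction_property :: "mfm set \<Rightarrow> bool" where
  "modal_disjunction_property S \<longleftrightarrow>
     (\<forall>A B. msentence (MOr (Box A) (Box B)) \<longrightarrow> S \<turnstile>\<^sub>m MOr (Box A) (Box B)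
        \<longrightarrow> S \<turnstile>\<^sub>m Box A \<or> S \<turnstile>\<^sub>m Box B)"

definition modal_numerical_existence_property :: "mfm set \<Rightarrow> bool" where
  "modal_numerical_existence_property S \<longleftrightarrow>
     (\<forall>A. msentence (MExists (Box A)) \<longrightarrow> S \<turnstile>\<^sub>m MExists (Box A)
        \<longrightarrow> (\<exists>n. S \<turnstile>\<^sub>m Box (msubst (inst (numeral_tm n)) A)))"

end

(*
Friedman's argument shows outright that the disjunction property yields the numerical existence
property. Suppose T proves Ex x. A(x). Provability in T is Sigma_1, so by diagonalization there are
sentences phi, psi and formulas C, D, decidable in HA, with

  phi = (Ex x. A(x) and neither C nor D holds up to x) or (D becomes true strictly before C),
  psi = (C becomes true no later than D),

where C (respectively D) is true at some number iff T proves phi (respectively psi). Since T proves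
Ex x. A(x), it proves phi or psi, hence one of them by the disjunction property, and so C or D is
true somewhere. If C comes first, HA proves psi, which refutes the second disjunct of phi; as T
proves phi, it proves A(x) for some x up to the stage at which C becomes true, and the disjunction
property singles out one such x. If D comes first, HA refutes psi although T proves it, and T is
inconsistent.

To know that provability is Sigma_1, it suffices to work with predicates on natural numbers: those
of the form Ex y. Q(y), with Q monotone in y and decided by HA, are closed under bounded
quantification, under composition with total recursive functions, and under inductive definitions.
*)

theory Submission
  imports Defs "HOL-Number_Theory.Cong"
begin

section \<open>Substitution and derivability\<close>

text \<open>The logic is intuitionistic, so the question which of C and D is first has an answer
  inside HA only if the stages are decided there. Deciding each numerical instance is too little: T
  reasons about an unknown witness x of A, so excluded middle for C and D has to be derived with a
  free variable. This is why a predicate is called decidable below only together with a formula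
  \<open>B\<close> for which HA proves \<open>Dec B\<close>; the formulas constructed are equations
  closed under connectives and bounded quantifiers.

  That C is true somewhere exactly when T proves phi is a fact about T, applied from outside. Inside
  HA there are only the values of C and D at single numerals and an induction that orders the
  stages.

  The comparison is Rosser's, with ties awarded to C. The disjunct of phi about x turns the usual
  contradiction into information: once T proves psi, only that disjunct can account for the
  provability of phi, and its witnesses lie below a fixed numeral.\<close>

lemma shift_eq [simp]: "shift n = Var (Suc n)" by (simp add: shift_def)
lemma shift_fold [simp]: "(\<lambda>n. Var (Suc n)) = shift" by (simp add: fun_eq_iff)
lemma up_0 [simp]: "up \<sigma> 0 = Var 0" by (simp add: up_def)
lemma up_Suc [simp]: "up \<sigma> (Suc n) = tsubst shift (\<sigma> n)" by (simp add: up_def)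
lemma inst_0 [simp]: "inst t 0 = t" by (simp add: inst_def)
lemma inst_Suc [simp]: "inst t (Suc n) = Var n" by (simp add: inst_def)

lemma tsubst_cong: "(\<And>n. n \<in> tfv t \<Longrightarrow> \<sigma> n = \<tau> n) \<Longrightarrow> tsubst \<sigma> t = tsubst \<tau> t"
  by (induction t) auto

lemma subst_cong: "(\<And>n. n \<in> fv A \<Longrightarrow> \<sigma> n = \<tau> n) \<Longrightarrow> subst \<sigma> A = subst \<tau> A"
proof (induction A arbitrary: \<sigma> \<tau>)
  case (Forall A)
  have "up \<sigma> n = up \<tau> n" if "n \<in> fv A" for n
    using that Forall.prems by (cases n) auto
  from Forall.IH[OF this] show ?case by simp
next
  case (Exists A)
  have "up \<sigma> n = up \<tau> n" if "n \<in> fv A" for n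
    using that Exists.prems by (cases n) auto
  from Exists.IH[OF this] show ?case by simp
next
  case (Eq s t) then show ?case by (auto intro!: tsubst_cong)
next
  case (Leq s t) then show ?case by (auto intro!: tsubst_cong)
next
  case (And A B)
  from And.prems And.IH(1)[of \<sigma> \<tau>] And.IH(2)[of \<sigma> \<tau>] show ?case by simp
next
  case (Or A B)
  from Or.prems Or.IH(1)[of \<sigma> \<tau>] Or.IH(2)[of \<sigma> \<tau>] show ?case by simp
next
  case (Imp A B)
  from Imp.prems Imp.IH(1)[of \<sigma> \<tau>] Imp.IH(2)[of \<sigma> \<tau>] show ?case by simp
qed simp

lemma tsubst_Var [simp]: "tsubst Var t = t"
  by (induction t) auto

lemma up_Var [simp]: "up Var = Var"
proof
  show "up Var n = Var n" for n by (cases n) auto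
qed

lemma subst_Var [simp]: "subst Var A = A"
  by (induction A) auto

lemma tsubst_tsubst [simp]: "tsubst \<sigma> (tsubst \<tau> t) = tsubst (\<lambda>n. tsubst \<sigma> (\<tau> n)) t"
  by (induction t) auto

lemma up_comp [simp]: "(\<lambda>n. tsubst (up \<sigma>) (up \<tau> n)) = up (\<lambda>n. tsubst \<sigma> (\<tau> n))"
proof
  show "tsubst (up \<sigma>) (up \<tau> n) = up (\<lambda>n. tsubst \<sigma> (\<tau> n)) n" for n
    by (cases n) auto
qed

text \<open>Nested substitutions are fused by simp, so an equation between substituted formulas
  becomes a pointwise equation between substitutions. This is why many proofs below evaluate a
  composite substitution at each variable by \<open>cases n\<close>.\<close>

lemma subst_subst [simp]: "subst \<sigma> (subst \<tau> A) = subst (\<lambda>n. tsubst \<sigma> (\<tau> n)) A"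
  by (induction A arbitrary: \<sigma> \<tau>) auto

lemma subst_eqI: "(\<And>n. \<sigma> n = \<tau> n) \<Longrightarrow> subst \<sigma> A = subst \<tau> A"
  by (rule subst_cong)

lemma subst_sentence: "sentence A \<Longrightarrow> subst \<sigma> A = A"
  using subst_cong[of A \<sigma> Var] by (simp add: sentence_def)

lemma tfv_numeral [simp]: "tfv (numeral_tm n) = {}"
  by (induction n) auto

lemma tsubst_numeral [simp]: "tsubst \<sigma> (numeral_tm n) = numeral_tm n"
  by (induction n) auto

lemma finite_tfv: "finite (tfv t)" by (induction t) auto
lemma finite_fv: "finite (fv A)"
proof (induction A)
  case (Forall A)
  have "{n. Suc n \<in> fv A} = Suc -` fv A" by auto
  then show ?case using Forall by (simp add: finite_vimageI)
next
  case (Exists A)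
  have "{n. Suc n \<in> fv A} = Suc -` fv A" by auto
  then show ?case using Exists by (simp add: finite_vimageI)
qed (auto simp: finite_tfv)

lemma fv_tsubst: "tfv (tsubst \<sigma> t) = (\<Union>n\<in>tfv t. tfv (\<sigma> n))"
  by (induction t) auto

lemma tfv_up: "{m. Suc m \<in> (\<Union>n\<in>X. tfv (up \<sigma> n))} = (\<Union>n\<in>{n. Suc n \<in> X}. tfv (\<sigma> n))"
proof -
  have "Suc m \<in> tfv (up \<sigma> n) \<longleftrightarrow> (\<exists>k. n = Suc k \<and> m \<in> tfv (\<sigma> k))" for m n
    by (cases n) (auto simp: fv_tsubst)
  then show ?thesis by auto
qed

lemma fv_subst: "fv (subst \<sigma> A) = (\<Union>n\<in>fv A. tfv (\<sigma> n))"
proof (induction A arbitrary: \<sigma>)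
  case (Forall A)
  then show ?case using tfv_up[of \<sigma> "fv A"] by simp
next
  case (Exists A)
  then show ?case using tfv_up[of \<sigma> "fv A"] by simp
qed (auto simp: fv_tsubst)

section \<open>Weakening, substitution and cut for natural deduction\<close>

lemma iprov_mono: "\<Gamma> \<turnstile>\<^sub>i A \<Longrightarrow> \<Gamma> \<subseteq> \<Delta> \<Longrightarrow> \<Delta> \<turnstile>\<^sub>i A"
proof (induction arbitrary: \<Delta> rule: iprov.induct)
  case (OrE \<Gamma> A B C)
  show ?case by (rule iprov.OrE[OF OrE.IH(1) OrE.IH(2) OrE.IH(3)]) (use OrE.prems in auto)
next
  case (ImpI A \<Gamma> B)
  show ?case by (rule iprov.ImpI[OF ImpI.IH]) (use ImpI.prems in auto)
next
  case (ForallI \<Gamma> A)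
  show ?case by (rule iprov.ForallI[OF ForallI.IH]) (use ForallI.prems in auto)
next
  case (ExistsE \<Gamma> A B)
  show ?case by (rule iprov.ExistsE[OF ExistsE.IH(1) ExistsE.IH(2)]) (use ExistsE.prems in auto)
next
  case (BotE \<Gamma> A) show ?case by (rule iprov.BotE[OF BotE.IH[OF BotE.prems]])
next
  case (AndI \<Gamma> A B) show ?case by (rule iprov.AndI[OF AndI.IH(1)[OF AndI.prems] AndI.IH(2)[OF AndI.prems]])
next
  case (AndE1 \<Gamma> A B) show ?case by (rule iprov.AndE1[OF AndE1.IH[OF AndE1.prems]])
next
  case (AndE2 \<Gamma> A B) show ?case by (rule iprov.AndE2[OF AndE2.IH[OF AndE2.prems]])
next
  case (OrI1 \<Gamma> A B) show ?case by (rule iprov.OrI1[OF OrI1.IH[OF OrI1.prems]])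
next
  case (OrI2 \<Gamma> B A) show ?case by (rule iprov.OrI2[OF OrI2.IH[OF OrI2.prems]])
next
  case (ImpE \<Gamma> A B) show ?case by (rule iprov.ImpE[OF ImpE.IH(1)[OF ImpE.prems] ImpE.IH(2)[OF ImpE.prems]])
next
  case (ForallE \<Gamma> A t) show ?case by (rule iprov.ForallE[OF ForallE.IH[OF ForallE.prems]])
next
  case (ExistsI \<Gamma> t A) show ?case by (rule iprov.ExistsI[OF ExistsI.IH[OF ExistsI.prems]])
next
  case (EqSubst \<Gamma> s t A) show ?case by (rule iprov.EqSubst[OF EqSubst.IH(1)[OF EqSubst.prems] EqSubst.IH(2)[OF EqSubst.prems]])
qed (auto intro: iprov.Assm iprov.EqRefl)

lemma iprov_weaken: "\<Gamma> \<turnstile>\<^sub>i A \<Longrightarrow> insert B \<Gamma> \<turnstile>\<^sub>i A"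
  by (rule iprov_mono) auto

lemma subst_inst_up: "subst \<sigma> (subst (inst t) A) = subst (inst (tsubst \<sigma> t)) (subst (up \<sigma>) A)"
proof -
  have "tsubst \<sigma> (inst t n) = tsubst (inst (tsubst \<sigma> t)) (up \<sigma> n)" for n
    by (cases n) auto
  then show ?thesis by simp
qed

lemma subst_up_shift: "subst (up \<sigma>) ` subst shift ` \<Gamma> = subst shift ` subst \<sigma> ` \<Gamma>"
  by (simp add: image_image)

text \<open>Below a quantifier the substitution becomes \<open>up \<sigma>\<close>, and
  \<open>subst_up_shift\<close> says that it commutes with the shift of the context that encodes the
  eigenvariable condition. The instance \<open>shift\<close> is what later carries derivations below
  a quantifier.\<close>

lemma iprov_subst: "\<Gamma> \<turnstile>\<^sub>i A \<Longrightarrow> subst \<sigma> ` \<Gamma> \<turnstile>\<^sub>i subst \<sigma> A"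
proof (induction arbitrary: \<sigma> rule: iprov.induct)
  case (OrE \<Gamma> A B C)
  show ?case
    by (rule iprov.OrE[of _ "subst \<sigma> A" "subst \<sigma> B"])
      (use OrE.IH(1)[of \<sigma>] OrE.IH(2)[of \<sigma>] OrE.IH(3)[of \<sigma>] in auto)
next
  case (ImpI A \<Gamma> B)
  then show ?case by (simp add: iprov.ImpI)
next
  case (ImpE \<Gamma> A B)
  show ?case by (rule iprov.ImpE[of _ "subst \<sigma> A"]) (use ImpE.IH[of \<sigma>] in simp_all)
next
  case (ForallI \<Gamma> A)
  have "subst shift ` subst \<sigma> ` \<Gamma> \<turnstile>\<^sub>i subst (up \<sigma>) A"
    using ForallI.IH[of "up \<sigma>"] by (simp only: subst_up_shift)
  then show ?case by (simp add: iprov.ForallI)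
next
  case (ForallE \<Gamma> A t)
  have "subst \<sigma> ` \<Gamma> \<turnstile>\<^sub>i Forall (subst (up \<sigma>) A)"
    using ForallE.IH[of \<sigma>] by simp
  then show ?case unfolding subst_inst_up by (rule iprov.ForallE)
next
  case (ExistsI \<Gamma> t A)
  have "subst \<sigma> ` \<Gamma> \<turnstile>\<^sub>i subst (inst (tsubst \<sigma> t)) (subst (up \<sigma>) A)"
    using ExistsI.IH[of \<sigma>] unfolding subst_inst_up .
  then show ?case by (simp only: subst.simps iprov.ExistsI)
next
  case (ExistsE \<Gamma> A B)
  have "subst \<sigma> ` \<Gamma> \<turnstile>\<^sub>i Exists (subst (up \<sigma>) A)"
    using ExistsE.IH(1)[of \<sigma>] by simp
  moreover have "insert (subst (up \<sigma>) A) (subst shift ` subst \<sigma> ` \<Gamma>)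
      \<turnstile>\<^sub>i subst shift (subst \<sigma> B)"
    using ExistsE.IH(2)[of "up \<sigma>"] unfolding image_insert subst_up_shift by simp
  ultimately show ?case by (rule iprov.ExistsE)
next
  case (EqSubst \<Gamma> s t A)
  show ?case unfolding subst_inst_up
    by (rule iprov.EqSubst[of _ "tsubst \<sigma> s"])
      (use EqSubst.IH(1)[of \<sigma>] EqSubst.IH(2)[of \<sigma>] in \<open>simp_all add: subst_inst_up del: subst_subst\<close>)
next
  case (BotE \<Gamma> A)
  show ?case by (rule iprov.BotE) (use BotE.IH[of \<sigma>] in simp)
next
  case (AndE1 \<Gamma> A B)
  show ?case by (rule iprov.AndE1[of _ _ "subst \<sigma> B"]) (use AndE1.IH[of \<sigma>] in simp)
next
  case (AndE2 \<Gamma> A B)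
  show ?case by (rule iprov.AndE2[of _ "subst \<sigma> A"]) (use AndE2.IH[of \<sigma>] in simp)
qed (simp_all add: iprov.Assm iprov.AndI iprov.OrI1 iprov.OrI2 iprov.EqRefl)

text \<open>Each use of an assumption is replaced by a derivation of it. Where the use sits below a
  quantifier rule that derivation has to be shifted, which \<open>iprov_subst\<close>
  permits.\<close>

lemma iprov_cut:
  "\<Delta> \<turnstile>\<^sub>i A \<Longrightarrow> (\<And>B. B \<in> \<Delta> \<Longrightarrow> \<Gamma> \<turnstile>\<^sub>i B) \<Longrightarrow> \<Gamma> \<turnstile>\<^sub>i A"
proof (induction arbitrary: \<Gamma> rule: iprov.induct)
  case (OrE \<Delta> A B C)
  have "insert A \<Gamma> \<turnstile>\<^sub>i C" "insert B \<Gamma> \<turnstile>\<^sub>i C"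
    by (rule OrE.IH(2) OrE.IH(3); use OrE.prems in \<open>auto intro: iprov.Assm iprov_weaken\<close>)+
  with OrE.IH(1)[OF OrE.prems] show ?case by (rule iprov.OrE)
next
  case (ImpI A \<Delta> B)
  have "insert A \<Gamma> \<turnstile>\<^sub>i B"
    by (rule ImpI.IH) (use ImpI.prems in \<open>auto intro: iprov.Assm iprov_weaken\<close>)
  then show ?case by (rule iprov.ImpI)
next
  case (ForallI \<Delta> A)
  have "subst shift ` \<Gamma> \<turnstile>\<^sub>i A"
    by (rule ForallI.IH) (use ForallI.prems in \<open>auto intro: iprov_subst\<close>)
  then show ?case by (rule iprov.ForallI)
next
  case (ExistsE \<Delta> A B)
  have "insert A (subst shift ` \<Gamma>) \<turnstile>\<^sub>i subst shift B"
    by (rule ExistsE.IH)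
      (use ExistsE.prems in \<open>auto intro: iprov.Assm iprov_weaken iprov_subst\<close>)
  with ExistsE.IH(1)[OF ExistsE.prems] show ?case by (rule iprov.ExistsE)
next
  case (BotE \<Gamma> A) show ?case by (rule iprov.BotE[OF BotE.IH[OF BotE.prems]])
next
  case (AndI \<Gamma> A B) show ?case by (rule iprov.AndI[OF AndI.IH(1)[OF AndI.prems] AndI.IH(2)[OF AndI.prems]])
next
  case (AndE1 \<Gamma> A B) show ?case by (rule iprov.AndE1[OF AndE1.IH[OF AndE1.prems]])
next
  case (AndE2 \<Gamma> A B) show ?case by (rule iprov.AndE2[OF AndE2.IH[OF AndE2.prems]])
next
  case (OrI1 \<Gamma> A B) show ?case by (rule iprov.OrI1[OF OrI1.IH[OF OrI1.prems]])
next
  case (OrI2 \<Gamma> B A) show ?case by (rule iprov.OrI2[OF OrI2.IH[OF OrI2.prems]])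
next
  case (ImpE \<Gamma> A B) show ?case by (rule iprov.ImpE[OF ImpE.IH(1)[OF ImpE.prems] ImpE.IH(2)[OF ImpE.prems]])
next
  case (ForallE \<Gamma> A t) show ?case by (rule iprov.ForallE[OF ForallE.IH[OF ForallE.prems]])
next
  case (ExistsI \<Gamma> t A) show ?case by (rule iprov.ExistsI[OF ExistsI.IH[OF ExistsI.prems]])
next
  case (EqSubst \<Gamma> s t A) show ?case by (rule iprov.EqSubst[OF EqSubst.IH(1)[OF EqSubst.prems] EqSubst.IH(2)[OF EqSubst.prems]])
qed (auto intro: iprov.Assm iprov.EqRefl)

section \<open>Derived rules for negation and equality\<close>

abbreviation Neg :: "fm \<Rightarrow> fm" where "Neg A \<equiv> Imp A Bot"

lemma NegE: "\<Gamma> \<turnstile>\<^sub>i Neg A \<Longrightarrow> \<Gamma> \<turnstile>\<^sub>i A \<Longrightarrow> \<Gamma> \<turnstile>\<^sub>i B"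
  by (rule iprov.BotE[OF iprov.ImpE])

lemma iprov_Assm [simp]: "insert A \<Gamma> \<turnstile>\<^sub>i A"
  by (simp add: iprov.Assm)

lemma iprov_Assm2 [simp]: "insert B (insert A \<Gamma>) \<turnstile>\<^sub>i A"
  by (simp add: iprov.Assm)

lemma iprov_Assm3 [simp]: "insert C (insert B (insert A \<Gamma>)) \<turnstile>\<^sub>i A"
  by (simp add: iprov.Assm)

text \<open>The conclusion of \<open>EqSubst\<close> is an instance \<open>subst (inst t) A\<close>,
  which seldom matches a given formula by unification. With \<open>A\<close> supplied and
  \<open>B\<close> kept apart, the substitution is computed by simp instead.\<close>

lemma eq_rewrite:
  assumes "\<Gamma> \<turnstile>\<^sub>i Eq s t" and "\<Gamma> \<turnstile>\<^sub>i subst (inst s) A" and "subst (inst t) A = B"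
  shows "\<Gamma> \<turnstile>\<^sub>i B"
  using iprov.EqSubst[OF assms(1,2)] assms(3) by simp

lemma tsubst_Var_eta [simp]: "tsubst (\<lambda>n. Var n) t = t"
  by (induction t) auto

lemma subst_Var_eta [simp]: "subst (\<lambda>n. Var n) A = A"
  using subst_Var[of A] by (simp add: fun_eq_iff)

lemma Eq_sym: "\<Gamma> \<turnstile>\<^sub>i Eq s t \<Longrightarrow> \<Gamma> \<turnstile>\<^sub>i Eq t s"
  by (rule eq_rewrite[of _ _ _ "Eq (Var 0) (tsubst shift s)"]) (auto intro: iprov.EqRefl)

lemma Eq_trans: "\<Gamma> \<turnstile>\<^sub>i Eq s t \<Longrightarrow> \<Gamma> \<turnstile>\<^sub>i Eq t u \<Longrightarrow> \<Gamma> \<turnstile>\<^sub>i Eq s u"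
  by (rule eq_rewrite[of _ _ _ "Eq (tsubst shift s) (Var 0)"]) auto

lemma Eq_Succ: "\<Gamma> \<turnstile>\<^sub>i Eq s t \<Longrightarrow> \<Gamma> \<turnstile>\<^sub>i Eq (Succ s) (Succ t)"
  by (rule eq_rewrite[of _ _ _ "Eq (Succ (tsubst shift s)) (Succ (Var 0))"])
    (auto intro: iprov.EqRefl)

lemma Eq_Add:
  assumes "\<Gamma> \<turnstile>\<^sub>i Eq s t" "\<Gamma> \<turnstile>\<^sub>i Eq s' t'"
  shows "\<Gamma> \<turnstile>\<^sub>i Eq (Add s s') (Add t t')"
proof -
  have "\<Gamma> \<turnstile>\<^sub>i Eq (Add s s') (Add t s')"
    by (rule eq_rewrite[OF assms(1), of "Eq (tsubst shift (Add s s')) (Add (Var 0) (tsubst shift s'))"])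
      (auto intro: iprov.EqRefl)
  moreover have "\<Gamma> \<turnstile>\<^sub>i Eq (Add t s') (Add t t')"
    by (rule eq_rewrite[OF assms(2), of "Eq (tsubst shift (Add t s')) (Add (tsubst shift t) (Var 0))"])
      (auto intro: iprov.EqRefl)
  ultimately show ?thesis by (rule Eq_trans)
qed

lemma Eq_Mul:
  assumes "\<Gamma> \<turnstile>\<^sub>i Eq s t" "\<Gamma> \<turnstile>\<^sub>i Eq s' t'"
  shows "\<Gamma> \<turnstile>\<^sub>i Eq (Mul s s') (Mul t t')"
proof -
  have "\<Gamma> \<turnstile>\<^sub>i Eq (Mul s s') (Mul t s')"
    by (rule eq_rewrite[OF assms(1), of "Eq (tsubst shift (Mul s s')) (Mul (Var 0) (tsubst shift s'))"])
      (auto intro: iprov.EqRefl)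
  moreover have "\<Gamma> \<turnstile>\<^sub>i Eq (Mul t s') (Mul t t')"
    by (rule eq_rewrite[OF assms(2), of "Eq (tsubst shift (Mul t s')) (Mul (tsubst shift t) (Var 0))"])
      (auto intro: iprov.EqRefl)
  ultimately show ?thesis by (rule Eq_trans)
qed

section \<open>Arithmetic in HA\<close>

text \<open>Unlike \<open>extends_HA\<close>, this puts no demand on the members of \<Gamma>, so it
  survives both the insertion of hypotheses with free variables and the shifting of the
  context.\<close>

definition arith :: "fm set \<Rightarrow> bool" where
  "arith \<Gamma> \<longleftrightarrow> (\<forall>A\<in>peano_axioms. \<Gamma> \<turnstile>\<^sub>i A)"

lemma peano_axioms_sentence: "A \<in> peano_axioms \<Longrightarrow> sentence A"
  by (auto simp: peano_axioms_def)

lemma subst_image_sentences: "(\<And>A. A \<in> T \<Longrightarrow> sentence A) \<Longrightarrow> subst \<sigma> ` T = T"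
  by (force simp: subst_sentence)

lemma arith_peano_axioms [simp]: "arith peano_axioms"
  by (simp add: arith_def iprov.Assm)

lemma arith_insert [simp]: "arith \<Gamma> \<Longrightarrow> arith (insert A \<Gamma>)"
  by (simp add: arith_def iprov_weaken)

lemma arith_subst [simp]:
  assumes "arith \<Gamma>" shows "arith (subst \<sigma> ` \<Gamma>)"
  unfolding arith_def
proof
  fix A assume A: "A \<in> peano_axioms"
  then have "subst \<sigma> A = A" by (simp add: peano_axioms_sentence subst_sentence)
  with A assms iprov_subst[of \<Gamma> A \<sigma>] show "subst \<sigma> ` \<Gamma> \<turnstile>\<^sub>i A" by (simp add: arith_def)
qed

lemma arith_cut: "arith \<Gamma> \<Longrightarrow> peano_axioms \<turnstile>\<^sub>i A \<Longrightarrow> \<Gamma> \<turnstile>\<^sub>i A"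
  by (erule iprov_cut) (simp add: arith_def)

text \<open>In the induction the innermost quantifier, which binds variable 0 of \<open>A\<close>,
  is split off and instantiated last. The induction hypothesis for \<open>Forall A\<close> is
  therefore used with \<sigma> moved by one.\<close>

lemma Forall_closureD:
  "\<Gamma> \<turnstile>\<^sub>i (Forall ^^ n) A \<Longrightarrow> \<Gamma> \<turnstile>\<^sub>i subst (\<lambda>i. if i < n then \<sigma> i else Var (i - n)) A"
proof (induction n arbitrary: A \<sigma>)
  case (Suc n)
  let ?\<tau> = "\<lambda>i. if i < n then \<sigma> (Suc i) else Var (i - n)"
  have "\<Gamma> \<turnstile>\<^sub>i (Forall ^^ n) (Forall A)"
    using Suc.prems by (simp add: funpow_swap1)
  from Suc.IH[OF this, of "\<lambda>i. \<sigma> (Suc i)"]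
  have "\<Gamma> \<turnstile>\<^sub>i Forall (subst (up ?\<tau>) A)" by simp
  then have "\<Gamma> \<turnstile>\<^sub>i subst (inst (\<sigma> 0)) (subst (up ?\<tau>) A)" by (rule iprov.ForallE)
  moreover have "tsubst (inst (\<sigma> 0)) (up ?\<tau> i) = (if i < Suc n then \<sigma> i else Var (i - Suc n))" for i
    by (cases i) auto
  ultimately show ?case by simp
qed simp

lemma fv_Forall_closure: "fv ((Forall ^^ n) A) = {i. i + n \<in> fv A}"
  by (induction n) auto

lemma arith_axiomD:
  assumes "arith \<Gamma>" "arith_axiom A" shows "\<Gamma> \<turnstile>\<^sub>i subst \<sigma> A"
proof -
  obtain n where n: "\<And>i. i \<in> fv A \<Longrightarrow> i < n"
    using finite_fv[of A] by (meson finite_nat_set_iff_bounded)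
  then have "sentence ((Forall ^^ n) A)"
    by (force simp: sentence_def fv_Forall_closure)
  then have "(Forall ^^ n) A \<in> peano_axioms"
    using assms by (auto simp: peano_axioms_def)
  then have "\<Gamma> \<turnstile>\<^sub>i (Forall ^^ n) A" using assms by (simp add: arith_def)
  from Forall_closureD[OF this, of \<sigma>]
  have "\<Gamma> \<turnstile>\<^sub>i subst (\<lambda>i. if i < n then \<sigma> i else Var (i - n)) A" .
  also have "subst (\<lambda>i. if i < n then \<sigma> i else Var (i - n)) A = subst \<sigma> A"
    by (rule subst_cong) (simp add: n)
  finally show ?thesis .
qed

context
  fixes \<Gamma> :: "fm set"
  assumes \<Gamma>: "arith \<Gamma>"
begin

lemma Succ_neq_ZeroD: "\<Gamma> \<turnstile>\<^sub>i Eq (Succ t) Zero \<Longrightarrow> \<Gamma> \<turnstile>\<^sub>i C"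
  using arith_axiomD[OF \<Gamma> Succ_neq_Zero, of "\<lambda>_. t"] by - (rule NegE, simp_all)

lemma Succ_injectD: "\<Gamma> \<turnstile>\<^sub>i Eq (Succ s) (Succ t) \<Longrightarrow> \<Gamma> \<turnstile>\<^sub>i Eq s t"
  using arith_axiomD[OF \<Gamma> Succ_inject, of "case_nat s (\<lambda>_. t)"] by - (rule iprov.ImpE, simp_all)

lemma Add_Zero_eq: "\<Gamma> \<turnstile>\<^sub>i Eq (Add t Zero) t"
  using arith_axiomD[OF \<Gamma> Add_Zero, of "\<lambda>_. t"] by simp

lemma Add_Succ_eq: "\<Gamma> \<turnstile>\<^sub>i Eq (Add s (Succ t)) (Succ (Add s t))"
  using arith_axiomD[OF \<Gamma> Add_Succ, of "case_nat s (\<lambda>_. t)"] by simp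

lemma Mul_Zero_eq: "\<Gamma> \<turnstile>\<^sub>i Eq (Mul t Zero) Zero"
  using arith_axiomD[OF \<Gamma> Mul_Zero, of "\<lambda>_. t"] by simp

lemma Mul_Succ_eq: "\<Gamma> \<turnstile>\<^sub>i Eq (Mul s (Succ t)) (Add (Mul s t) s)"
  using arith_axiomD[OF \<Gamma> Mul_Succ, of "case_nat s (\<lambda>_. t)"] by simp

lemma LeqD: "\<Gamma> \<turnstile>\<^sub>i Leq s t \<Longrightarrow> \<Gamma> \<turnstile>\<^sub>i Exists (Eq (Add (Var 0) (tsubst shift s)) (tsubst shift t))"
  using arith_axiomD[OF \<Gamma> Leq_D, of "case_nat s (\<lambda>_. t)"]
  by - (rule iprov.ImpE, simp_all add: numeral_2_eq_2)

lemma LeqI: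
  assumes "\<Gamma> \<turnstile>\<^sub>i Eq (Add w s) t" shows "\<Gamma> \<turnstile>\<^sub>i Leq s t"
proof -
  have "\<Gamma> \<turnstile>\<^sub>i Imp (Exists (Eq (Add (Var 0) (tsubst shift s)) (tsubst shift t))) (Leq s t)"
    using arith_axiomD[OF \<Gamma> Leq_I, of "case_nat s (\<lambda>_. t)"] by (simp add: numeral_2_eq_2)
  moreover have "\<Gamma> \<turnstile>\<^sub>i Exists (Eq (Add (Var 0) (tsubst shift s)) (tsubst shift t))"
    by (rule iprov.ExistsI[of _ w]) (use assms in simp)
  ultimately show ?thesis by (rule iprov.ImpE)
qed

lemma LeqE:
  "\<Gamma> \<turnstile>\<^sub>i Leq s t \<Longrightarrow>
   insert (Eq (Add (Var 0) (tsubst shift s)) (tsubst shift t)) (subst shift ` \<Gamma>) \<turnstile>\<^sub>i subst shift C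
   \<Longrightarrow> \<Gamma> \<turnstile>\<^sub>i C"
  by (rule iprov.ExistsE[OF LeqD])

text \<open>Induction as a rule: the step is taken in the shifted context, with variable 0 as the
  induction variable. In \<open>case_nat (Succ (Var 0)) shift\<close> the index has already been
  lowered by one when \<open>shift\<close> is applied, so all variables other than 0 stay
  fixed.\<close>

lemma arith_induct:
  assumes "\<Gamma> \<turnstile>\<^sub>i subst (inst Zero) A"
    and "insert A (subst shift ` \<Gamma>) \<turnstile>\<^sub>i subst (case_nat (Succ (Var 0)) shift) A"
  shows "\<Gamma> \<turnstile>\<^sub>i subst (inst t) A"
proof -
  have "\<Gamma> \<turnstile>\<^sub>i Imp (And (subst (inst Zero) A)
              (Forall (Imp A (subst (case_nat (Succ (Var 0)) shift) A)))) (Forall A)"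
    using arith_axiomD[OF \<Gamma> Induction, of Var A] by simp
  from iprov.ImpE[OF this iprov.AndI[OF assms(1) iprov.ForallI[OF iprov.ImpI[OF assms(2)]]]]
  show ?thesis by (rule iprov.ForallE)
qed

end

section \<open>Addition and order in HA\<close>

lemma Zero_Add_eq:
  assumes "arith \<Gamma>" shows "\<Gamma> \<turnstile>\<^sub>i Eq (Add Zero t) t"
proof -
  let ?A = "Eq (Add Zero (Var 0)) (Var 0)"
  have "\<Gamma> \<turnstile>\<^sub>i subst (inst t) ?A"
  proof (rule arith_induct[OF assms])
    let ?\<Gamma> = "insert ?A (subst shift ` \<Gamma>)"
    show "\<Gamma> \<turnstile>\<^sub>i subst (inst Zero) ?A" using Add_Zero_eq[OF assms] by simp
    have "?\<Gamma> \<turnstile>\<^sub>i Eq (Add Zero (Succ (Var 0))) (Succ (Add Zero (Var 0)))"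
      by (rule Add_Succ_eq) (simp add: assms)
    then have "?\<Gamma> \<turnstile>\<^sub>i Eq (Add Zero (Succ (Var 0))) (Succ (Var 0))"
      by (rule Eq_trans) (rule Eq_Succ, simp)
    then show "?\<Gamma> \<turnstile>\<^sub>i subst (case_nat (Succ (Var 0)) shift) ?A" by simp
  qed
  then show ?thesis by simp
qed

text \<open>The axioms recurse on the right summand, but the witness \<open>w\<close> for
  \<open>Leq s t\<close> in \<open>w + s = t\<close> is a left summand. Case distinctions on
  \<open>w\<close> rest on this law and on \<open>Zero_Add_eq\<close>.\<close>

lemma Succ_Add_eq:
  assumes "arith \<Gamma>" shows "\<Gamma> \<turnstile>\<^sub>i Eq (Add (Succ s) t) (Succ (Add s t))"
proof -
  let ?s = "tsubst shift s"
  let ?A = "Eq (Add (Succ ?s) (Var 0)) (Succ (Add ?s (Var 0)))"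
  have "\<Gamma> \<turnstile>\<^sub>i subst (inst t) ?A"
  proof (rule arith_induct[OF assms])
    let ?\<Gamma> = "insert ?A (subst shift ` \<Gamma>)"
    have "\<Gamma> \<turnstile>\<^sub>i Eq (Add (Succ s) Zero) (Succ (Add s Zero))"
      by (rule Eq_trans[OF Add_Zero_eq[OF assms]])
        (rule Eq_Succ, rule Eq_sym, rule Add_Zero_eq[OF assms])
    then show "\<Gamma> \<turnstile>\<^sub>i subst (inst Zero) ?A" by simp
    have g: "arith ?\<Gamma>" by (simp add: assms)
    have "?\<Gamma> \<turnstile>\<^sub>i Eq (Add (Succ ?s) (Succ (Var 0))) (Succ (Add (Succ ?s) (Var 0)))"
      by (rule Add_Succ_eq[OF g])
    also have "?\<Gamma> \<turnstile>\<^sub>i Eq (Succ (Add (Succ ?s) (Var 0))) (Succ (Succ (Add ?s (Var 0))))"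
      by (rule Eq_Succ) simp
    also (Eq_trans) have "?\<Gamma> \<turnstile>\<^sub>i Eq (Succ (Succ (Add ?s (Var 0)))) (Succ (Add ?s (Succ (Var 0))))"
      by (rule Eq_Succ) (rule Eq_sym, rule Add_Succ_eq[OF g])
    finally (Eq_trans) show "?\<Gamma> \<turnstile>\<^sub>i subst (case_nat (Succ (Var 0)) shift) ?A" by simp
  qed
  then show ?thesis by simp
qed

text \<open>An induction whose step is immediate, since a successor has its own predecessor as
  witness.\<close>

lemma arith_cases:
  assumes "arith \<Gamma>"
    and zero: "insert (Eq t Zero) \<Gamma> \<turnstile>\<^sub>i C"
    and succ: "insert (Eq (tsubst shift t) (Succ (Var 0))) (subst shift ` \<Gamma>) \<turnstile>\<^sub>i subst shift C"
  shows "\<Gamma> \<turnstile>\<^sub>i C"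
proof -
  let ?A = "Or (Eq (Var 0) Zero) (Exists (Eq (Var 1) (Succ (Var 0))))"
  have "\<Gamma> \<turnstile>\<^sub>i subst (inst t) ?A"
  proof (rule arith_induct[OF assms(1)])
    let ?\<Gamma> = "insert ?A (subst shift ` \<Gamma>)"
    show "\<Gamma> \<turnstile>\<^sub>i subst (inst Zero) ?A" by (simp add: iprov.OrI1 iprov.EqRefl)
    show "?\<Gamma> \<turnstile>\<^sub>i subst (case_nat (Succ (Var 0)) shift) ?A"
      by (auto intro!: iprov.OrI2 iprov.ExistsI[of _ "Var 0"] iprov.EqRefl)
  qed
  then have "\<Gamma> \<turnstile>\<^sub>i Or (Eq t Zero) (Exists (Eq (tsubst shift t) (Succ (Var 0))))" by simp
  then show ?thesis
  proof (rule iprov.OrE[OF _ zero])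
    show "insert (Exists (Eq (tsubst shift t) (Succ (Var 0)))) \<Gamma> \<turnstile>\<^sub>i C"
      by (rule iprov.ExistsE[OF iprov_Assm], rule iprov_mono[OF succ]) auto
  qed
qed

lemma Leq_ZeroD:
  assumes \<Gamma>: "arith \<Gamma>" and leq: "\<Gamma> \<turnstile>\<^sub>i Leq s Zero"
  shows "\<Gamma> \<turnstile>\<^sub>i Eq s Zero"
proof (rule arith_cases[OF \<Gamma>, of s])
  let ?s = "tsubst shift s" and ?v = "Var 0"
  let ?\<Gamma> = "insert (Eq ?s (Succ ?v)) (subst shift ` \<Gamma>)"
  have g: "arith ?\<Gamma>" using \<Gamma> by simp
  have "?\<Gamma> \<turnstile>\<^sub>i Leq ?s Zero" using iprov_subst[OF leq, of shift] by (simp add: iprov_weaken)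
  then have "?\<Gamma> \<turnstile>\<^sub>i Bot"
  proof (rule LeqE[OF g])
    let ?s = "tsubst shift (tsubst shift s)" and ?v = "Var 1" and ?w = "Var 0"
    let ?\<Delta> = "insert (Eq (Add ?w ?s) Zero) (subst shift ` ?\<Gamma>)"
    have d: "arith ?\<Delta>" using \<Gamma> by simp
    have "?\<Delta> \<turnstile>\<^sub>i Eq ?s (Succ ?v)" by (rule iprov.Assm) simp
    then have "?\<Delta> \<turnstile>\<^sub>i Eq (Add ?w ?s) (Add ?w (Succ ?v))" by (rule Eq_Add[OF iprov.EqRefl])
    from Eq_trans[OF this Add_Succ_eq[OF d]]
    have "?\<Delta> \<turnstile>\<^sub>i Eq (Add ?w ?s) (Succ (Add ?w ?v))" .
    from Eq_trans[OF Eq_sym[OF this] iprov_Assm]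
    have "?\<Delta> \<turnstile>\<^sub>i Bot" by (rule Succ_neq_ZeroD[OF d])
    then show "insert (Eq (Add ?w (tsubst shift (tsubst shift s))) (tsubst shift Zero)) (subst shift ` ?\<Gamma>)
        \<turnstile>\<^sub>i subst shift Bot" by simp
  qed
  then show "?\<Gamma> \<turnstile>\<^sub>i subst shift (Eq s Zero)" by (rule iprov.BotE)
qed simp

lemma Leq_Zero_left: "arith \<Gamma> \<Longrightarrow> \<Gamma> \<turnstile>\<^sub>i Leq Zero t"
  by (rule LeqI[OF _ Add_Zero_eq])

lemma Leq_refl: "arith \<Gamma> \<Longrightarrow> \<Gamma> \<turnstile>\<^sub>i Leq t t"
  by (rule LeqI[OF _ Zero_Add_eq])

lemma Leq_Eq_right: "\<Gamma> \<turnstile>\<^sub>i Leq s t \<Longrightarrow> \<Gamma> \<turnstile>\<^sub>i Eq t u \<Longrightarrow> \<Gamma> \<turnstile>\<^sub>i Leq s u"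
  by (rule eq_rewrite[of _ t u "Leq (tsubst shift s) (Var 0)"]) auto

lemma Leq_Eq_left: "\<Gamma> \<turnstile>\<^sub>i Leq s t \<Longrightarrow> \<Gamma> \<turnstile>\<^sub>i Eq s u \<Longrightarrow> \<Gamma> \<turnstile>\<^sub>i Leq u t"
  by (rule eq_rewrite[of _ s u "Leq (Var 0) (tsubst shift t)"]) auto

lemma Leq_SuccI:
  assumes \<Gamma>: "arith \<Gamma>" and leq: "\<Gamma> \<turnstile>\<^sub>i Leq s t"
  shows "\<Gamma> \<turnstile>\<^sub>i Leq s (Succ t)"
proof (rule LeqE[OF \<Gamma> leq])
  let ?s = "tsubst shift s" and ?t = "tsubst shift t" and ?w = "Var 0"
  let ?\<Gamma> = "insert (Eq (Add ?w ?s) ?t) (subst shift ` \<Gamma>)"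
  have g: "arith ?\<Gamma>" using \<Gamma> by simp
  have "?\<Gamma> \<turnstile>\<^sub>i Leq ?s (Succ ?t)"
    by (rule LeqI[OF g], rule Eq_trans[OF Succ_Add_eq[OF g, of ?w]], rule Eq_Succ) simp
  then show "?\<Gamma> \<turnstile>\<^sub>i subst shift (Leq s (Succ t))" by simp
qed

text \<open>Case distinction on the witness for \<open>s \<le> t + 1\<close>: zero gives equality,
  and a successor can be cancelled against that of \<open>t + 1\<close>.\<close>

lemma Leq_SuccD:
  assumes \<Gamma>: "arith \<Gamma>" and leq: "\<Gamma> \<turnstile>\<^sub>i Leq s (Succ t)"
  shows "\<Gamma> \<turnstile>\<^sub>i Or (Leq s t) (Eq s (Succ t))"
proof (rule LeqE[OF \<Gamma> leq])
  let ?s = "tsubst shift s" and ?t = "tsubst shift t" and ?w = "Var 0"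
  let ?\<Gamma> = "insert (Eq (Add ?w ?s) (Succ ?t)) (subst shift ` \<Gamma>)"
  have g: "arith ?\<Gamma>" using \<Gamma> by simp
  have "?\<Gamma> \<turnstile>\<^sub>i Or (Leq ?s ?t) (Eq ?s (Succ ?t))"
  proof (rule arith_cases[OF g, of ?w])
    let ?\<Delta> = "insert (Eq ?w Zero) ?\<Gamma>"
    have d: "arith ?\<Delta>" using \<Gamma> by simp
    have "?\<Delta> \<turnstile>\<^sub>i Eq (Add ?w ?s) ?s"
      by (rule Eq_trans[OF Eq_Add[OF iprov_Assm iprov.EqRefl] Zero_Add_eq[OF d]])
    then have "?\<Delta> \<turnstile>\<^sub>i Eq ?s (Succ ?t)" by (rule Eq_trans[OF Eq_sym iprov_Assm2])
    then show "?\<Delta> \<turnstile>\<^sub>i Or (Leq ?s ?t) (Eq ?s (Succ ?t))" by (rule iprov.OrI2)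
  next
    let ?s' = "tsubst shift ?s" and ?t' = "tsubst shift ?t" and ?w = "Var 1" and ?v = "Var 0"
    let ?\<Delta> = "insert (Eq (tsubst shift (Var 0)) (Succ ?v)) (subst shift ` ?\<Gamma>)"
    have d: "arith ?\<Delta>" using \<Gamma> by simp
    have "?\<Delta> \<turnstile>\<^sub>i Eq ?w (Succ ?v)" by simp
    then have "?\<Delta> \<turnstile>\<^sub>i Eq (Add ?w ?s') (Add (Succ ?v) ?s')" by (rule Eq_Add[OF _ iprov.EqRefl])
    from Eq_trans[OF this Succ_Add_eq[OF d]]
    have "?\<Delta> \<turnstile>\<^sub>i Eq (Add ?w ?s') (Succ (Add ?v ?s'))" .
    moreover have "?\<Delta> \<turnstile>\<^sub>i Eq (Add ?w ?s') (Succ ?t')" by (rule iprov.Assm) simp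
    ultimately have "?\<Delta> \<turnstile>\<^sub>i Eq (Succ (Add ?v ?s')) (Succ ?t')"
      by (rule Eq_trans[OF Eq_sym])
    then have "?\<Delta> \<turnstile>\<^sub>i Leq ?s' ?t'" by (rule LeqI[OF d Succ_injectD[OF d]])
    then have "?\<Delta> \<turnstile>\<^sub>i Or (Leq ?s' ?t') (Eq ?s' (Succ ?t'))" by (rule iprov.OrI1)
    then show "?\<Delta> \<turnstile>\<^sub>i subst shift (Or (Leq ?s ?t) (Eq ?s (Succ ?t)))" by simp
  qed
  then show "insert (Eq (Add ?w ?s) (tsubst shift (Succ t))) (subst shift ` \<Gamma>)
      \<turnstile>\<^sub>i subst shift (Or (Leq s t) (Eq s (Succ t)))" by simp
qed

lemma Leq_SuccE:
  assumes "arith \<Gamma>" "\<Gamma> \<turnstile>\<^sub>i Leq s (Succ t)"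
    and "insert (Leq s t) \<Gamma> \<turnstile>\<^sub>i C" "insert (Eq s (Succ t)) \<Gamma> \<turnstile>\<^sub>i C"
  shows "\<Gamma> \<turnstile>\<^sub>i C"
  by (rule iprov.OrE[OF Leq_SuccD[OF assms(1,2)] assms(3,4)])

text \<open>Adding the two witnesses would call for associativity of addition. Induction on
  \<open>u\<close> lets the upper bound grow by one successor at a time instead.\<close>

lemma Leq_trans:
  assumes \<Gamma>: "arith \<Gamma>" and st: "\<Gamma> \<turnstile>\<^sub>i Leq s t" and tu: "\<Gamma> \<turnstile>\<^sub>i Leq t u"
  shows "\<Gamma> \<turnstile>\<^sub>i Leq s u"
proof -
  let ?s = "tsubst shift s" and ?t = "tsubst shift t"
  let ?A = "Imp (Leq ?t (Var 0)) (Leq ?s (Var 0))"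
  have "\<Gamma> \<turnstile>\<^sub>i subst (inst u) ?A"
  proof (rule arith_induct[OF \<Gamma>])
    let ?\<Delta> = "insert (Leq t Zero) \<Gamma>"
    have "?\<Delta> \<turnstile>\<^sub>i Eq t Zero" by (rule Leq_ZeroD) (simp_all add: \<Gamma>)
    then have "?\<Delta> \<turnstile>\<^sub>i Leq s Zero" by (rule Leq_Eq_right[OF iprov_weaken[OF st]])
    then show "\<Gamma> \<turnstile>\<^sub>i subst (inst Zero) ?A" by (simp add: iprov.ImpI)
    let ?\<Gamma> = "insert ?A (subst shift ` \<Gamma>)"
    let ?\<Delta> = "insert (Leq ?t (Succ (Var 0))) ?\<Gamma>"
    have d: "arith ?\<Delta>" by (simp add: \<Gamma>)
    have "?\<Delta> \<turnstile>\<^sub>i Leq ?s (Succ (Var 0))"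
    proof (rule Leq_SuccE[OF d iprov_Assm])
      show "insert (Leq ?t (Var 0)) ?\<Delta> \<turnstile>\<^sub>i Leq ?s (Succ (Var 0))"
        by (rule Leq_SuccI, simp add: \<Gamma>, rule iprov.ImpE[OF iprov_Assm3 iprov_Assm])
      have "subst shift ` \<Gamma> \<turnstile>\<^sub>i Leq ?s ?t" using iprov_subst[OF st, of shift] by simp
      then have "insert (Eq ?t (Succ (Var 0))) ?\<Delta> \<turnstile>\<^sub>i Leq ?s ?t" by (rule iprov_mono) auto
      then show "insert (Eq ?t (Succ (Var 0))) ?\<Delta> \<turnstile>\<^sub>i Leq ?s (Succ (Var 0))"
        by (rule Leq_Eq_right) simp
    qed
    then have "?\<Gamma> \<turnstile>\<^sub>i Imp (Leq ?t (Succ (Var 0))) (Leq ?s (Succ (Var 0)))" by (rule iprov.ImpI)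
    then show "?\<Gamma> \<turnstile>\<^sub>i subst (case_nat (Succ (Var 0)) shift) ?A" by simp
  qed
  then have "\<Gamma> \<turnstile>\<^sub>i Imp (Leq t u) (Leq s u)" by simp
  from this tu show ?thesis by (rule iprov.ImpE)
qed

text \<open>Induction on \<open>t\<close>. If \<open>t + 1 \<le> s\<close>, the difference of the
  two is zero or a successor, and this decides whether \<open>s\<close> equals \<open>t + 1\<close>
  or exceeds it.\<close>

lemma Leq_linear:
  assumes \<Gamma>: "arith \<Gamma>"
  shows "\<Gamma> \<turnstile>\<^sub>i Or (Leq s t) (Leq (Succ t) s)"
proof -
  let ?s = "tsubst shift s" and ?v = "Var 0"
  let ?A = "Or (Leq ?s ?v) (Leq (Succ ?v) ?s)"
  have "\<Gamma> \<turnstile>\<^sub>i subst (inst t) ?A"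
  proof (rule arith_induct[OF \<Gamma>])
    have "\<Gamma> \<turnstile>\<^sub>i Or (Leq s Zero) (Leq (Succ Zero) s)"
    proof (rule arith_cases[OF \<Gamma>, of s])
      let ?\<Delta> = "insert (Eq s Zero) \<Gamma>"
      show "?\<Delta> \<turnstile>\<^sub>i Or (Leq s Zero) (Leq (Succ Zero) s)"
        by (rule iprov.OrI1, rule Leq_Eq_left[OF Leq_Zero_left Eq_sym]) (simp_all add: \<Gamma>)
      let ?\<Delta> = "insert (Eq ?s (Succ ?v)) (subst shift ` \<Gamma>)"
      have d: "arith ?\<Delta>" by (simp add: \<Gamma>)
      have "?\<Delta> \<turnstile>\<^sub>i Eq (Add ?v (Succ Zero)) (Succ ?v)"
        by (rule Eq_trans[OF Add_Succ_eq[OF d]], rule Eq_Succ, rule Add_Zero_eq[OF d])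
      then have "?\<Delta> \<turnstile>\<^sub>i Leq (Succ Zero) ?s"
        by (rule LeqI[OF d Eq_trans[OF _ Eq_sym[OF iprov_Assm]]])
      then show "?\<Delta> \<turnstile>\<^sub>i subst shift (Or (Leq s Zero) (Leq (Succ Zero) s))"
        by (simp add: iprov.OrI2)
    qed
    then show "\<Gamma> \<turnstile>\<^sub>i subst (inst Zero) ?A" by simp
    let ?\<Gamma> = "insert ?A (subst shift ` \<Gamma>)"
    let ?C = "Or (Leq ?s (Succ ?v)) (Leq (Succ (Succ ?v)) ?s)"
    have g: "arith ?\<Gamma>" by (simp add: \<Gamma>)
    have "?\<Gamma> \<turnstile>\<^sub>i ?C"
    proof (rule iprov.OrE[OF iprov_Assm])
      show "insert (Leq ?s ?v) ?\<Gamma> \<turnstile>\<^sub>i ?C"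
        by (rule iprov.OrI1, rule Leq_SuccI) (simp_all add: \<Gamma>)
      let ?\<Delta> = "insert (Leq (Succ ?v) ?s) ?\<Gamma>"
      have d: "arith ?\<Delta>" by (simp add: \<Gamma>)
      let ?s = "tsubst shift ?s" and ?v = "Var 1" and ?w = "Var 0"
      let ?\<Delta>1 = "insert (Eq (Add ?w (Succ ?v)) ?s) (subst shift ` ?\<Delta>)"
      let ?C' = "Or (Leq ?s (Succ ?v)) (Leq (Succ (Succ ?v)) ?s)"
      have d1: "arith ?\<Delta>1" by (simp add: \<Gamma>)
      have "?\<Delta>1 \<turnstile>\<^sub>i ?C'"
      proof (rule arith_cases[OF d1, of ?w])
        let ?\<Delta>2 = "insert (Eq ?w Zero) ?\<Delta>1"
        have d2: "arith ?\<Delta>2" by (simp add: \<Gamma>)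
        have "?\<Delta>2 \<turnstile>\<^sub>i Eq (Add ?w (Succ ?v)) (Succ ?v)"
          by (rule Eq_trans[OF Eq_Add[OF iprov_Assm iprov.EqRefl] Zero_Add_eq[OF d2]])
        then have "?\<Delta>2 \<turnstile>\<^sub>i Eq ?s (Succ ?v)" by (rule Eq_trans[OF Eq_sym[OF iprov_Assm2]])
        then have "?\<Delta>2 \<turnstile>\<^sub>i Leq ?s (Succ ?v)" by (rule Leq_Eq_left[OF Leq_refl[OF d2] Eq_sym])
        then show "?\<Delta>2 \<turnstile>\<^sub>i ?C'" by (rule iprov.OrI1)
      next
        let ?s' = "tsubst shift ?s" and ?v' = "Var 2" and ?w' = "Var 1" and ?x = "Var 0"
        let ?\<Delta>2 = "insert (Eq (tsubst shift ?w) (Succ ?x)) (subst shift ` ?\<Delta>1)"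
        have d2: "arith ?\<Delta>2" by (simp add: \<Gamma>)
        have "?\<Delta>2 \<turnstile>\<^sub>i Eq ?w' (Succ ?x)" by simp
        then have "?\<Delta>2 \<turnstile>\<^sub>i Eq (Add ?w' (Succ ?v')) (Succ (Add ?x (Succ ?v')))"
          by (rule Eq_trans[OF Eq_Add[OF _ iprov.EqRefl] Succ_Add_eq[OF d2]])
        moreover have "?\<Delta>2 \<turnstile>\<^sub>i Eq (Add ?w' (Succ ?v')) ?s'"
          by (rule iprov.Assm) (simp add: numeral_2_eq_2)
        ultimately have "?\<Delta>2 \<turnstile>\<^sub>i Eq (Succ (Add ?x (Succ ?v'))) ?s'"
          by (rule Eq_trans[OF Eq_sym])
        then have "?\<Delta>2 \<turnstile>\<^sub>i Eq (Add ?x (Succ (Succ ?v'))) ?s'"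
          by (rule Eq_trans[OF Add_Succ_eq[OF d2]])
        then have "?\<Delta>2 \<turnstile>\<^sub>i Leq (Succ (Succ ?v')) ?s'" by (rule LeqI[OF d2])
        then show "?\<Delta>2 \<turnstile>\<^sub>i subst shift ?C'"
          by (simp add: numeral_2_eq_2 iprov.OrI2)
      qed
      then have *: "insert (Eq (Add (Var 0) (tsubst shift (Succ (Var 0)))) ?s) (subst shift ` ?\<Delta>) \<turnstile>\<^sub>i subst shift ?C"
        by simp
      show "?\<Delta> \<turnstile>\<^sub>i ?C"
        by (rule LeqE[OF d iprov_Assm *])
    qed
    then show "?\<Gamma> \<turnstile>\<^sub>i subst (case_nat (Succ (Var 0)) shift) ?A" by simp
  qed
  then show ?thesis by simp
qed

section \<open>Bounded existential quantifiers\<close>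

definition bex :: "tm \<Rightarrow> fm \<Rightarrow> fm" where
  "bex t B = Exists (And (Leq (Var 0) (tsubst shift t)) B)"

lemma subst_bex [simp]: "subst \<sigma> (bex t B) = bex (tsubst \<sigma> t) (subst (up \<sigma>) B)"
  by (simp add: bex_def)

lemma fv_bex: "fv (bex t B) = tfv t \<union> {n. Suc n \<in> fv B}"
  by (auto simp: bex_def fv_tsubst)

lemma bexI:
  assumes "\<Gamma> \<turnstile>\<^sub>i Leq s t" "\<Gamma> \<turnstile>\<^sub>i subst (inst s) B" shows "\<Gamma> \<turnstile>\<^sub>i bex t B"
  unfolding bex_def by (rule iprov.ExistsI[of _ s]) (simp add: assms iprov.AndI)

lemma bexE:
  assumes "\<Gamma> \<turnstile>\<^sub>i bex t B"
    and C: "insert B (insert (Leq (Var 0) (tsubst shift t)) (subst shift ` \<Gamma>)) \<turnstile>\<^sub>i subst shift C"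
  shows "\<Gamma> \<turnstile>\<^sub>i C"
proof (rule iprov.ExistsE[OF assms(1)[unfolded bex_def]])
  let ?L = "Leq (Var 0) (tsubst shift t)"
  let ?\<Gamma> = "insert (And ?L B) (subst shift ` \<Gamma>)"
  have "?\<Gamma> \<turnstile>\<^sub>i ?L" "?\<Gamma> \<turnstile>\<^sub>i B"
    using iprov.AndE1[OF iprov_Assm] iprov.AndE2[OF iprov_Assm] by blast+
  then show "?\<Gamma> \<turnstile>\<^sub>i subst shift C"
    by (intro iprov_cut[OF C]) (auto intro: iprov.Assm)
qed

lemma Eq_inst:
  assumes "\<Gamma> \<turnstile>\<^sub>i Eq (Var 0) (tsubst shift t)" "\<Gamma> \<turnstile>\<^sub>i B"
  shows "\<Gamma> \<turnstile>\<^sub>i subst shift (subst (inst t) B)"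
\<comment> \<open>\<open>up shift\<close> keeps variable 0 of \<open>B\<close> as the place to be
  rewritten and moves the parameters of \<open>B\<close> past the eigenvariable, which then enters
  as the term \<open>Var 0\<close>.\<close>
proof (rule eq_rewrite[OF assms(1), of "subst (up shift) B"])
  have "tsubst (inst (Var 0)) (up shift n) = Var n" for n
    by (cases n) auto
  then show "\<Gamma> \<turnstile>\<^sub>i subst (inst (Var 0)) (subst (up shift) B)"
    using assms(2) by simp
  have "tsubst (inst (tsubst shift t)) (up shift n) = tsubst shift (inst t n)" for n
    by (cases n) auto
  then show "subst (inst (tsubst shift t)) (subst (up shift) B) = subst shift (subst (inst t) B)"
    by simp
qed

lemma bex_ZeroD:
  assumes \<Gamma>: "arith \<Gamma>" and "\<Gamma> \<turnstile>\<^sub>i bex Zero B" shows "\<Gamma> \<turnstile>\<^sub>i subst (inst Zero) B"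
proof (rule bexE[OF assms(2)])
  let ?\<Gamma> = "insert B (insert (Leq (Var 0) (tsubst shift Zero)) (subst shift ` \<Gamma>))"
  have "?\<Gamma> \<turnstile>\<^sub>i Eq (Var 0) Zero"
    by (rule Leq_ZeroD) (simp_all add: \<Gamma>)
  then show "?\<Gamma> \<turnstile>\<^sub>i subst shift (subst (inst Zero) B)"
    by (intro Eq_inst) (simp_all del: subst_subst)
qed

lemma bex_SuccD:
  assumes \<Gamma>: "arith \<Gamma>" and "\<Gamma> \<turnstile>\<^sub>i bex (Succ t) B"
  shows "\<Gamma> \<turnstile>\<^sub>i Or (bex t B) (subst (inst (Succ t)) B)"
proof (rule bexE[OF assms(2)])
  let ?C = "Or (bex t B) (subst (inst (Succ t)) B)"
  let ?\<Gamma> = "insert B (insert (Leq (Var 0) (tsubst shift (Succ t))) (subst shift ` \<Gamma>))"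
  have g: "arith ?\<Gamma>" by (simp add: \<Gamma>)
  have "?\<Gamma> \<turnstile>\<^sub>i Leq (Var 0) (Succ (tsubst shift t))" by simp
  then show "?\<Gamma> \<turnstile>\<^sub>i subst shift ?C"
  proof (rule Leq_SuccE[OF g])
    let ?\<Delta> = "insert (Leq (Var 0) (tsubst shift t)) ?\<Gamma>"
    have "?\<Delta> \<turnstile>\<^sub>i bex (tsubst shift t) (subst (up shift) B)"
    proof (rule bexI[OF iprov_Assm])
      have "tsubst (inst (Var 0)) (up shift n) = Var n" for n
        by (cases n) auto
      then show "?\<Delta> \<turnstile>\<^sub>i subst (inst (Var 0)) (subst (up shift) B)"
        by simp
    qed
    then show "?\<Delta> \<turnstile>\<^sub>i subst shift ?C" by (simp add: iprov.OrI1)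
    let ?\<Delta> = "insert (Eq (Var 0) (Succ (tsubst shift t))) ?\<Gamma>"
    have "?\<Delta> \<turnstile>\<^sub>i subst shift (subst (inst (Succ t)) B)"
      by (rule Eq_inst) simp_all
    then show "?\<Delta> \<turnstile>\<^sub>i subst shift ?C"
      unfolding subst.simps by (rule iprov.OrI2)
  qed
qed

lemma bex_mono:
  assumes \<Gamma>: "arith \<Gamma>" and st: "\<Gamma> \<turnstile>\<^sub>i Leq s t" and s: "\<Gamma> \<turnstile>\<^sub>i bex s B"
  shows "\<Gamma> \<turnstile>\<^sub>i bex t B"
proof (rule bexE[OF s])
  let ?\<Gamma> = "insert B (insert (Leq (Var 0) (tsubst shift s)) (subst shift ` \<Gamma>))"
  have "?\<Gamma> \<turnstile>\<^sub>i Leq (tsubst shift s) (tsubst shift t)"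
    using iprov_subst[OF st, of shift] by (simp add: iprov_weaken)
  then have "?\<Gamma> \<turnstile>\<^sub>i Leq (Var 0) (tsubst shift t)"
    by (rule Leq_trans[rotated 2]) (simp_all add: \<Gamma>)
  moreover have "tsubst (inst (Var 0)) (up shift n) = Var n" for n
    by (cases n) auto
  ultimately show "?\<Gamma> \<turnstile>\<^sub>i subst shift (bex t B)"
    by (simp add: bexI[of _ "Var 0"])
qed

lemma bex_Leq_SuccI:
  assumes \<Gamma>: "arith \<Gamma>" and s: "\<Gamma> \<turnstile>\<^sub>i bex t B"
  shows "\<Gamma> \<turnstile>\<^sub>i bex (Succ t) B"
  by (rule bex_mono[OF \<Gamma> _ s]) (simp add: Leq_SuccI Leq_refl \<Gamma>)

section \<open>Formulas for which HA proves excluded middle\<close>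

abbreviation Dec :: "fm \<Rightarrow> fm" where "Dec A \<equiv> Or A (Neg A)"

lemma Dec_cases:
  "\<Gamma> \<turnstile>\<^sub>i Dec A \<Longrightarrow> insert A \<Gamma> \<turnstile>\<^sub>i C \<Longrightarrow> insert (Neg A) \<Gamma> \<turnstile>\<^sub>i C \<Longrightarrow> \<Gamma> \<turnstile>\<^sub>i C"
  by (rule iprov.OrE)

lemma Dec_Imp:
  assumes "\<Gamma> \<turnstile>\<^sub>i Dec A" "\<Gamma> \<turnstile>\<^sub>i Dec B" shows "\<Gamma> \<turnstile>\<^sub>i Dec (Imp A B)"
proof (rule Dec_cases[OF assms(1)])
  show "insert A \<Gamma> \<turnstile>\<^sub>i Dec (Imp A B)"
  proof (rule Dec_cases[OF iprov_weaken[OF assms(2)]])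
    show "insert B (insert A \<Gamma>) \<turnstile>\<^sub>i Dec (Imp A B)"
      by (rule iprov.OrI1, rule iprov.ImpI) simp
    show "insert (Neg B) (insert A \<Gamma>) \<turnstile>\<^sub>i Dec (Imp A B)"
      by (rule iprov.OrI2, rule iprov.ImpI, rule iprov.ImpE[OF iprov_Assm2],
          rule iprov.ImpE[OF iprov_Assm]) simp
  qed
  show "insert (Neg A) \<Gamma> \<turnstile>\<^sub>i Dec (Imp A B)"
    by (rule iprov.OrI1, rule iprov.ImpI, rule NegE[OF iprov_Assm2 iprov_Assm])
qed

lemma Dec_Bot: "\<Gamma> \<turnstile>\<^sub>i Dec Bot"
  by (rule iprov.OrI2, rule iprov.ImpI) simp

lemma Dec_And:
  assumes "\<Gamma> \<turnstile>\<^sub>i Dec A" "\<Gamma> \<turnstile>\<^sub>i Dec B" shows "\<Gamma> \<turnstile>\<^sub>i Dec (And A B)"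
proof (rule Dec_cases[OF assms(1)])
  show "insert A \<Gamma> \<turnstile>\<^sub>i Dec (And A B)"
  proof (rule Dec_cases[OF iprov_weaken[OF assms(2)]])
    show "insert B (insert A \<Gamma>) \<turnstile>\<^sub>i Dec (And A B)"
      by (rule iprov.OrI1, rule iprov.AndI) simp_all
    show "insert (Neg B) (insert A \<Gamma>) \<turnstile>\<^sub>i Dec (And A B)"
      by (rule iprov.OrI2, rule iprov.ImpI, rule iprov.ImpE[OF iprov_Assm2],
          rule iprov.AndE2[OF iprov_Assm])
  qed
  show "insert (Neg A) \<Gamma> \<turnstile>\<^sub>i Dec (And A B)"
    by (rule iprov.OrI2, rule iprov.ImpI, rule iprov.ImpE[OF iprov_Assm2],
        rule iprov.AndE1[OF iprov_Assm])
qed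

lemma Dec_Or:
  assumes "\<Gamma> \<turnstile>\<^sub>i Dec A" "\<Gamma> \<turnstile>\<^sub>i Dec B" shows "\<Gamma> \<turnstile>\<^sub>i Dec (Or A B)"
proof (rule Dec_cases[OF assms(1)])
  show "insert A \<Gamma> \<turnstile>\<^sub>i Dec (Or A B)"
    by (rule iprov.OrI1, rule iprov.OrI1) simp
  show "insert (Neg A) \<Gamma> \<turnstile>\<^sub>i Dec (Or A B)"
  proof (rule Dec_cases[OF iprov_weaken[OF assms(2)]])
    show "insert B (insert (Neg A) \<Gamma>) \<turnstile>\<^sub>i Dec (Or A B)"
      by (rule iprov.OrI1, rule iprov.OrI2) simp_all
    let ?\<Gamma> = "insert (Or A B) (insert (Neg B) (insert (Neg A) \<Gamma>))"
    have "insert A ?\<Gamma> \<turnstile>\<^sub>i Bot" "insert B ?\<Gamma> \<turnstile>\<^sub>i Bot"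
      by (rule iprov.ImpE[of _ A] iprov.ImpE[of _ B]; rule iprov.Assm; simp)+
    then have "?\<Gamma> \<turnstile>\<^sub>i Bot" by (rule iprov.OrE[OF iprov_Assm])
    then show "insert (Neg B) (insert (Neg A) \<Gamma>) \<turnstile>\<^sub>i Dec (Or A B)"
      by (intro iprov.OrI2 iprov.ImpI)
  qed
qed

lemma Dec_iff:
  assumes "\<Gamma> \<turnstile>\<^sub>i Dec A" "insert A \<Gamma> \<turnstile>\<^sub>i B" "insert B \<Gamma> \<turnstile>\<^sub>i A" shows "\<Gamma> \<turnstile>\<^sub>i Dec B"
proof (rule Dec_cases[OF assms(1)])
  show "insert A \<Gamma> \<turnstile>\<^sub>i Dec B" using assms(2) by (rule iprov.OrI1)
  have "insert B (insert (Neg A) \<Gamma>) \<turnstile>\<^sub>i A" by (rule iprov_mono[OF assms(3)]) auto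
  then show "insert (Neg A) \<Gamma> \<turnstile>\<^sub>i Dec B"
    by (intro iprov.OrI2 iprov.ImpI iprov.ImpE[OF iprov_Assm2])
qed

text \<open>Induction on one side, with the other side universally quantified: for two successors
  the hypothesis is applied to the predecessor of the other side.\<close>

lemma Dec_Eq:
  assumes \<Gamma>: "arith \<Gamma>" shows "\<Gamma> \<turnstile>\<^sub>i Dec (Eq s t)"
proof -
  let ?A = "Forall (Dec (Eq (Var 1) (Var 0)))"
  have "\<Gamma> \<turnstile>\<^sub>i subst (inst s) ?A"
  proof (rule arith_induct[OF \<Gamma>])
    let ?\<Gamma> = "subst shift ` \<Gamma>"
    have g: "arith ?\<Gamma>" by (simp add: \<Gamma>)
    have "?\<Gamma> \<turnstile>\<^sub>i Dec (Eq Zero (Var 0))"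
    proof (rule arith_cases[OF g, of "Var 0"])
      show "insert (Eq (Var 0) Zero) ?\<Gamma> \<turnstile>\<^sub>i Dec (Eq Zero (Var 0))"
        by (rule iprov.OrI1, rule Eq_sym) simp
      let ?\<Delta> = "insert (Eq Zero (Var 1)) (insert (Eq (Var 1) (Succ (Var 0))) (subst shift ` ?\<Gamma>))"
      have d: "arith ?\<Delta>" by (simp add: \<Gamma>)
      have "?\<Delta> \<turnstile>\<^sub>i Bot"
        by (rule Succ_neq_ZeroD[OF d Eq_sym[OF Eq_trans]], rule iprov_Assm, rule iprov_Assm2)
      then show "insert (Eq (tsubst shift (Var 0)) (Succ (Var 0))) (subst shift ` ?\<Gamma>)
          \<turnstile>\<^sub>i subst shift (Dec (Eq Zero (Var 0)))" by (simp add: iprov.OrI2 iprov.ImpI)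
    qed
    then show "\<Gamma> \<turnstile>\<^sub>i subst (inst Zero) ?A" by (simp add: iprov.ForallI)
    let ?\<Gamma> = "subst shift ` insert ?A (subst shift ` \<Gamma>)"
    have g: "arith ?\<Gamma>" by (simp add: \<Gamma>)
    have "?\<Gamma> \<turnstile>\<^sub>i Dec (Eq (Succ (Var 1)) (Var 0))"
    proof (rule arith_cases[OF g, of "Var 0"])
      let ?\<Delta> = "insert (Eq (Succ (Var 1)) (Var 0)) (insert (Eq (Var 0) Zero) ?\<Gamma>)"
      have d: "arith ?\<Delta>" by (simp add: \<Gamma>)
      have "?\<Delta> \<turnstile>\<^sub>i Bot"
        by (rule Succ_neq_ZeroD[OF d Eq_trans], rule iprov_Assm, rule iprov_Assm2)
      then show "insert (Eq (Var 0) Zero) ?\<Gamma> \<turnstile>\<^sub>i Dec (Eq (Succ (Var 1)) (Var 0))"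
        by (simp add: iprov.OrI2 iprov.ImpI)
      let ?\<Delta> = "insert (Eq (Var 1) (Succ (Var 0))) (subst shift ` ?\<Gamma>)"
      have d: "arith ?\<Delta>" by (simp add: \<Gamma>)
      \<comment> \<open>The context has been shifted twice since the hypothesis was assumed, so the
        induction variable has index 3 below the quantifier.\<close>
      have "?\<Delta> \<turnstile>\<^sub>i Forall (Dec (Eq (Var 3) (Var 0)))"
        by (rule iprov.Assm) (simp add: numeral_3_eq_3)
      from iprov.ForallE[OF this, of "Var 0"]
      have dec: "?\<Delta> \<turnstile>\<^sub>i Dec (Eq (Var 2) (Var 0))" by (simp add: numeral_3_eq_3 numeral_2_eq_2)
      have "?\<Delta> \<turnstile>\<^sub>i Dec (Eq (Succ (Var 2)) (Var 1))"
      proof (rule Dec_iff[OF dec])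
        show "insert (Eq (Var 2) (Var 0)) ?\<Delta> \<turnstile>\<^sub>i Eq (Succ (Var 2)) (Var 1)"
          by (rule Eq_trans[OF Eq_Succ[OF iprov_Assm] Eq_sym[OF iprov_Assm2]])
        show "insert (Eq (Succ (Var 2)) (Var 1)) ?\<Delta> \<turnstile>\<^sub>i Eq (Var 2) (Var 0)"
          by (rule Succ_injectD, simp add: \<Gamma>, rule Eq_trans[OF iprov_Assm iprov_Assm2])
      qed
      then show "insert (Eq (tsubst shift (Var 0)) (Succ (Var 0))) (subst shift ` ?\<Gamma>)
          \<turnstile>\<^sub>i subst shift (Dec (Eq (Succ (Var 1)) (Var 0)))"
        by (simp add: numeral_2_eq_2)
    qed
    then show "insert ?A (subst shift ` \<Gamma>) \<turnstile>\<^sub>i subst (case_nat (Succ (Var 0)) shift) ?A"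
      by (simp add: iprov.ForallI)
  qed
  then have "\<Gamma> \<turnstile>\<^sub>i Forall (Dec (Eq (tsubst shift s) (Var 0)))" by simp
  from iprov.ForallE[OF this, of t] show ?thesis by simp
qed

text \<open>The axioms are closed, so theorems of HA with free variables may be instantiated at will
  and moved to any arithmetical context. Decidability assumptions are stated over
  \<open>peano_axioms\<close> to profit from this.\<close>

lemma peano_axioms_subst:
  assumes "peano_axioms \<turnstile>\<^sub>i A" "arith \<Gamma>" shows "\<Gamma> \<turnstile>\<^sub>i subst \<sigma> A"
  using iprov_subst[OF assms(1), of \<sigma>]
  by (intro arith_cut[OF assms(2)]) (simp add: subst_image_sentences peano_axioms_sentence)

text \<open>Induction on the bound: at zero the quantifier reduces to one instance of
  \<open>B\<close>, and at a successor to a disjunction of the smaller quantifier with one more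
  instance.\<close>

lemma Dec_bex:
  assumes B: "peano_axioms \<turnstile>\<^sub>i Dec B" and \<Gamma>: "arith \<Gamma>"
  shows "\<Gamma> \<turnstile>\<^sub>i Dec (bex t B)"
proof -
  have B: "\<Delta> \<turnstile>\<^sub>i Dec (subst \<sigma> B)" if "arith \<Delta>" for \<Delta> \<sigma>
    using peano_axioms_subst[OF B that, of \<sigma>] by simp
  \<comment> \<open>Variable 0 outside the quantifier is freed for the bound, on which the induction
    runs.\<close>
  let ?B = "subst (up shift) B"
  let ?A = "Dec (bex (Var 0) ?B)"
  have "\<Gamma> \<turnstile>\<^sub>i subst (inst t) ?A"
  proof (rule arith_induct[OF \<Gamma>])
    have "\<Gamma> \<turnstile>\<^sub>i Dec (bex Zero B)"
    proof (rule Dec_iff[OF B[OF \<Gamma>, of "inst Zero"]])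
      show "insert (subst (inst Zero) B) \<Gamma> \<turnstile>\<^sub>i bex Zero B"
        by (rule bexI[OF Leq_Zero_left iprov_Assm]) (simp add: \<Gamma>)
      show "insert (bex Zero B) \<Gamma> \<turnstile>\<^sub>i subst (inst Zero) B"
        by (rule bex_ZeroD) (simp_all add: \<Gamma>)
    qed
    moreover have "tsubst (up (inst s)) (up shift n) = Var n" for s n by (cases n) auto
    ultimately show "\<Gamma> \<turnstile>\<^sub>i subst (inst Zero) ?A" by simp
    let ?\<Gamma> = "insert ?A (subst shift ` \<Gamma>)"
    have g: "arith ?\<Gamma>" by (simp add: \<Gamma>)
    have "?\<Gamma> \<turnstile>\<^sub>i Dec (bex (Succ (Var 0)) ?B)"
    proof (rule Dec_iff[OF Dec_Or[OF iprov_Assm B[OF g]]])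
      let ?C = "subst (inst (Succ (Var 0))) ?B"
      have C: "subst (\<lambda>n. tsubst (inst (Succ (Var 0))) (up shift n)) B = ?C" by simp
      show "insert (Or (bex (Var 0) ?B) (subst (\<lambda>n. tsubst (inst (Succ (Var 0))) (up shift n)) B)) ?\<Gamma>
          \<turnstile>\<^sub>i bex (Succ (Var 0)) ?B"
        unfolding C
      proof (rule iprov.OrE[OF iprov_Assm])
        show "insert (bex (Var 0) ?B) (insert (Or (bex (Var 0) ?B) ?C) ?\<Gamma>) \<turnstile>\<^sub>i bex (Succ (Var 0)) ?B"
          by (rule bex_Leq_SuccI) (simp_all add: \<Gamma>)
        show "insert ?C (insert (Or (bex (Var 0) ?B) ?C) ?\<Gamma>) \<turnstile>\<^sub>i bex (Succ (Var 0)) ?B"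
          by (rule bexI[OF Leq_refl iprov_Assm]) (simp add: \<Gamma>)
      qed
      show "insert (bex (Succ (Var 0)) ?B) ?\<Gamma> \<turnstile>\<^sub>i
          Or (bex (Var 0) ?B) (subst (\<lambda>n. tsubst (inst (Succ (Var 0))) (up shift n)) B)"
        unfolding C by (rule bex_SuccD) (simp_all add: \<Gamma>)
    qed
    moreover have "tsubst (up (case_nat (Succ (Var 0)) shift)) (up shift n) = up shift n" for n
      by (cases n) auto
    ultimately show "?\<Gamma> \<turnstile>\<^sub>i subst (case_nat (Succ (Var 0)) shift) ?A" by simp
  qed
  moreover have "tsubst (up (inst s)) (up shift n) = Var n" for s n by (cases n) auto
  ultimately show ?thesis by simp
qed

section \<open>Computation with numerals\<close>

lemma Add_numeral:
  "arith \<Gamma> \<Longrightarrow> \<Gamma> \<turnstile>\<^sub>i Eq (Add (numeral_tm m) (numeral_tm n)) (numeral_tm (m + n))"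
  by (induction n) (auto intro: Add_Zero_eq Eq_trans[OF Add_Succ_eq] Eq_Succ)

lemma Mul_numeral:
  assumes "arith \<Gamma>"
  shows "\<Gamma> \<turnstile>\<^sub>i Eq (Mul (numeral_tm m) (numeral_tm n)) (numeral_tm (m * n))"
proof (induction n)
  case 0 show ?case by (simp add: Mul_Zero_eq assms)
next
  case (Suc n)
  have "\<Gamma> \<turnstile>\<^sub>i Eq (Mul (numeral_tm m) (Succ (numeral_tm n))) (Add (numeral_tm (m * n)) (numeral_tm m))"
    by (rule Eq_trans[OF Mul_Succ_eq[OF assms] Eq_Add[OF Suc.IH iprov.EqRefl]])
  from Eq_trans[OF this Add_numeral[OF assms]] show ?case by (simp add: add.commute)
qed

lemma Eq_numeralD:
  "arith \<Gamma> \<Longrightarrow> m \<noteq> n \<Longrightarrow> \<Gamma> \<turnstile>\<^sub>i Eq (numeral_tm m) (numeral_tm n) \<Longrightarrow> \<Gamma> \<turnstile>\<^sub>i C"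
proof (induction m arbitrary: n)
  case 0
  then obtain k where "n = Suc k" by (cases n) auto
  with 0 have "\<Gamma> \<turnstile>\<^sub>i Eq (Succ (numeral_tm k)) Zero" by (simp add: Eq_sym)
  then show ?case by (rule Succ_neq_ZeroD[OF 0(1)])
next
  case (Suc m)
  show ?case
  proof (cases n)
    case 0
    with Suc have "\<Gamma> \<turnstile>\<^sub>i Eq (Succ (numeral_tm m)) Zero" by simp
    then show ?thesis by (rule Succ_neq_ZeroD[OF Suc(2)])
  next
    case (Suc k)
    show ?thesis by (rule Suc.IH[of k])
        (use Suc.prems Suc in \<open>auto intro: Succ_injectD\<close>)
  qed
qed

lemma Leq_numeral: "arith \<Gamma> \<Longrightarrow> m \<le> n \<Longrightarrow> \<Gamma> \<turnstile>\<^sub>i Leq (numeral_tm m) (numeral_tm n)"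
  using LeqI[OF _ Add_numeral[of \<Gamma> "n - m" m]] by simp

primrec teval :: "(nat \<Rightarrow> nat) \<Rightarrow> tm \<Rightarrow> nat" where
  "teval e (Var n) = e n"
| "teval e Zero = 0"
| "teval e (Succ t) = Suc (teval e t)"
| "teval e (Add s t) = teval e s + teval e t"
| "teval e (Mul s t) = teval e s * teval e t"

abbreviation num :: "(nat \<Rightarrow> nat) \<Rightarrow> nat \<Rightarrow> tm" where
  "num e \<equiv> \<lambda>n. numeral_tm (e n)"

lemma teval_numeral: "arith \<Gamma> \<Longrightarrow> \<Gamma> \<turnstile>\<^sub>i Eq (tsubst (num e) t) (numeral_tm (teval e t))"
  by (induction t)
    (auto intro: iprov.EqRefl Eq_Succ Eq_trans[OF Eq_Add Add_numeral] Eq_trans[OF Eq_Mul Mul_numeral])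

section \<open>Relations decided by HA\<close>

text \<open>The clause on \<open>Dec B\<close> is uniform in the variables of \<open>B\<close>; the
  clauses for single environments do not imply it.\<close>

definition represents :: "fm \<Rightarrow> ((nat \<Rightarrow> nat) \<Rightarrow> bool) \<Rightarrow> bool" where
  "represents B Q \<longleftrightarrow> peano_axioms \<turnstile>\<^sub>i Dec B \<and>
     (\<forall>e. (Q e \<longrightarrow> peano_axioms \<turnstile>\<^sub>i subst (num e) B)
       \<and> (\<not> Q e \<longrightarrow> peano_axioms \<turnstile>\<^sub>i Neg (subst (num e) B)))"

lemma representsI:
  assumes "peano_axioms \<turnstile>\<^sub>i Dec B"
    and "\<And>e. Q e \<Longrightarrow> peano_axioms \<turnstile>\<^sub>i subst (num e) B"
    and "\<And>e. \<not> Q e \<Longrightarrow> insert (subst (num e) B) peano_axioms \<turnstile>\<^sub>i Bot"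
  shows "represents B Q"
  using assms by (simp add: represents_def iprov.ImpI)

lemma
  assumes "represents B Q"
  shows represents_Dec: "peano_axioms \<turnstile>\<^sub>i Dec B"
    and represents_true: "Q e \<Longrightarrow> peano_axioms \<turnstile>\<^sub>i subst (num e) B"
    and represents_false: "\<not> Q e \<Longrightarrow> peano_axioms \<turnstile>\<^sub>i Neg (subst (num e) B)"
  using assms by (simp_all add: represents_def)

definition decidable :: "((nat \<Rightarrow> nat) \<Rightarrow> bool) \<Rightarrow> bool" where
  "decidable Q \<longleftrightarrow> (\<exists>B. represents B Q)"

lemma decidable_Eq: "decidable (\<lambda>e. teval e s = teval e t)"
  unfolding decidable_def
proof (intro exI representsI)
  show "peano_axioms \<turnstile>\<^sub>i Dec (Eq s t)" by (simp add: Dec_Eq)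
  fix e
  have s: "\<Gamma> \<turnstile>\<^sub>i Eq (tsubst (num e) s) (numeral_tm (teval e s))"
    and t: "\<Gamma> \<turnstile>\<^sub>i Eq (tsubst (num e) t) (numeral_tm (teval e t))" if "arith \<Gamma>" for \<Gamma>
    using that by (simp_all add: teval_numeral)
  show "peano_axioms \<turnstile>\<^sub>i subst (num e) (Eq s t)" if "teval e s = teval e t"
    using s[OF arith_peano_axioms] Eq_sym[OF t[OF arith_peano_axioms]] that
    by (simp add: Eq_trans[of _ _ "numeral_tm (teval e t)"])
  show "insert (subst (num e) (Eq s t)) peano_axioms \<turnstile>\<^sub>i Bot" if "teval e s \<noteq> teval e t"
  proof -
    let ?\<Gamma> = "insert (subst (num e) (Eq s t)) peano_axioms"
    have g: "arith ?\<Gamma>" by simp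
    have "?\<Gamma> \<turnstile>\<^sub>i Eq (tsubst (num e) s) (tsubst (num e) t)" by simp
    then have "?\<Gamma> \<turnstile>\<^sub>i Eq (numeral_tm (teval e s)) (numeral_tm (teval e t))"
      by (rule Eq_trans[OF Eq_sym[OF s[OF g]] Eq_trans[OF _ t[OF g]]])
    then show "?\<Gamma> \<turnstile>\<^sub>i Bot" by (rule Eq_numeralD[OF g that])
  qed
qed

lemma decidable_Not:
  assumes "decidable Q" shows "decidable (\<lambda>e. \<not> Q e)"
proof -
  obtain B where B: "represents B Q" using assms by (auto simp: decidable_def)
  have "represents (Neg B) (\<lambda>e. \<not> Q e)"
  proof (rule representsI)
    show "peano_axioms \<turnstile>\<^sub>i Dec (Neg B)"
      using represents_Dec[OF B] by (rule Dec_Imp) (rule Dec_Bot)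
    show "peano_axioms \<turnstile>\<^sub>i subst (num e) (Neg B)" if "\<not> Q e" for e
      using represents_false[OF B that] by simp
    show "insert (subst (num e) (Neg B)) peano_axioms \<turnstile>\<^sub>i Bot" if "\<not> \<not> Q e" for e
      unfolding subst.simps
      by (rule iprov.ImpE[OF iprov_Assm iprov_weaken[OF represents_true[OF B]]]) (use that in simp)
  qed
  then show ?thesis by (auto simp: decidable_def)
qed

lemma decidable_conj:
  assumes "decidable P" "decidable Q" shows "decidable (\<lambda>e. P e \<and> Q e)"
proof -
  obtain A B where A: "represents A P" and B: "represents B Q"
    using assms by (auto simp: decidable_def)
  have "represents (And A B) (\<lambda>e. P e \<and> Q e)"
  proof (rule representsI)
    show "peano_axioms \<turnstile>\<^sub>i Dec (And A B)"
      by (rule Dec_And[OF represents_Dec[OF A] represents_Dec[OF B]])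
    fix e
    show "peano_axioms \<turnstile>\<^sub>i subst (num e) (And A B)" if "P e \<and> Q e"
      using represents_true[OF A] represents_true[OF B] that by (simp add: iprov.AndI)
    let ?\<Gamma> = "insert (And (subst (num e) A) (subst (num e) B)) peano_axioms"
    have "?\<Gamma> \<turnstile>\<^sub>i Bot" if "\<not> P e"
      by (rule iprov.ImpE[OF iprov_weaken[OF represents_false[of _ P, OF A that]] iprov.AndE1[OF iprov_Assm]])
    moreover have "?\<Gamma> \<turnstile>\<^sub>i Bot" if "\<not> Q e"
      by (rule iprov.ImpE[OF iprov_weaken[OF represents_false[of _ Q, OF B that]] iprov.AndE2[OF iprov_Assm]])
    ultimately show "insert (subst (num e) (And A B)) peano_axioms \<turnstile>\<^sub>i Bot" if "\<not> (P e \<and> Q e)"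
      using that by auto
  qed
  then show ?thesis by (auto simp: decidable_def)
qed

text \<open>The predicates themselves are classical, so De Morgan's law may be applied to them
  rather than to the formulas.\<close>

lemma decidable_disj:
  assumes "decidable P" "decidable Q" shows "decidable (\<lambda>e. P e \<or> Q e)"
  using decidable_Not[OF decidable_conj[OF decidable_Not[OF assms(1)] decidable_Not[OF assms(2)]]]
  by simp

lemma bex_numeralI:
  assumes "arith \<Gamma>" "k \<le> n" "\<Gamma> \<turnstile>\<^sub>i subst (inst (numeral_tm k)) B"
  shows "\<Gamma> \<turnstile>\<^sub>i bex (numeral_tm n) B"
  by (rule bexI[OF Leq_numeral[OF assms(1,2)] assms(3)])

lemma bex_numeralD:
  assumes "arith \<Gamma>" "\<And>k. k \<le> n \<Longrightarrow> \<Gamma> \<turnstile>\<^sub>i Neg (subst (inst (numeral_tm k)) B)"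
  shows "\<Gamma> \<turnstile>\<^sub>i Neg (bex (numeral_tm n) B)"
  using assms(2)
proof (induction n)
  case 0
  show ?case
    by (rule iprov.ImpI, rule iprov.ImpE[OF iprov_weaken[OF 0[of 0]]])
      (use bex_ZeroD[of "insert (bex Zero B) \<Gamma>" B] assms(1) in simp_all)
next
  case (Suc n)
  let ?\<Gamma> = "insert (bex (Succ (numeral_tm n)) B) \<Gamma>"
  have "?\<Gamma> \<turnstile>\<^sub>i Bot"
  proof (rule iprov.OrE[OF bex_SuccD])
    show "insert (bex (numeral_tm n) B) ?\<Gamma> \<turnstile>\<^sub>i Bot"
      by (rule iprov.ImpE[OF _ iprov_Assm], rule iprov_mono[OF Suc.IH]) (auto intro: Suc.prems)
    show "insert (subst (inst (Succ (numeral_tm n))) B) ?\<Gamma> \<turnstile>\<^sub>i Bot"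
      by (rule iprov.ImpE[OF _ iprov_Assm], rule iprov_mono[OF Suc.prems[of "Suc n", simplified]]) auto
  qed (simp_all add: assms(1))
  then show ?case by (simp add: iprov.ImpI)
qed

lemma decidable_bex:
  assumes "decidable Q" shows "decidable (\<lambda>e. \<exists>x\<le>e i. Q (case_nat x e))"
proof -
  obtain B where B: "represents B Q" using assms by (auto simp: decidable_def)
  have "represents (bex (Var i) B) (\<lambda>e. \<exists>x\<le>e i. Q (case_nat x e))"
  proof (rule representsI)
    show "peano_axioms \<turnstile>\<^sub>i Dec (bex (Var i) B)"
      by (rule Dec_bex[OF represents_Dec[OF B]]) simp
    fix e
    let ?B = "subst (up (num e)) B"
    \<comment> \<open>Numerals for the parameters followed by \<open>k\<close> for the bound
      variable amount to evaluation in the environment extended by \<open>k\<close>.\<close>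
    have inst: "subst (inst (numeral_tm k)) ?B = subst (num (case_nat k e)) B" for k
      unfolding subst_subst
    proof (rule subst_eqI)
      show "tsubst (inst (numeral_tm k)) (up (num e) n) = numeral_tm (case_nat k e n)" for n
        by (cases n) auto
    qed
    show "peano_axioms \<turnstile>\<^sub>i subst (num e) (bex (Var i) B)" if Q: "\<exists>x\<le>e i. Q (case_nat x e)"
    proof -
      obtain k where k: "k \<le> e i" "Q (case_nat k e)" using Q by auto
      have "peano_axioms \<turnstile>\<^sub>i bex (numeral_tm (e i)) ?B"
        by (rule bex_numeralI[OF _ k(1)]) (simp_all only: inst arith_peano_axioms represents_true[of _ Q, OF B k(2)])
      then show ?thesis by simp
    qed
    show "insert (subst (num e) (bex (Var i) B)) peano_axioms \<turnstile>\<^sub>i Bot"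
      if Q: "\<not> (\<exists>x\<le>e i. Q (case_nat x e))"
    proof -
      have "peano_axioms \<turnstile>\<^sub>i Neg (bex (numeral_tm (e i)) ?B)"
      proof (rule bex_numeralD)
        show "peano_axioms \<turnstile>\<^sub>i Neg (subst (inst (numeral_tm k)) ?B)" if "k \<le> e i" for k
          unfolding inst by (rule represents_false[OF B]) (use Q that in auto)
      qed simp
      then show ?thesis by (intro iprov.ImpE[OF iprov_weaken iprov_Assm]) simp
    qed
  qed
  then show ?thesis by (auto simp: decidable_def)
qed

lemma decidable_rename:
  assumes "decidable Q" shows "decidable (\<lambda>e. Q (\<lambda>n. e (\<rho> n)))"
proof -
  obtain B where B: "represents B Q" using assms by (auto simp: decidable_def)
  have "represents (subst (\<lambda>n. Var (\<rho> n)) B) (\<lambda>e. Q (\<lambda>n. e (\<rho> n)))"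
    using represents_true[OF B] represents_false[OF B]
      peano_axioms_subst[OF represents_Dec[OF B] arith_peano_axioms, of "\<lambda>n. Var (\<rho> n)"]
    by (simp add: represents_def)
  then show ?thesis by (auto simp: decidable_def)
qed

section \<open>Sigma-1 predicates\<close>

text \<open>
  Monotonicity in \<open>y\<close> lets a single bound serve for several existential quantifiers, so that
  conjunctions and bounded universal quantifiers need no coding of tuples.
\<close>

definition sigma :: "((nat \<Rightarrow> nat) \<Rightarrow> bool) \<Rightarrow> bool" where
  "sigma P \<longleftrightarrow> (\<exists>Q. decidable Q \<and> (\<forall>e. P e \<longleftrightarrow> (\<exists>y. Q (case_nat y e))) \<and>
     (\<forall>e y z. y \<le> z \<longrightarrow> Q (case_nat y e) \<longrightarrow> Q (case_nat z e)))"

lemma sigmaI: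
  assumes "decidable Q" "\<And>e. P e \<longleftrightarrow> (\<exists>y. Q (case_nat y e))"
    "\<And>e y z. y \<le> z \<Longrightarrow> Q (case_nat y e) \<Longrightarrow> Q (case_nat z e)"
  shows "sigma P"
  unfolding sigma_def using assms by blast

lemma sigmaE:
  assumes "sigma P"
  obtains Q where "decidable Q" "\<And>e. P e \<longleftrightarrow> (\<exists>y. Q (case_nat y e))"
    "\<And>e y z. y \<le> z \<Longrightarrow> Q (case_nat y e) \<Longrightarrow> Q (case_nat z e)"
  using assms unfolding sigma_def by blast

lemma sigma_teval: "sigma (\<lambda>e. teval e s = teval e t)"
  by (rule sigmaI[OF decidable_rename[OF decidable_Eq[of s t], of Suc]]) simp_all

lemma sigma_conj:
  assumes "sigma P" "sigma R" shows "sigma (\<lambda>e. P e \<and> R e)"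
proof -
  obtain Q where Q: "decidable Q" "\<And>e. P e \<longleftrightarrow> (\<exists>y. Q (case_nat y e))"
    "\<And>e y z. y \<le> z \<Longrightarrow> Q (case_nat y e) \<Longrightarrow> Q (case_nat z e)"
    using assms(1) by (rule sigmaE) blast
  obtain S where S: "decidable S" "\<And>e. R e \<longleftrightarrow> (\<exists>y. S (case_nat y e))"
    "\<And>e y z. y \<le> z \<Longrightarrow> S (case_nat y e) \<Longrightarrow> S (case_nat z e)"
    using assms(2) by (rule sigmaE) blast
  show ?thesis
  proof (rule sigmaI[OF decidable_conj[OF Q(1) S(1)]])
    show "P e \<and> R e \<longleftrightarrow> (\<exists>y. Q (case_nat y e) \<and> S (case_nat y e))" for e
      using Q(2) S(2) Q(3)[of _ "max _ _" e] S(3)[of _ "max _ _" e]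
      by (meson max.cobounded1 max.cobounded2)
  qed (use Q(3) S(3) in blast)
qed

lemma sigma_disj:
  assumes "sigma P" "sigma R" shows "sigma (\<lambda>e. P e \<or> R e)"
proof -
  obtain Q where Q: "decidable Q" "\<And>e. P e \<longleftrightarrow> (\<exists>y. Q (case_nat y e))"
    "\<And>e y z. y \<le> z \<Longrightarrow> Q (case_nat y e) \<Longrightarrow> Q (case_nat z e)"
    using assms(1) by (rule sigmaE) blast
  obtain S where S: "decidable S" "\<And>e. R e \<longleftrightarrow> (\<exists>y. S (case_nat y e))"
    "\<And>e y z. y \<le> z \<Longrightarrow> S (case_nat y e) \<Longrightarrow> S (case_nat z e)"
    using assms(2) by (rule sigmaE) blast
  show ?thesis
    by (rule sigmaI[OF decidable_disj[OF Q(1) S(1)]]) (use Q(2,3) S(2,3) in blast)+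
qed

lemma sigma_rename:
  assumes "sigma P" shows "sigma (\<lambda>e. P (\<lambda>n. e (\<rho> n)))"
proof -
  obtain Q where Q: "decidable Q" "\<And>e. P e \<longleftrightarrow> (\<exists>y. Q (case_nat y e))"
    "\<And>e y z. y \<le> z \<Longrightarrow> Q (case_nat y e) \<Longrightarrow> Q (case_nat z e)"
    using assms(1) by (rule sigmaE) blast
  let ?\<rho> = "case_nat 0 (\<lambda>n. Suc (\<rho> n))"
  have "(\<lambda>n. case_nat y e (?\<rho> n)) = case_nat y (\<lambda>n. e (\<rho> n))" for y and e :: "nat \<Rightarrow> nat"
    by (auto simp: fun_eq_iff split: nat.split)
  then show ?thesis
    by (intro sigmaI[OF decidable_rename[OF Q(1), of ?\<rho>]]) (use Q(2,3) in auto)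
qed

text \<open>Transposition of variables 0 and 1: \<open>sigma\<close> keeps the stage in variable 0,
  while a newly quantified number enters in front of it.\<close>

lemma case_nat_swap:
  "(\<lambda>n. case_nat x (case_nat y e) (case_nat 1 (case_nat 0 (\<lambda>n. Suc (Suc n))) n))
    = case_nat y (case_nat x e)" for e :: "nat \<Rightarrow> nat"
  by (auto simp: fun_eq_iff split: nat.split)

text \<open>The stage \<open>y\<close> serves as a bound for the quantified \<open>x\<close> too; by
  monotonicity it can be raised until it is at least \<open>x\<close>.\<close>

lemma sigma_ex:
  assumes "sigma (\<lambda>e. P (e 0) (\<lambda>n. e (Suc n)))" shows "sigma (\<lambda>e. \<exists>x. P x e)"
proof -
  obtain Q where Q: "decidable Q" "\<And>e. P (e 0) (\<lambda>n. e (Suc n)) \<longleftrightarrow> (\<exists>y. Q (case_nat y e))"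
    "\<And>e y z. y \<le> z \<Longrightarrow> Q (case_nat y e) \<Longrightarrow> Q (case_nat z e)"
    using assms(1) by (rule sigmaE) blast
  let ?Q = "\<lambda>e. \<exists>x\<le>e 0. Q (\<lambda>n. case_nat x e (case_nat 1 (case_nat 0 (\<lambda>n. Suc (Suc n))) n))"
  show ?thesis
  proof (rule sigmaI[of ?Q])
    show "decidable ?Q" by (rule decidable_bex[OF decidable_rename[OF Q(1)]])
    fix e
    have "P x e \<longleftrightarrow> (\<exists>y. Q (case_nat y (case_nat x e)))" for x
      using Q(2)[of "case_nat x e"] by simp
    moreover have "(\<exists>x y. Q (case_nat y (case_nat x e))) \<longleftrightarrow> (\<exists>y. \<exists>x\<le>y. Q (case_nat y (case_nat x e)))"
      using Q(3) by (meson max.cobounded1 max.cobounded2)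
    ultimately show "(\<exists>x. P x e) \<longleftrightarrow> (\<exists>y. ?Q (case_nat y e))"
      by (simp add: case_nat_swap)
    show "?Q (case_nat z e)" if "y \<le> z" "?Q (case_nat y e)" for y z
      using that Q(3) by (simp add: case_nat_swap) (meson order_trans)
  qed
qed

text \<open>The finitely many stages belonging to the numbers up to the bound are replaced by their
  maximum. The decided matrix is obtained from a bounded existential quantifier by two
  negations.\<close>

lemma sigma_all_var:
  assumes "sigma (\<lambda>e. P (e 0) (\<lambda>n. e (Suc n)))" shows "sigma (\<lambda>e. \<forall>x\<le>e i. P x e)"
proof -
  obtain Q where Q: "decidable Q" "\<And>e. P (e 0) (\<lambda>n. e (Suc n)) \<longleftrightarrow> (\<exists>y. Q (case_nat y e))"
    "\<And>e y z. y \<le> z \<Longrightarrow> Q (case_nat y e) \<Longrightarrow> Q (case_nat z e)"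
    using assms(1) by (rule sigmaE) blast
  let ?Q = "\<lambda>e. \<not> (\<exists>x\<le>e (Suc i). \<not> Q (\<lambda>n. case_nat x e (case_nat 1 (case_nat 0 (\<lambda>n. Suc (Suc n))) n)))"
  show ?thesis
  proof (rule sigmaI[of ?Q])
    show "decidable ?Q"
      by (rule decidable_Not[OF decidable_bex[OF decidable_Not[OF decidable_rename[OF Q(1)]]]])
    fix e
    have *: "P x e \<longleftrightarrow> (\<exists>y. Q (case_nat y (case_nat x e)))" for x
      using Q(2)[of "case_nat x e"] by simp
    show "?Q (case_nat z e)" if "y \<le> z" "?Q (case_nat y e)" for y z
      using that Q(3) by (simp add: case_nat_swap)
    have "\<exists>y. \<forall>x\<le>n. Q (case_nat y (case_nat x e))"
      if "\<forall>x\<le>n. \<exists>y. Q (case_nat y (case_nat x e))" for n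
      using that
    proof (induction n)
      case (Suc n)
      then obtain y where y: "\<forall>x\<le>n. Q (case_nat y (case_nat x e))" by auto
      obtain z where z: "Q (case_nat z (case_nat (Suc n) e))" using Suc.prems by blast
      have "Q (case_nat (max y z) (case_nat x e))" if "x \<le> Suc n" for x
        using that y z Q(3)[of y "max y z"] Q(3)[of z "max y z"] by (auto simp: le_Suc_eq)
      then show ?case by blast
    qed simp
    then show "(\<forall>x\<le>e i. P x e) \<longleftrightarrow> (\<exists>y. ?Q (case_nat y e))"
      unfolding * by (simp add: case_nat_swap) blast
  qed
qed

section \<open>Functions with Sigma-1 graph\<close>

definition sigma_fun :: "((nat \<Rightarrow> nat) \<Rightarrow> nat) \<Rightarrow> bool" where
  "sigma_fun f \<longleftrightarrow> sigma (\<lambda>e. f (\<lambda>n. e (Suc n)) = e 0)"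

text \<open>The graph of \<open>f\<close> names its value by a new variable; all compositions are
  reduced to relations between variables in this way.\<close>

lemma sigma_bind:
  assumes "sigma_fun f" "sigma (\<lambda>e. P (e 0) (\<lambda>n. e (Suc n)))"
  shows "sigma (\<lambda>e. P (f e) e)"
proof -
  have "sigma (\<lambda>e. \<exists>x. f e = x \<and> P x e)"
    by (rule sigma_ex, rule sigma_conj) (use assms in \<open>simp_all add: sigma_fun_def\<close>)
  then show ?thesis by simp
qed

lemma sigma_fun_rename: "sigma_fun f \<Longrightarrow> sigma_fun (\<lambda>e. f (\<lambda>n. e (\<rho> n)))"
  unfolding sigma_fun_def
  using sigma_rename[of "\<lambda>e. f (\<lambda>n. e (Suc n)) = e 0" "case_nat 0 (\<lambda>n. Suc (\<rho> n))"] by simp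

lemma sigma_rel1: "sigma (\<lambda>e. P (e 0)) \<Longrightarrow> sigma_fun f \<Longrightarrow> sigma (\<lambda>e. P (f e))"
  by (rule sigma_bind)

lemma sigma_bind_list:
  assumes "\<And>h. h \<in> set hs \<Longrightarrow> sigma_fun h"
    and "sigma (\<lambda>e. P (map e [0..<length hs]) (\<lambda>n. e (length hs + n)))"
  shows "sigma (\<lambda>e. P (map (\<lambda>h. h e) hs) e)"
  using assms
proof (induction hs arbitrary: P)
  case (Cons h hs)
  let ?m = "length hs"
  \<comment> \<open>The values of \<open>hs\<close> already occupy the first \<open>?m\<close>
    variables, so \<open>h\<close> has to read the environment behind them.\<close>
  have "sigma (\<lambda>e. P (h (\<lambda>n. e (?m + n)) # map e [0..<?m]) (\<lambda>n. e (?m + n)))"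
  proof (rule sigma_bind[where P = "\<lambda>x e. P (x # map e [0..<?m]) (\<lambda>n. e (?m + n))"])
    show "sigma_fun (\<lambda>e. h (\<lambda>n. e (?m + n)))"
      by (rule sigma_fun_rename) (use Cons.prems(1) in simp)
    have "map e [0..<Suc ?m] = e 0 # map (\<lambda>n. e (Suc n)) [0..<?m]" for e :: "nat \<Rightarrow> nat"
      by (simp only: upt_conv_Cons[OF zero_less_Suc] list.map map_Suc_upt[symmetric]) simp
    then show "sigma (\<lambda>e. P (e 0 # map (\<lambda>n. e (Suc n)) [0..<?m]) (\<lambda>n. e (Suc (?m + n))))"
      using Cons.prems(2) by simp
  qed
  then show ?case
    using Cons.IH[of "\<lambda>xs e. P (h e # xs) e"] Cons.prems(1) by simp
qed simp

lemma sigma_rel2: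
  assumes "sigma (\<lambda>e. P (e 0) (e 1))" "sigma_fun f" "sigma_fun g"
  shows "sigma (\<lambda>e. P (f e) (g e))"
  using sigma_bind_list[of "[f, g]" "\<lambda>xs e. P (xs ! 0) (xs ! 1)"] assms
  by (auto simp: numeral_2_eq_2)

lemma sigma_rel3:
  assumes "sigma (\<lambda>e. P (e 0) (e 1) (e 2))" "sigma_fun f" "sigma_fun g" "sigma_fun h"
  shows "sigma (\<lambda>e. P (f e) (g e) (h e))"
  using sigma_bind_list[of "[f, g, h]" "\<lambda>xs e. P (xs ! 0) (xs ! 1) (xs ! 2)"] assms
  by (auto simp: numeral_2_eq_2)

lemma sigma_rel4:
  assumes "sigma (\<lambda>e. P (e 0) (e 1) (e 2) (e 3))"
    "sigma_fun f" "sigma_fun g" "sigma_fun h" "sigma_fun k"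
  shows "sigma (\<lambda>e. P (f e) (g e) (h e) (k e))"
  using sigma_bind_list[of "[f, g, h, k]" "\<lambda>xs e. P (xs ! 0) (xs ! 1) (xs ! 2) (xs ! 3)"] assms
  by (auto simp: numeral_2_eq_2 numeral_3_eq_3)

lemma sigma_fun_var: "sigma_fun (\<lambda>e. e i)"
  unfolding sigma_fun_def using sigma_teval[of "Var (Suc i)" "Var 0"] by simp

lemma teval_numeral_tm [simp]: "teval e (numeral_tm n) = n"
  by (induction n) auto

lemma sigma_fun_const: "sigma_fun (\<lambda>e. c)"
  unfolding sigma_fun_def using sigma_teval[of "numeral_tm c" "Var 0"] by simp


lemma sigma_fun_op1:
  assumes "sigma (\<lambda>e. h (e 0) = e 1)" "sigma_fun f" shows "sigma_fun (\<lambda>e. h (f e))"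
  unfolding sigma_fun_def
  by (rule sigma_rel2[where P = "\<lambda>x y. h x = y", OF _ sigma_fun_rename[OF assms(2)] sigma_fun_var])
    (use assms(1) in simp)

lemma sigma_fun_op2:
  assumes "sigma (\<lambda>e. h (e 0) (e 1) = e 2)" "sigma_fun f" "sigma_fun g"
  shows "sigma_fun (\<lambda>e. h (f e) (g e))"
  unfolding sigma_fun_def
  by (rule sigma_rel3[where P = "\<lambda>x y z. h x y = z", OF _ sigma_fun_rename[OF assms(2)]
        sigma_fun_rename[OF assms(3)] sigma_fun_var]) (use assms(1) in simp)

lemma sigma_fun_op3:
  assumes "sigma (\<lambda>e. k (e 0) (e 1) (e 2) = e 3)" "sigma_fun f" "sigma_fun g" "sigma_fun h"
  shows "sigma_fun (\<lambda>e. k (f e) (g e) (h e))"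
  unfolding sigma_fun_def
  by (rule sigma_rel4[where P = "\<lambda>w x y z. k w x y = z", OF _ sigma_fun_rename[OF assms(2)]
        sigma_fun_rename[OF assms(3)] sigma_fun_rename[OF assms(4)] sigma_fun_var])
    (use assms(1) in simp)

lemma sigma_fun_Suc: "sigma_fun f \<Longrightarrow> sigma_fun (\<lambda>e. Suc (f e))"
  by (rule sigma_fun_op1) (use sigma_teval[of "Succ (Var 0)" "Var 1"] in simp)

lemma sigma_fun_add: "sigma_fun f \<Longrightarrow> sigma_fun g \<Longrightarrow> sigma_fun (\<lambda>e. f e + g e)"
  by (rule sigma_fun_op2) (use sigma_teval[of "Add (Var 0) (Var 1)" "Var 2"] in simp)

lemma sigma_fun_mult: "sigma_fun f \<Longrightarrow> sigma_fun g \<Longrightarrow> sigma_fun (\<lambda>e. f e * g e)"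
  by (rule sigma_fun_op2) (use sigma_teval[of "Mul (Var 0) (Var 1)" "Var 2"] in simp)

lemma sigma_eq: "sigma_fun f \<Longrightarrow> sigma_fun g \<Longrightarrow> sigma (\<lambda>e. f e = g e)"
  by (rule sigma_rel2) (use sigma_teval[of "Var 0" "Var 1"] in simp)

lemma sigma_less:
  assumes "sigma_fun f" "sigma_fun g" shows "sigma (\<lambda>e. f e < g e)"
proof -
  have "sigma (\<lambda>e. \<exists>k. e 1 = Suc (e 0 + k))"
    by (intro sigma_ex sigma_eq sigma_fun_Suc sigma_fun_add sigma_fun_var)
  then have "sigma (\<lambda>e. e 0 < e 1)" by (simp only: less_iff_Suc_add)
  then show ?thesis using assms by (rule sigma_rel2)
qed

lemma sigma_all_le:
  assumes "sigma (\<lambda>e. P (e 0) (\<lambda>n. e (Suc n)))" "sigma_fun f"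
  shows "sigma (\<lambda>e. \<forall>x\<le>f e. P x e)"
  using sigma_bind[OF assms(2), of "\<lambda>b e. \<forall>x\<le>b. P x e"]
    sigma_all_var[of "\<lambda>x e. P x (\<lambda>n. e (Suc n))" 0]
    sigma_rename[OF assms(1), of "case_nat 0 (\<lambda>n. Suc (Suc n))"] by simp

text \<open>A positive strict bound is a weak bound by the predecessor, which is introduced by a
  quantifier because terms have no subtraction.\<close>

lemma sigma_all_less:
  assumes "sigma (\<lambda>e. P (e 0) (\<lambda>n. e (Suc n)))" "sigma_fun f"
  shows "sigma (\<lambda>e. \<forall>x<f e. P x e)"
proof -
  have "sigma (\<lambda>e. f e = 0 \<or> (\<exists>b. f e = Suc b \<and> (\<forall>x\<le>b. P x e)))"
    by (intro sigma_disj sigma_ex sigma_conj sigma_all_le sigma_eq sigma_fun_Suc sigma_fun_const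
        sigma_fun_var sigma_fun_rename[OF assms(2)] assms(2))
      (use sigma_rename[OF assms(1), of "case_nat 0 (\<lambda>n. Suc (Suc n))"] in simp)
  moreover have "(f e = 0 \<or> (\<exists>b. f e = Suc b \<and> (\<forall>x\<le>b. P x e))) \<longleftrightarrow> (\<forall>x<f e. P x e)" for e
    by (cases "f e") (auto simp: less_Suc_eq_le)
  ultimately show ?thesis by simp
qed

lemma sigma_ex_less:
  assumes "sigma (\<lambda>e. P (e 0) (\<lambda>n. e (Suc n)))" "sigma_fun f"
  shows "sigma (\<lambda>e. \<exists>x<f e. P x e)"
  by (intro sigma_ex sigma_conj sigma_less sigma_fun_var sigma_fun_rename[OF assms(2)] assms(1))

text \<open>Cantor's pairing contains a triangular number; doubling both sides clears its division
  by two and leaves a polynomial equation.\<close>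

lemma sigma_fun_prod_encode:
  "sigma_fun f \<Longrightarrow> sigma_fun g \<Longrightarrow> sigma_fun (\<lambda>e. prod_encode (f e, g e))"
proof (rule sigma_fun_op2[where h = "\<lambda>m n. prod_encode (m, n)"])
  have "sigma (\<lambda>e. (e 0 + e 1) * Suc (e 0 + e 1) + (e 0 + e 0) = e 2 + e 2)"
    by (intro sigma_eq sigma_fun_add sigma_fun_mult sigma_fun_Suc sigma_fun_var)
  moreover have "prod_encode (m, n) = k \<longleftrightarrow> (m + n) * Suc (m + n) + (m + m) = k + k" for m n k
  proof -
    have "2 * triangle (m + n) = (m + n) * Suc (m + n)" by (simp add: triangle_def)
    then show ?thesis by (auto simp: prod_encode_def)
  qed
  ultimately show "sigma (\<lambda>e. prod_encode (e 0, e 1) = e 2)" by simp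
qed

section \<open>Goedel's beta function, recursion and minimization\<close>

definition beta :: "nat \<Rightarrow> nat \<Rightarrow> nat \<Rightarrow> nat" where
  "beta a b i = a mod Suc (Suc i * b)"

lemma sigma_fun_beta:
  "sigma_fun f \<Longrightarrow> sigma_fun g \<Longrightarrow> sigma_fun h \<Longrightarrow> sigma_fun (\<lambda>e. beta (f e) (g e) (h e))"
proof (rule sigma_fun_op3[where k = beta])
  have "sigma (\<lambda>e. e 3 < Suc (Suc (e 2) * e 1) \<and> (\<exists>q. e 0 = q * Suc (Suc (e 2) * e 1) + e 3))"
    by (intro sigma_conj sigma_less sigma_ex sigma_eq sigma_fun_add sigma_fun_mult sigma_fun_Suc
        sigma_fun_var)
  moreover have "beta a b i = k \<longleftrightarrow> k < Suc (Suc i * b) \<and> (\<exists>q. a = q * Suc (Suc i * b) + k)"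
    for a b i k
    unfolding beta_def by (metis div_mult_mod_eq mod_less mod_less_divisor mod_mult_self3 zero_less_Suc)
  ultimately show "sigma (\<lambda>e. beta (e 0) (e 1) (e 2) = e 3)" by simp
qed

text \<open>For \<open>b\<close> a suitable factorial, the moduli are pairwise coprime and exceed
  the prescribed values; \<open>a\<close> then comes from the Chinese remainder theorem.\<close>

lemma beta_exists: "\<exists>a b. \<forall>i<n. beta a b i = f i"
proof -
  \<comment> \<open>Large enough for every difference of two indices to divide the factorial of
    \<open>M\<close>, and for every value to be at most that factorial.\<close>
  define M where "M = n + (\<Sum>i<n. f i)"
  define b where "b = (fact M :: nat)"
  have dvd_b: "d dvd b" if "0 < d" "d \<le> n" for d
    using that by (simp add: b_def M_def dvd_fact)
  have less: "f i < Suc (Suc i * b)" if "i < n" for i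
  proof -
    have "f i \<le> M" using that by (auto simp: M_def intro: trans_le_add2 member_le_sum)
    also have "M \<le> b" unfolding b_def by (rule fact_ge_self)
    finally show ?thesis by (simp add: trans_le_add1 le_imp_less_Suc)
  qed
  have cop: "coprime (Suc (Suc i * b)) (Suc (Suc j * b))" if "i < j" "j < n" for i j
  proof (rule coprimeI)
    fix c assume c: "c dvd Suc (Suc i * b)" "c dvd Suc (Suc j * b)"
    have "c dvd Suc (Suc j * b) - Suc (Suc i * b)" using c by (intro dvd_diff_nat)
    also have "Suc (Suc j * b) - Suc (Suc i * b) = (j - i) * b" by (simp add: diff_mult_distrib)
    finally have "c dvd (j - i) * b" .
    \<comment> \<open>A common divisor of two moduli is coprime to \<open>b\<close>. It therefore
      divides \<open>j - i\<close>, which divides \<open>b\<close>, and so it is a unit.\<close>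
    moreover have "coprime c b"
    proof (rule coprimeI)
      fix d assume "d dvd c" "d dvd b"
      then have "d dvd Suc i * b + 1" "d dvd Suc i * b" using c by auto
      then show "d dvd 1" by (rule dvd_add_right_iff[THEN iffD1, rotated])
    qed
    ultimately have "c dvd j - i" by (simp add: coprime_dvd_mult_left_iff)
    then have "c dvd b" using dvd_b[of "j - i"] that by (meson dvd_trans diff_le_self le_trans less_imp_le zero_less_diff)
    with \<open>coprime c b\<close> show "c dvd 1" by (metis coprime_common_divisor dvd_refl)
  qed
  obtain a where a: "\<forall>i\<in>{..<n}. [a = f i] (mod Suc (Suc i * b))"
    using chinese_remainder_nat[of "{..<n}" "\<lambda>i. Suc (Suc i * b)" f] cop
    by (metis finite_lessThan lessThan_iff coprime_commute linorder_neqE_nat)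
  have "beta a b i = f i" if "i < n" for i
    using a that less[OF that] by (simp add: beta_def cong_def)
  then show ?thesis by blast
qed

lemma sigma_fun_case_nat2:
  assumes "sigma_fun G" "sigma_fun f" "sigma_fun g"
  shows "sigma_fun (\<lambda>e. G (case_nat (f e) (case_nat (g e) (\<lambda>n. e (\<rho> n)))))"
  unfolding sigma_fun_def
proof (rule sigma_bind[OF sigma_fun_rename[OF assms(2)]], rule sigma_bind[OF sigma_fun_rename[OF assms(3)]])
  let ?\<rho> = "case_nat 2 (case_nat 1 (case_nat 0 (\<lambda>n. Suc (Suc (Suc (\<rho> n))))))"
  have "(\<lambda>n. e (?\<rho> (Suc n))) = case_nat (e 1) (case_nat (e 0) (\<lambda>n. e (Suc (Suc (Suc (\<rho> n))))))"
    for e :: "nat \<Rightarrow> nat"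
    by (auto simp: fun_eq_iff split: nat.split)
  then show "sigma (\<lambda>e. G (case_nat (e (Suc 0)) (case_nat (e 0)
      (\<lambda>n. e (Suc (Suc (Suc (\<rho> n))))))) = e (Suc (Suc 0)))"
    using sigma_rename[OF assms(1)[unfolded sigma_fun_def], of ?\<rho>] by (simp add: numeral_2_eq_2)
qed

lemma sigma_fun_case_nat:
  assumes "sigma_fun G" "sigma_fun f"
  shows "sigma_fun (\<lambda>e. G (case_nat (f e) (\<lambda>n. e (\<rho> n))))"
proof -
  have "(\<lambda>n. case_nat x (case_nat y e) (case_nat 0 (\<lambda>n. Suc (Suc n)) n)) = case_nat x e"
    for x y and e :: "nat \<Rightarrow> nat"
    by (auto simp: fun_eq_iff split: nat.split)
  then show ?thesis
    using sigma_fun_case_nat2[OF sigma_fun_rename[OF assms(1), of "case_nat 0 (\<lambda>n. Suc (Suc n))"]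
      assms(2) assms(2), of \<rho>] by simp
qed

text \<open>The beta function codes the whole run of the recursion, from the initial value to the
  value at \<open>N e\<close>, and the graph asserts that such a code exists.\<close>

lemma sigma_fun_rec_nat:
  assumes F: "sigma_fun F" and G: "sigma_fun G" and N: "sigma_fun N"
  shows "sigma_fun (\<lambda>e. rec_nat (F e) (\<lambda>n r. G (case_nat n (case_nat r e))) (N e))"
proof -
  let ?r = "\<lambda>e. rec_nat (F e) (\<lambda>n r. G (case_nat n (case_nat r e)))"
  let ?P = "\<lambda>a b e y. beta a b 0 = F e
      \<and> (\<forall>i<N e. beta a b (Suc i) = G (case_nat i (case_nat (beta a b i) (\<lambda>n. e n))))
      \<and> beta a b (N e) = y"
  have "(\<exists>a b. ?P a b e y) \<longleftrightarrow> ?r e (N e) = y" for e y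
  proof
    assume "?r e (N e) = y"
    moreover obtain a b where "\<forall>i<Suc (N e). beta a b i = ?r e i"
      using beta_exists by blast
    ultimately have "?P a b e y" by simp
    then show "\<exists>a b. ?P a b e y" by blast
  next
    assume "\<exists>a b. ?P a b e y"
    then obtain a b where P: "?P a b e y" by blast
    have "i \<le> N e \<Longrightarrow> beta a b i = ?r e i" for i
      by (induction i) (use P in auto)
    then show "?r e (N e) = y" using P by auto
  qed
  moreover have "sigma (\<lambda>e. \<exists>a b. ?P a b (\<lambda>n. e (Suc n)) (e 0))"
    by (intro sigma_ex sigma_conj sigma_all_less sigma_eq sigma_fun_beta sigma_fun_var sigma_fun_Suc
        sigma_fun_const sigma_fun_case_nat2[OF G] sigma_fun_rename[OF F] sigma_fun_rename[OF N])
  ultimately show ?thesis unfolding sigma_fun_def by simp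
qed

text \<open>Sigma-1 predicates are not closed under negation, so that a value below the least zero
  is nonzero is expressed positively, by its being a successor.\<close>

lemma sigma_fun_Least:
  assumes F: "sigma_fun F" and ex: "\<And>e. \<exists>y. F (case_nat y e) = 0"
  shows "sigma_fun (\<lambda>e. LEAST y. F (case_nat y e) = 0)"
proof -
  have "(LEAST y. F (case_nat y e) = 0) = z
    \<longleftrightarrow> F (case_nat z e) = 0 \<and> (\<forall>y<z. \<exists>v. F (case_nat y e) = Suc v)" for z e
    by (metis (mono_tags, lifting) LeastI Least_le ex linorder_neqE_nat not0_implies_Suc
        not_less_Least old.nat.distinct(2))
  moreover have "sigma (\<lambda>e. F (case_nat (e 0) (\<lambda>n. e (Suc n))) = 0
      \<and> (\<forall>y<e 0. \<exists>v. F (case_nat y (\<lambda>n. e (Suc n))) = Suc v))"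
    by (intro sigma_conj sigma_all_less sigma_ex sigma_eq sigma_fun_case_nat[OF F] sigma_fun_var
        sigma_fun_const sigma_fun_Suc)
  ultimately show ?thesis unfolding sigma_fun_def by simp
qed

lemma total_recursive_sigma: "total_recursive k f \<Longrightarrow> sigma_fun (\<lambda>e. f (map e [0..<k]))"
proof (induction rule: total_recursive.induct)
  case (zero k) show ?case by (rule sigma_fun_const)
next
  case succ show ?case by (simp add: sigma_fun_Suc sigma_fun_var)
next
  case (proj i k) then show ?case by (simp add: sigma_fun_var)
next
  case (comp gs f k)
  \<comment> \<open>Variable 0 is reserved for the value of the composite, so the arguments are read
    from variable 1 on.\<close>
  let ?hs = "map (\<lambda>g e. g (map (\<lambda>n. e (Suc n)) [0..<k])) gs"
  have "sigma (\<lambda>e. f (map (\<lambda>h. h e) ?hs) = e 0)"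
  proof (rule sigma_bind_list[where P = "\<lambda>xs e. f xs = e 0"])
    show "sigma_fun h" if "h \<in> set ?hs" for h
      using that comp.IH(2) sigma_fun_rename[of "\<lambda>e. _ (map e [0..<k])" Suc] by fastforce
    show "sigma (\<lambda>e. f (map e [0..<length ?hs]) = e (length ?hs + 0))"
      using sigma_rename[OF comp.IH(1)[unfolded sigma_fun_def], of "case_nat (length gs) (\<lambda>n. n)"]
      by simp
  qed
  then show ?case by (simp add: sigma_fun_def comp_def)
next
  case (prec k f g)
  let ?F = "\<lambda>e. f (map (\<lambda>n. e (Suc n)) [0..<k])"
  \<comment> \<open>In the recursion step, variables 0 and 1 hold the counter and the previous
    value. Variable 2 is the recursion argument itself, which is not passed to \<open>g\<close> and
    is skipped.\<close>
  let ?G = "\<lambda>e. g (map (\<lambda>n. e (case_nat 0 (case_nat 1 (\<lambda>n. Suc (Suc (Suc n)))) n)) [0..<k + 2])"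
  have "sigma_fun (\<lambda>e. rec_nat (?F e) (\<lambda>n r. ?G (case_nat n (case_nat r e))) (e 0))"
    by (intro sigma_fun_rec_nat sigma_fun_var sigma_fun_rename[OF prec.IH(1)]
        sigma_fun_rename[OF prec.IH(2)])
  moreover have "map e [0..<Suc m] = e 0 # map (\<lambda>n. e (Suc n)) [0..<m]" for m and e :: "nat \<Rightarrow> nat"
    by (simp only: upt_conv_Cons[OF zero_less_Suc] list.map map_Suc_upt[symmetric]) simp
  ultimately show ?case by (simp del: upt_Suc)
next
  case (minim k f)
  have "map (case_nat y e) [0..<Suc k] = y # map e [0..<k]" for y and e :: "nat \<Rightarrow> nat"
    by (simp only: upt_conv_Cons[OF zero_less_Suc] list.map map_Suc_upt[symmetric]) simp
  with minim.hyps(2) sigma_fun_Least[OF minim.IH] show ?case by (simp del: upt_Suc)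
qed

section \<open>Inductively generated sets of numbers\<close>

inductive closure :: "(nat \<Rightarrow> bool) \<Rightarrow> (nat \<Rightarrow> nat \<Rightarrow> nat \<Rightarrow> bool) \<Rightarrow> nat \<Rightarrow> bool"
  for A R where
  base: "A c \<Longrightarrow> closure A R c"
| step: "closure A R a \<Longrightarrow> closure A R b \<Longrightarrow> R a b c \<Longrightarrow> closure A R c"

text \<open>Membership means that there is a finite derivation, coded by \<open>beta\<close>, each
  entry of which is an axiom or follows from two earlier entries. One-premise rules fit into this
  format by repeating their premise.\<close>

lemma sigma_closure:
  assumes A: "sigma (\<lambda>e. A (e 0))" and R: "sigma (\<lambda>e. R (e 0) (e 1) (e 2))"
  shows "sigma (\<lambda>e. closure A R (e 0))"
proof -
  define justified where "justified s i \<longleftrightarrow> A (s i) \<or> (\<exists>j<i. \<exists>k<i. R (s j) (s k) (s i))"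
    for s :: "nat \<Rightarrow> nat" and i
  \<comment> \<open>The test at \<open>i\<close> looks only at entries up to \<open>i\<close>, so a
    list may be exchanged for its beta code.\<close>
  have justified_cong: "justified s i \<longleftrightarrow> justified t i" if "\<And>j. j \<le> i \<Longrightarrow> s j = t j" for s t i
    using that by (simp add: justified_def) (metis less_imp_le)
  have "closure A R c \<longleftrightarrow> (\<exists>a b n. beta a b n = c \<and> (\<forall>i\<le>n. justified (beta a b) i))" for c
  proof
    assume "closure A R c"
    then have "\<exists>xs. (\<forall>i<length xs. justified (\<lambda>i. xs ! i) i) \<and> c \<in> set xs"
    proof induction
      case (base c)
      then show ?case by (intro exI[of _ "[c]"]) (simp add: justified_def)
    next
      case (step a b c)
      then obtain xs ys where xs: "\<forall>i<length xs. justified (\<lambda>i. xs ! i) i" "a \<in> set xs"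
        and ys: "\<forall>i<length ys. justified (\<lambda>i. ys ! i) i" "b \<in> set ys" by blast
      \<comment> \<open>The derivations of the two premises are concatenated, so the indices in the
        second one move by \<open>length xs\<close>.\<close>
      let ?zs = "xs @ ys @ [c]"
      have "justified (\<lambda>i. ?zs ! i) i" if i: "i < length ?zs" for i
      proof -
        consider "i < length xs" | j where "i = length xs + j" "j < length ys"
          | "i = length xs + length ys"
          using i by (metis add.commute add_diff_inverse_nat length_append length_append_singleton
              less_Suc_eq nat_add_left_cancel_less)
        then show ?thesis
        proof cases
          case 1
          with xs(1) show ?thesis by (fastforce simp: justified_def nth_append)
        next
          case 2
          then have "justified (\<lambda>i. ys ! i) j" using ys(1) by simp
          then consider "A (ys ! j)" | k l where "k < j" "l < j" "R (ys ! k) (ys ! l) (ys ! j)"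
            unfolding justified_def by blast
          then show ?thesis
          proof cases
            case 1 with 2 show ?thesis by (simp add: justified_def nth_append)
          next
            case c: 2
            have "R (?zs ! (length xs + k)) (?zs ! (length xs + l)) (?zs ! i)"
              using c 2 by (simp add: nth_append)
            with c 2 show ?thesis unfolding justified_def by (meson nat_add_left_cancel_less)
          qed
        next
          case 3
          obtain k l where kl: "k < length xs" "xs ! k = a" "l < length ys" "ys ! l = b"
            using xs(2) ys(2) by (meson in_set_conv_nth)
          then have "R (?zs ! k) (?zs ! (length xs + l)) (?zs ! i)"
            using step.hyps(3) 3 by (simp add: nth_append)
          with kl 3 show ?thesis unfolding justified_def by (meson nat_add_left_cancel_less trans_less_add1)
        qed
      qed
      then show ?case by (intro exI[of _ ?zs]) simp
    qed
    then obtain xs n where xs: "\<forall>i<length xs. justified (\<lambda>i. xs ! i) i" "n < length xs" "xs ! n = c"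
      by (metis in_set_conv_nth)
    obtain a b where ab: "\<forall>i<length xs. beta a b i = xs ! i" using beta_exists by blast
    have "justified (beta a b) i" if "i \<le> n" for i
      using that xs(1,2) ab by (simp add: justified_cong[of i "beta a b" "\<lambda>i. xs ! i"])
    with xs ab show "\<exists>a b n. beta a b n = c \<and> (\<forall>i\<le>n. justified (beta a b) i)" by metis
  next
    assume "\<exists>a b n. beta a b n = c \<and> (\<forall>i\<le>n. justified (beta a b) i)"
    then obtain a b n where *: "beta a b n = c" "\<forall>i\<le>n. justified (beta a b) i" by blast
    have "i \<le> n \<Longrightarrow> closure A R (beta a b i)" for i
    proof (induction i rule: less_induct)
      case (less i)
      then have "justified (beta a b) i" using * by simp
      then show ?case unfolding justified_def
        using less by (meson closure.base closure.step less_imp_le order_trans)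
    qed
    with * show "closure A R c" by blast
  qed
  moreover have "sigma (\<lambda>e. \<exists>a b n. beta a b n = e 0 \<and> (\<forall>i\<le>n. justified (beta a b) i))"
    unfolding justified_def
    by (intro sigma_ex sigma_conj sigma_disj sigma_all_le sigma_ex_less sigma_eq sigma_fun_beta
        sigma_fun_var sigma_rel1[OF A] sigma_rel3[OF R])
  ultimately show ?thesis by simp
qed

section \<open>The Sigma-1 definition of provability\<close>

text \<open>
  A calculus without contexts makes the codes of theorems an inductively generated set of numbers.
  The quantifier rules generalize over all variables, which is sound since theories consist of
  sentences.
\<close>

inductive hilbert :: "fm set \<Rightarrow> fm \<Rightarrow> bool" for T where
  Ax: "A \<in> T \<Longrightarrow> hilbert T A"
| K: "hilbert T (Imp A (Imp B A))"
| S: "hilbert T (Imp (Imp A (Imp B C)) (Imp (Imp A B) (Imp A C)))"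
| BotE: "hilbert T (Imp Bot A)"
| AndI: "hilbert T (Imp A (Imp B (And A B)))"
| AndE1: "hilbert T (Imp (And A B) A)"
| AndE2: "hilbert T (Imp (And A B) B)"
| OrI1: "hilbert T (Imp A (Or A B))"
| OrI2: "hilbert T (Imp B (Or A B))"
| OrE: "hilbert T (Imp (Imp A C) (Imp (Imp B C) (Imp (Or A B) C)))"
| ForallE: "hilbert T (Imp (Forall A) (subst (inst t) A))"
| ExistsI: "hilbert T (Imp (subst (inst t) A) (Exists A))"
| EqRefl: "hilbert T (Eq t t)"
| EqSubst: "hilbert T (Imp (Eq s t) (Imp (subst (inst s) A) (subst (inst t) A)))"
| MP: "hilbert T (Imp A B) \<Longrightarrow> hilbert T A \<Longrightarrow> hilbert T B"
| ForallI: "hilbert T (Imp (subst shift B) A) \<Longrightarrow> hilbert T (Imp B (Forall A))"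
| ExistsE: "hilbert T (Imp A (subst shift B)) \<Longrightarrow> hilbert T (Imp (Exists A) B)"

lemma hilbert_sound:
  assumes T: "\<And>A. A \<in> T \<Longrightarrow> sentence A" and "hilbert T A"
  shows "T \<turnstile>\<^sub>i A"
  using assms(2)
proof induction
  case (Ax A) then show ?case by (rule iprov.Assm)
next
  case (K A B) show ?case by (rule iprov.ImpI, rule iprov.ImpI) simp
next
  case (S A B C)
  let ?\<Gamma> = "insert A (insert (Imp A B) (insert (Imp A (Imp B C)) T))"
  have "?\<Gamma> \<turnstile>\<^sub>i C"
    by (rule iprov.ImpE[OF iprov.ImpE[OF iprov_Assm3 iprov_Assm] iprov.ImpE[OF iprov_Assm2 iprov_Assm]])
  then show ?case by (intro iprov.ImpI)
next
  case (BotE A) show ?case by (rule iprov.ImpI, rule iprov.BotE) simp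
next
  case (AndI A B) show ?case by (rule iprov.ImpI, rule iprov.ImpI, rule iprov.AndI) simp_all
next
  case (AndE1 A B) show ?case by (rule iprov.ImpI, rule iprov.AndE1[OF iprov_Assm])
next
  case (AndE2 A B) show ?case by (rule iprov.ImpI, rule iprov.AndE2[OF iprov_Assm])
next
  case (OrI1 A B) show ?case by (rule iprov.ImpI, rule iprov.OrI1) simp
next
  case (OrI2 B A) show ?case by (rule iprov.ImpI, rule iprov.OrI2) simp
next
  case (OrE A C B)
  let ?\<Gamma> = "insert (Or A B) (insert (Imp B C) (insert (Imp A C) T))"
  have "insert A ?\<Gamma> \<turnstile>\<^sub>i C" "insert B ?\<Gamma> \<turnstile>\<^sub>i C"
    by (rule iprov.ImpE[OF _ iprov_Assm]; rule iprov.Assm; simp)+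
  then have "?\<Gamma> \<turnstile>\<^sub>i C" by (rule iprov.OrE[OF iprov_Assm])
  then show ?case by (intro iprov.ImpI)
next
  case (ForallE A t) show ?case by (rule iprov.ImpI, rule iprov.ForallE) simp
next
  case (ExistsI t A) show ?case by (rule iprov.ImpI, rule iprov.ExistsI) (rule iprov_Assm)
next
  case (EqRefl t) show ?case by (rule iprov.EqRefl)
next
  case (EqSubst s t A)
  show ?case by (rule iprov.ImpI, rule iprov.ImpI, rule iprov.EqSubst[OF iprov_Assm2 iprov_Assm])
next
  case (MP A B) show ?case by (rule iprov.ImpE[OF MP.IH])
next
  case (ForallI B A)
  have "insert (subst shift B) T \<turnstile>\<^sub>i A"
    by (rule iprov.ImpE[OF iprov_weaken[OF ForallI.IH] iprov_Assm])
  then have "subst shift ` insert B T \<turnstile>\<^sub>i A" by (simp add: subst_image_sentences T)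
  then show ?case by (intro iprov.ImpI iprov.ForallI)
next
  case (ExistsE A B)
  have "insert A (subst shift ` insert (Exists A) T) \<turnstile>\<^sub>i subst shift B"
    by (rule iprov.ImpE[OF iprov_mono[OF ExistsE.IH] iprov_Assm])
      (auto simp: subst_image_sentences T)
  then show ?case by (intro iprov.ImpI iprov.ExistsE[OF iprov_Assm])
qed

section \<open>Equivalence of the calculus with natural deduction\<close>

inductive hilbert_from :: "fm set \<Rightarrow> fm set \<Rightarrow> fm \<Rightarrow> bool" for T \<Gamma> where
  Thm: "hilbert T A \<Longrightarrow> hilbert_from T \<Gamma> A"
| Hyp: "A \<in> \<Gamma> \<Longrightarrow> hilbert_from T \<Gamma> A"
| MP: "hilbert_from T \<Gamma> (Imp A B) \<Longrightarrow> hilbert_from T \<Gamma> A \<Longrightarrow> hilbert_from T \<Gamma> B"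

lemma hilbert_from_cut:
  "hilbert_from T \<Delta> A \<Longrightarrow> (\<And>B. B \<in> \<Delta> \<Longrightarrow> hilbert_from T \<Gamma> B) \<Longrightarrow> hilbert_from T \<Gamma> A"
proof (induction rule: hilbert_from.induct)
  case (MP A B) show ?case by (rule hilbert_from.MP[OF MP.IH(1)[OF MP.prems] MP.IH(2)[OF MP.prems]])
qed (auto intro: hilbert_from.Thm)

lemma hilbert_from_empty: "hilbert_from T {} A \<Longrightarrow> hilbert T A"
proof (induction rule: hilbert_from.induct)
  case (MP A B) show ?case by (rule hilbert.MP[OF MP.IH])
qed auto

text \<open>Hypotheses enter \<open>hilbert_from\<close> only through modus ponens, while the
  quantifier rules act on theorems; so hypotheses with free variables can be discharged
  freely.\<close>

lemma deduction: "hilbert_from T (insert A \<Gamma>) B \<Longrightarrow> hilbert_from T \<Gamma> (Imp A B)"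
proof (induction rule: hilbert_from.induct)
  case (Thm B)
  then show ?case by (rule hilbert_from.Thm[OF hilbert.MP[OF hilbert.K]])
next
  case (Hyp B)
  have "hilbert T (Imp A A)"
    by (rule hilbert.MP[OF hilbert.MP[OF hilbert.S hilbert.K[of _ _ "Imp A A"]] hilbert.K])
  then show ?case using Hyp
    by (auto intro: hilbert_from.Thm hilbert_from.MP[OF hilbert_from.Thm[OF hilbert.K] hilbert_from.Hyp])
next
  case (MP B C)
  show ?case by (rule hilbert_from.MP[OF hilbert_from.MP[OF hilbert_from.Thm[OF hilbert.S] MP.IH(1)] MP.IH(2)])
qed

lemma hilbert_from_MP2:
  "hilbert T (Imp A (Imp B C)) \<Longrightarrow> hilbert_from T \<Gamma> A \<Longrightarrow> hilbert_from T \<Gamma> B \<Longrightarrow> hilbert_from T \<Gamma> C"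
  by (rule hilbert_from.MP[OF hilbert_from.MP[OF hilbert_from.Thm]])

lemma hilbert_from_finite:
  "hilbert_from T \<Gamma> A \<Longrightarrow> \<exists>F. finite F \<and> F \<subseteq> \<Gamma> \<and> hilbert_from T F A"
proof (induction rule: hilbert_from.induct)
  case (Thm A)
  then show ?case by (auto intro: hilbert_from.Thm)
next
  case (Hyp A)
  then show ?case by (intro exI[of _ "{A}"]) (auto intro: hilbert_from.Hyp)
next
  case (MP A B)
  then obtain F G where F: "finite F" "F \<subseteq> \<Gamma>" "hilbert_from T F (Imp A B)"
    and G: "finite G" "G \<subseteq> \<Gamma>" "hilbert_from T G A" by blast
  have "hilbert_from T (F \<union> G) (Imp A B)" "hilbert_from T (F \<union> G) A"
    by (rule hilbert_from_cut[OF F(3)] hilbert_from_cut[OF G(3)]; auto intro: hilbert_from.Hyp)+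
  then have "hilbert_from T (F \<union> G) B" by (rule hilbert_from.MP)
  then show ?case using F G by (intro exI[of _ "F \<union> G"]) simp
qed

text \<open>The quantifier rules of \<open>hilbert\<close> have a single formula as side formula, so
  the finitely many hypotheses in use are packed into one conjunction \<open>B\<close>. The
  projections are demanded under every substitution because they are applied to shifted
  hypotheses.\<close>

lemma conjunction_exists:
  "finite F \<Longrightarrow> F \<subseteq> \<Gamma> \<Longrightarrow>
    \<exists>B. hilbert_from T \<Gamma> B \<and> (\<forall>A\<in>F. \<forall>\<sigma>. hilbert T (Imp (subst \<sigma> B) (subst \<sigma> A)))"
proof (induction rule: finite_induct)
  case empty
  have "hilbert_from T \<Gamma> (Imp Bot Bot)" by (rule hilbert_from.Thm[OF hilbert.BotE])
  then show ?case by blast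
next
  case (insert A F)
  then obtain B where B: "hilbert_from T \<Gamma> B" "\<forall>A\<in>F. \<forall>\<sigma>. hilbert T (Imp (subst \<sigma> B) (subst \<sigma> A))"
    by auto
  have trans: "hilbert T (Imp C E)" if "hilbert T (Imp C D)" "hilbert T (Imp D E)" for C D E
    by (rule hilbert.MP[OF hilbert.MP[OF hilbert.S hilbert.MP[OF hilbert.K that(2)]] that(1)])
  have "hilbert_from T \<Gamma> (And A B)"
    by (rule hilbert_from_MP2[OF hilbert.AndI hilbert_from.Hyp B(1)]) (use insert.prems in simp)
  moreover have "\<forall>C\<in>insert A F. \<forall>\<sigma>. hilbert T (Imp (subst \<sigma> (And A B)) (subst \<sigma> C))"
    using B(2) trans[OF hilbert.AndE2] by (auto intro: hilbert.AndE1)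
  ultimately show ?case by blast
qed

lemma hilbert_from_shift:
  assumes "hilbert_from T (subst shift ` \<Gamma>) A"
  obtains B where "hilbert_from T \<Gamma> B" "hilbert T (Imp (subst shift B) A)"
proof -
  obtain F where F: "finite F" "F \<subseteq> subst shift ` \<Gamma>" "hilbert_from T F A"
    using hilbert_from_finite[OF assms] by blast
  then obtain G where G: "finite G" "G \<subseteq> \<Gamma>" "F = subst shift ` G"
    by (meson finite_subset_image)
  obtain B where B: "hilbert_from T \<Gamma> B" "\<forall>A\<in>G. \<forall>\<sigma>. hilbert T (Imp (subst \<sigma> B) (subst \<sigma> A))"
    using conjunction_exists[OF G(1,2)] by blast
  have "hilbert_from T {subst shift B} A"
    by (rule hilbert_from_cut[OF F(3)])
      (use B(2) G(3) in \<open>auto intro: hilbert_from.MP[OF hilbert_from.Thm hilbert_from.Hyp]\<close>)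
  then have "hilbert T (Imp (subst shift B) A)"
    by (rule hilbert_from_empty[OF deduction])
  with B(1) show thesis by (rule that)
qed

lemma hilbert_from_complete: "\<Gamma> \<turnstile>\<^sub>i A \<Longrightarrow> hilbert_from T \<Gamma> A"
proof (induction rule: iprov.induct)
  case (Assm A \<Gamma>) then show ?case by (rule hilbert_from.Hyp)
next
  case (BotE \<Gamma> A) show ?case by (rule hilbert_from.MP[OF hilbert_from.Thm[OF hilbert.BotE] BotE.IH])
next
  case (AndI \<Gamma> A B) show ?case by (rule hilbert_from_MP2[OF hilbert.AndI AndI.IH])
next
  case (AndE1 \<Gamma> A B)
  show ?case by (rule hilbert_from.MP[OF hilbert_from.Thm[OF hilbert.AndE1] AndE1.IH])
next
  case (AndE2 \<Gamma> A B)
  show ?case by (rule hilbert_from.MP[OF hilbert_from.Thm[OF hilbert.AndE2] AndE2.IH])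
next
  case (OrI1 \<Gamma> A B)
  show ?case by (rule hilbert_from.MP[OF hilbert_from.Thm[OF hilbert.OrI1] OrI1.IH])
next
  case (OrI2 \<Gamma> B A)
  show ?case by (rule hilbert_from.MP[OF hilbert_from.Thm[OF hilbert.OrI2] OrI2.IH])
next
  case (OrE \<Gamma> A B C)
  show ?case
    by (rule hilbert_from.MP[OF hilbert_from_MP2[OF hilbert.OrE deduction deduction] OrE.IH(1)])
      (use OrE.IH in auto)
next
  case (ImpI A \<Gamma> B) show ?case by (rule deduction[OF ImpI.IH])
next
  case (ImpE \<Gamma> A B) show ?case by (rule hilbert_from.MP[OF ImpE.IH])
next
  case (ForallI \<Gamma> A)
  obtain B where B: "hilbert_from T \<Gamma> B" "hilbert T (Imp (subst shift B) A)"
    using hilbert_from_shift[OF ForallI.IH] by blast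
  show ?case by (rule hilbert_from.MP[OF hilbert_from.Thm[OF hilbert.ForallI[OF B(2)]] B(1)])
next
  case (ForallE \<Gamma> A t)
  show ?case by (rule hilbert_from.MP[OF hilbert_from.Thm[OF hilbert.ForallE] ForallE.IH])
next
  case (ExistsI \<Gamma> t A)
  show ?case by (rule hilbert_from.MP[OF hilbert_from.Thm[OF hilbert.ExistsI] ExistsI.IH])
next
  case (ExistsE \<Gamma> A C)
  \<comment> \<open>The context is condensed into \<open>B\<close> and moved behind the antecedent
    \<open>A\<close>, so that the existential rule applies; afterwards it is discharged
    again.\<close>
  obtain B where B: "hilbert_from T \<Gamma> B" "hilbert T (Imp (subst shift B) (Imp A (subst shift C)))"
    using hilbert_from_shift[OF deduction[OF ExistsE.IH(2)]] by blast
  have "hilbert_from T {subst shift B, A} (subst shift C)"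
    by (rule hilbert_from_MP2[OF B(2)]) (auto intro: hilbert_from.Hyp)
  then have "hilbert T (Imp A (subst shift (Imp B C)))"
    by (auto intro: hilbert_from_empty[OF deduction[OF deduction]])
  from hilbert_from_MP2[OF hilbert.ExistsE[OF this] ExistsE.IH(1) B(1)] show ?case .
next
  case (EqRefl \<Gamma> t) show ?case by (rule hilbert_from.Thm[OF hilbert.EqRefl])
next
  case (EqSubst \<Gamma> s t A) show ?case by (rule hilbert_from_MP2[OF hilbert.EqSubst EqSubst.IH])
qed

lemma hilbert_iff_iprov:
  assumes "\<And>A. A \<in> T \<Longrightarrow> sentence A"
  shows "hilbert T A \<longleftrightarrow> T \<turnstile>\<^sub>i A"
proof
  assume "T \<turnstile>\<^sub>i A"
  then have "hilbert_from T T A" by (rule hilbert_from_complete)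
  then have "hilbert_from T {} A" by (rule hilbert_from_cut) (simp add: hilbert_from.Thm hilbert.Ax)
  then show "hilbert T A" by (rule hilbert_from_empty)
qed (simp add: hilbert_sound assms)

section \<open>Injectivity of the coding, and lifting of terms\<close>

abbreviation pair :: "nat \<Rightarrow> nat \<Rightarrow> nat" where "pair a b \<equiv> prod_encode (a, b)"

lemma tcode_inject [simp]: "tcode s = tcode t \<longleftrightarrow> s = t"
proof
  show "tcode s = tcode t \<Longrightarrow> s = t"
  proof (induction s arbitrary: t)
    case (Var n) then show ?case by (cases t) auto
  next
    case Zero then show ?case by (cases t) auto
  next
    case (Succ s) then show ?case by (cases t) auto
  next
    case (Add s1 s2) then show ?case by (cases t) auto
  next
    case (Mul s1 s2) then show ?case by (cases t) auto
  qed
qed simp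

lemma code_inject [simp]: "code A = code B \<longleftrightarrow> A = B"
proof
  show "code A = code B \<Longrightarrow> A = B"
  proof (induction A arbitrary: B)
    case (Eq s t) then show ?case by (cases B) auto
  next
    case (Leq s t) then show ?case by (cases B) auto
  next
    case Bot then show ?case by (cases B) auto
  next
    case (And A1 A2) then show ?case by (cases B) auto
  next
    case (Or A1 A2) then show ?case by (cases B) auto
  next
    case (Imp A1 A2) then show ?case by (cases B) auto
  next
    case (Forall A) then show ?case by (cases B) auto
  next
    case (Exists A) then show ?case by (cases B) auto
  qed
qed simp

definition lift :: "nat \<Rightarrow> tm \<Rightarrow> tm" where
  "lift k = tsubst (\<lambda>n. Var (n + k))"

text \<open>The graph of \<open>lift\<close> is generated as a set of coded triples, with the amount
  \<open>k\<close> carried along unchanged; the other leading numbers are the tags of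
  \<open>tcode\<close>.\<close>

definition lift_axiom :: "nat \<Rightarrow> bool" where
  "lift_axiom c \<longleftrightarrow> (\<exists>k n. c = pair k (pair (pair 0 n) (pair 0 (n + k))) \<or>
     c = pair k (pair (pair 1 0) (pair 1 0)))"

definition lift_rule :: "nat \<Rightarrow> nat \<Rightarrow> nat \<Rightarrow> bool" where
  "lift_rule a b c \<longleftrightarrow> (\<exists>k s s' t t'. a = pair k (pair s s') \<and> b = pair k (pair t t') \<and>
     (c = pair k (pair (pair 2 s) (pair 2 s')) \<or>
      c = pair k (pair (pair 3 (pair s t)) (pair 3 (pair s' t'))) \<or>
      c = pair k (pair (pair 4 (pair s t)) (pair 4 (pair s' t')))))"

definition lifted :: "nat \<Rightarrow> nat \<Rightarrow> nat \<Rightarrow> bool" where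
  "lifted k s s' \<longleftrightarrow> closure lift_axiom lift_rule (pair k (pair s s'))"

lemma lifted_tcode: "lifted k (tcode t) (tcode (lift k t))"
proof (induction t)
  case (Var n)
  show ?case unfolding lifted_def
    by (rule closure.base) (simp add: lift_def lift_axiom_def)
next
  case Zero
  show ?case unfolding lifted_def
    by (rule closure.base) (simp add: lift_def lift_axiom_def)
next
  case (Succ t)
  show ?case unfolding lifted_def
    by (rule closure.step[OF Succ.IH[unfolded lifted_def] Succ.IH[unfolded lifted_def]])
      (simp add: lift_def lift_rule_def)
next
  case (Add s t)
  show ?case unfolding lifted_def
    by (rule closure.step[OF Add.IH[unfolded lifted_def]]) (simp add: lift_def lift_rule_def)
next
  case (Mul s t)
  show ?case unfolding lifted_def
    by (rule closure.step[OF Mul.IH[unfolded lifted_def]]) (simp add: lift_def lift_rule_def)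
qed

lemma liftedD: "lifted k a b \<Longrightarrow> \<exists>t. a = tcode t \<and> b = tcode (lift k t)"
proof -
  have "closure lift_axiom lift_rule c \<Longrightarrow> \<exists>k t. c = pair k (pair (tcode t) (tcode (lift k t)))" for c
  proof (induction rule: closure.induct)
    case (base c)
    then obtain k n where "c = pair k (pair (pair 0 n) (pair 0 (n + k))) \<or>
      c = pair k (pair (pair 1 0) (pair 1 0))" by (auto simp: lift_axiom_def)
    then have "c = pair k (pair (tcode (Var n)) (tcode (lift k (Var n)))) \<or>
      c = pair k (pair (tcode Zero) (tcode (lift k Zero)))" by (simp add: lift_def)
    then show ?case by blast
  next
    case (step a b c)
    then obtain k s t where a: "a = pair k (pair (tcode s) (tcode (lift k s)))"
      and b: "b = pair k (pair (tcode t) (tcode (lift k t)))"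
      and "c = pair k (pair (tcode (Succ s)) (tcode (lift k (Succ s)))) \<or>
        c = pair k (pair (tcode (Add s t)) (tcode (lift k (Add s t)))) \<or>
        c = pair k (pair (tcode (Mul s t)) (tcode (lift k (Mul s t))))"
      by (auto simp: lift_rule_def lift_def)
    then show ?case by blast
  qed
  then show "lifted k a b \<Longrightarrow> \<exists>t. a = tcode t \<and> b = tcode (lift k t)"
    unfolding lifted_def by fastforce
qed

lemmas sigma_intros = sigma_ex sigma_conj sigma_disj sigma_eq sigma_less
  sigma_fun_var sigma_fun_const sigma_fun_Suc sigma_fun_add sigma_fun_prod_encode

lemma sigma_lifted:
  assumes "sigma_fun f" "sigma_fun g" "sigma_fun h"
  shows "sigma (\<lambda>e. lifted (f e) (g e) (h e))"
proof -
  have "sigma (\<lambda>e. lift_axiom (e 0))" unfolding lift_axiom_def by (intro sigma_intros)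
  moreover have "sigma (\<lambda>e. lift_rule (e 0) (e 1) (e 2))"
    unfolding lift_rule_def by (intro sigma_intros)
  ultimately have "sigma (\<lambda>e. closure lift_axiom lift_rule (e 0))" by (rule sigma_closure)
  then show ?thesis unfolding lifted_def
    by (rule sigma_rel1) (intro sigma_fun_prod_encode assms)
qed

text \<open>
  The substitutions met when \<open>shift\<close> (for \<open>None\<close>) or \<open>inst t\<close> (for \<open>Some t\<close>) is pushed below
  \<open>k\<close> quantifiers.
\<close>

fun usub :: "nat \<Rightarrow> tm option \<Rightarrow> nat \<Rightarrow> tm" where
  "usub k None n = (if n < k then Var n else Var (Suc n))"
| "usub k (Some t) n = (if n < k then Var n else if n = k then lift k t else Var (n - 1))"

lemma up_usub: "up (usub k w) = usub (Suc k) w"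
proof
  show "up (usub k w) n = usub (Suc k) w n" for n
    by (cases n; cases w) (auto simp: lift_def)
qed

lemma usub_0: "usub 0 None = shift" "usub 0 (Some t) = inst t"
proof -
  show "usub 0 None = shift" by (auto simp: fun_eq_iff)
  show "usub 0 (Some t) = inst t"
  proof
    show "usub 0 (Some t) n = inst t n" for n by (cases n) (auto simp: lift_def)
  qed
qed

section \<open>The graph of substitution on codes\<close>

primrec ocode :: "tm option \<Rightarrow> nat" where
  "ocode None = 0"
| "ocode (Some t) = Suc (tcode t)"

text \<open>
  The tag \<open>i\<close> distinguishes terms (0) from formulas (1), whose codes overlap.
\<close>

abbreviation quint :: "nat \<Rightarrow> nat \<Rightarrow> nat \<Rightarrow> nat \<Rightarrow> nat \<Rightarrow> nat" where
  "quint i k u a b \<equiv> pair i (pair k (pair u (pair a b)))"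

text \<open>Stated by means of \<open>usub\<close>, which keeps the correctness proofs close to the
  syntax; \<open>sigma_subst_axiom\<close> supplies an arithmetical description.\<close>

definition subst_axiom :: "nat \<Rightarrow> bool" where
  "subst_axiom c \<longleftrightarrow> (\<exists>k w. (\<exists>n. c = quint 0 k (ocode w) (pair 0 n) (tcode (usub k w n)))
     \<or> c = quint 0 k (ocode w) (pair 1 0) (pair 1 0)
     \<or> c = quint 1 k (ocode w) (pair 2 0) (pair 2 0))"

text \<open>The leading tag changes from 0 to 1 where two terms form an atomic formula. A quantified
  formula at depth \<open>k\<close> rests on its body at depth \<open>Suc k\<close>, in accordance
  with \<open>up_usub\<close>.\<close>

definition subst_rule :: "nat \<Rightarrow> nat \<Rightarrow> nat \<Rightarrow> bool" where
  "subst_rule a b c \<longleftrightarrow>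
     (\<exists>k u s s'. a = quint 0 k u s s' \<and> c = quint 0 k u (pair 2 s) (pair 2 s')) \<or>
     (\<exists>k u s s'. a = quint 1 (Suc k) u s s' \<and>
        (c = quint 1 k u (pair 6 s) (pair 6 s') \<or> c = quint 1 k u (pair 7 s) (pair 7 s'))) \<or>
     (\<exists>k u s s' t t'. a = quint 0 k u s s' \<and> b = quint 0 k u t t' \<and>
        (c = quint 0 k u (pair 3 (pair s t)) (pair 3 (pair s' t')) \<or>
         c = quint 0 k u (pair 4 (pair s t)) (pair 4 (pair s' t')) \<or>
         c = quint 1 k u (pair 0 (pair s t)) (pair 0 (pair s' t')) \<or>
         c = quint 1 k u (pair 1 (pair s t)) (pair 1 (pair s' t')))) \<or>
     (\<exists>k u s s' t t'. a = quint 1 k u s s' \<and> b = quint 1 k u t t' \<and>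
        (c = quint 1 k u (pair 3 (pair s t)) (pair 3 (pair s' t')) \<or>
         c = quint 1 k u (pair 4 (pair s t)) (pair 4 (pair s' t')) \<or>
         c = quint 1 k u (pair 5 (pair s t)) (pair 5 (pair s' t'))))"

abbreviation subst_closure :: "nat \<Rightarrow> bool" where
  "subst_closure \<equiv> closure subst_axiom subst_rule"

lemma subst_closure_tm:
  "subst_closure (quint 0 k (ocode w) (tcode t) (tcode (tsubst (usub k w) t)))"
proof (induction t)
  case (Var n)
  show ?case by (rule closure.base) (auto simp: subst_axiom_def)
next
  case Zero
  show ?case by (rule closure.base) (auto simp: subst_axiom_def)
next
  case (Succ t)
  show ?case by (rule closure.step[OF Succ.IH Succ.IH]) (simp add: subst_rule_def)
next
  case (Add s t)
  show ?case by (rule closure.step[OF Add.IH]) (simp add: subst_rule_def)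
next
  case (Mul s t)
  show ?case by (rule closure.step[OF Mul.IH]) (simp add: subst_rule_def)
qed

lemma subst_closure_fm:
  "subst_closure (quint 1 k (ocode w) (code A) (code (subst (usub k w) A)))"
proof (induction A arbitrary: k)
  case (Eq s t)
  show ?case
    by (rule closure.step[OF subst_closure_tm[of k w s] subst_closure_tm[of k w t]])
      (simp add: subst_rule_def)
next
  case (Leq s t)
  show ?case
    by (rule closure.step[OF subst_closure_tm[of k w s] subst_closure_tm[of k w t]])
      (simp add: subst_rule_def)
next
  case Bot
  show ?case by (rule closure.base) (auto simp: subst_axiom_def)
next
  case (And A B)
  show ?case by (rule closure.step[OF And.IH]) (simp add: subst_rule_def)
next
  case (Or A B)
  show ?case by (rule closure.step[OF Or.IH]) (simp add: subst_rule_def)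
next
  case (Imp A B)
  show ?case by (rule closure.step[OF Imp.IH]) (simp add: subst_rule_def)
next
  case (Forall A)
  show ?case
    by (rule closure.step[OF Forall.IH Forall.IH]) (simp add: subst_rule_def up_usub)
next
  case (Exists A)
  show ?case
    by (rule closure.step[OF Exists.IH Exists.IH]) (simp add: subst_rule_def up_usub)
qed

lemma subst_closureD:
  "subst_closure c \<Longrightarrow>
     (\<exists>k w t. c = quint 0 k (ocode w) (tcode t) (tcode (tsubst (usub k w) t))) \<or>
     (\<exists>k w A. c = quint 1 k (ocode w) (code A) (code (subst (usub k w) A)))"
  (is "_ \<Longrightarrow> ?T c \<or> ?F c")
proof (induction rule: closure.induct)
  case (base c)
  then obtain k w n where "c = quint 0 k (ocode w) (pair 0 n) (tcode (usub k w n))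
     \<or> c = quint 0 k (ocode w) (pair 1 0) (pair 1 0) \<or> c = quint 1 k (ocode w) (pair 2 0) (pair 2 0)"
    by (auto simp: subst_axiom_def)
  then have "c = quint 0 k (ocode w) (tcode (Var n)) (tcode (tsubst (usub k w) (Var n)))
     \<or> c = quint 0 k (ocode w) (tcode Zero) (tcode (tsubst (usub k w) Zero))
     \<or> c = quint 1 k (ocode w) (code Bot) (code (subst (usub k w) Bot))" by simp
  then show ?case by blast
next
  case (step a b c)
  from step.hyps(3) consider
    k u s s' where "a = quint 0 k u s s'" "c = quint 0 k u (pair 2 s) (pair 2 s')"
  | k u s s' where "a = quint 1 (Suc k) u s s'"
      "c = quint 1 k u (pair 6 s) (pair 6 s') \<or> c = quint 1 k u (pair 7 s) (pair 7 s')"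
  | k u s s' t t' where "a = quint 0 k u s s'" "b = quint 0 k u t t'"
      "c = quint 0 k u (pair 3 (pair s t)) (pair 3 (pair s' t')) \<or>
       c = quint 0 k u (pair 4 (pair s t)) (pair 4 (pair s' t')) \<or>
       c = quint 1 k u (pair 0 (pair s t)) (pair 0 (pair s' t')) \<or>
       c = quint 1 k u (pair 1 (pair s t)) (pair 1 (pair s' t'))"
  | k u s s' t t' where "a = quint 1 k u s s'" "b = quint 1 k u t t'"
      "c = quint 1 k u (pair 3 (pair s t)) (pair 3 (pair s' t')) \<or>
       c = quint 1 k u (pair 4 (pair s t)) (pair 4 (pair s' t')) \<or>
       c = quint 1 k u (pair 5 (pair s t)) (pair 5 (pair s' t'))"
    unfolding subst_rule_def by blast
  then show ?case
  proof cases
    case 1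
    then obtain w t where "u = ocode w" "s = tcode t" "s' = tcode (tsubst (usub k w) t)"
      using step.IH(1) by auto
    with 1 have "c = quint 0 k (ocode w) (tcode (Succ t)) (tcode (tsubst (usub k w) (Succ t)))"
      by simp
    then show ?thesis by blast
  next
    case 2
    then obtain w A where "u = ocode w" "s = code A" "s' = code (subst (usub (Suc k) w) A)"
      using step.IH(1) by auto
    with 2 have "c = quint 1 k (ocode w) (code (Forall A)) (code (subst (usub k w) (Forall A))) \<or>
      c = quint 1 k (ocode w) (code (Exists A)) (code (subst (usub k w) (Exists A)))"
      by (simp add: up_usub)
    then show ?thesis by blast
  next
    case 3
    then obtain w x where x: "u = ocode w" "s = tcode x" "s' = tcode (tsubst (usub k w) x)"
      using step.IH(1) by auto
    \<comment> \<open>Both premises carry the same parameter code, so injectivity of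
      \<open>ocode\<close> makes them instances of the same substitution.\<close>
    have inj: "ocode v = ocode w \<Longrightarrow> v = w" for v by (cases v; cases w) auto
    obtain y where y: "t = tcode y" "t' = tcode (tsubst (usub k w) y)"
      using step.IH(2) 3(2) x(1) inj by auto
    from 3(3) x y have "c = quint 0 k (ocode w) (tcode (Add x y)) (tcode (tsubst (usub k w) (Add x y))) \<or>
      c = quint 0 k (ocode w) (tcode (Mul x y)) (tcode (tsubst (usub k w) (Mul x y))) \<or>
      c = quint 1 k (ocode w) (code (Eq x y)) (code (subst (usub k w) (Eq x y))) \<or>
      c = quint 1 k (ocode w) (code (Leq x y)) (code (subst (usub k w) (Leq x y)))"
      by simp
    then show ?thesis by blast
  next
    case 4
    then obtain w x where x: "u = ocode w" "s = code x" "s' = code (subst (usub k w) x)"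
      using step.IH(1) by auto
    have inj: "ocode v = ocode w \<Longrightarrow> v = w" for v by (cases v; cases w) auto
    obtain y where y: "t = code y" "t' = code (subst (usub k w) y)"
      using step.IH(2) 4(2) x(1) inj by auto
    from 4(3) x y have "c = quint 1 k (ocode w) (code (And x y)) (code (subst (usub k w) (And x y))) \<or>
      c = quint 1 k (ocode w) (code (Or x y)) (code (subst (usub k w) (Or x y))) \<or>
      c = quint 1 k (ocode w) (code (Imp x y)) (code (subst (usub k w) (Imp x y)))"
      by simp
    then show ?thesis by blast
  qed
qed

text \<open>The codes of terms form the domain of \<open>lifted\<close>, which is already known to
  be Sigma-1.\<close>

lemma sigma_is_tcode: "sigma_fun f \<Longrightarrow> sigma (\<lambda>e. \<exists>t. f e = tcode t)"
proof -
  have "(\<exists>t. a = tcode t) \<longleftrightarrow> (\<exists>b. lifted 0 a b)" for a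
    using lifted_tcode liftedD by blast
  moreover have "sigma (\<lambda>e. \<exists>b. lifted 0 (e 0) b)"
    by (intro sigma_ex sigma_lifted sigma_fun_var sigma_fun_const)
  ultimately have "sigma (\<lambda>e. \<exists>t. e 0 = tcode t)" by simp
  then show "sigma_fun f \<Longrightarrow> sigma (\<lambda>e. \<exists>t. f e = tcode t)" by (rule sigma_rel1)
qed

text \<open>A variable gives five cases: below \<open>k\<close> or not for shifting, and below, at
  or above \<open>k\<close> for instantiation. Subtraction and the condition
  \<open>n \<ge> k\<close> are removed by writing the variable as \<open>n + k\<close> or
  \<open>Suc (n + k)\<close>.\<close>

lemma sigma_subst_axiom: "sigma (\<lambda>e. subst_axiom (e 0))"
proof -
  let ?is_tcode = "\<lambda>a. \<exists>t. a = tcode t"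
  have var: "(\<exists>k w n. c = quint 0 k (ocode w) (pair 0 n) (tcode (usub k w n))) \<longleftrightarrow>
    (\<exists>k n. n < k \<and> c = quint 0 k 0 (pair 0 n) (pair 0 n)) \<or>
    (\<exists>k n. c = quint 0 k 0 (pair 0 (n + k)) (pair 0 (Suc (n + k)))) \<or>
    (\<exists>k n t. ?is_tcode t \<and> n < k \<and> c = quint 0 k (Suc t) (pair 0 n) (pair 0 n)) \<or>
    (\<exists>k t t'. lifted k t t' \<and> c = quint 0 k (Suc t) (pair 0 k) t') \<or>
    (\<exists>k n t. ?is_tcode t \<and> c = quint 0 k (Suc t) (pair 0 (Suc (n + k))) (pair 0 (n + k)))"
    (is "?L \<longleftrightarrow> ?R1 \<or> ?R2 \<or> ?R3 \<or> ?R4 \<or> ?R5") for c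
  proof
    assume ?L
    then obtain k w n where c: "c = quint 0 k (ocode w) (pair 0 n) (tcode (usub k w n))" by blast
    show "?R1 \<or> ?R2 \<or> ?R3 \<or> ?R4 \<or> ?R5"
    proof (cases w)
      case None
      show ?thesis
      proof (cases "n < k")
        case True with None c have "c = quint 0 k 0 (pair 0 n) (pair 0 n)" by simp
        with True show ?thesis by blast
      next
        case False
        with None c have "c = quint 0 k 0 (pair 0 (n - k + k)) (pair 0 (Suc (n - k + k)))" by simp
        then show ?thesis by blast
      qed
    next
      case (Some t)
      consider "n < k" | "n = k" | m where "n = Suc (m + k)"
        by (metis add.commute less_imp_Suc_add linorder_neqE_nat)
      then show ?thesis
      proof cases
        case 1 with Some c have "c = quint 0 k (Suc (tcode t)) (pair 0 n) (pair 0 n)" by simp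
        with 1 show ?thesis by blast
      next
        case 2 with Some c have "c = quint 0 k (Suc (tcode t)) (pair 0 k) (tcode (lift k t))" by simp
        with lifted_tcode[of k t] have ?R4 by (intro exI conjI)
        then show ?thesis by simp
      next
        case 3 with Some c
        have "c = quint 0 k (Suc (tcode t)) (pair 0 (Suc (m + k))) (pair 0 (m + k))" by simp
        then show ?thesis by blast
      qed
    qed
  next
    have I: ?L if "c = quint 0 k (ocode w) (pair 0 n) (tcode (usub k w n))" for k w n
      using that by blast
    assume "?R1 \<or> ?R2 \<or> ?R3 \<or> ?R4 \<or> ?R5"
    then show ?L
    proof (elim disjE)
      assume ?R1
      then obtain k n where "n < k" "c = quint 0 k 0 (pair 0 n) (pair 0 n)" by (elim exE conjE)
      then show ?L by (intro I[of k None n]) simp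
    next
      assume ?R2
      then obtain k n where "c = quint 0 k 0 (pair 0 (n + k)) (pair 0 (Suc (n + k)))" by (elim exE)
      then show ?L by (intro I[of k None "n + k"]) simp
    next
      assume ?R3
      then obtain k n t where "n < k" "c = quint 0 k (Suc (tcode t)) (pair 0 n) (pair 0 n)"
        by (elim exE conjE) simp
      then show ?L by (intro I[of k "Some t" n]) simp
    next
      assume ?R4
      then obtain k a b where ab: "lifted k a b" "c = quint 0 k (Suc a) (pair 0 k) b" by (elim exE conjE)
      from liftedD[OF ab(1)] obtain t where "a = tcode t" "b = tcode (lift k t)" by (elim exE conjE)
      with ab(2) show ?L by (intro I[of k "Some t" k]) simp
    next
      assume ?R5
      then obtain k n t where "c = quint 0 k (Suc (tcode t)) (pair 0 (Suc (n + k))) (pair 0 (n + k))"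
        by (elim exE conjE) simp
      then show ?L by (intro I[of k "Some t" "Suc (n + k)"]) simp
    qed
  qed
  have w: "(\<exists>w. u = ocode w) \<longleftrightarrow> u = 0 \<or> (\<exists>t. ?is_tcode t \<and> u = Suc t)" for u
  proof
    assume "\<exists>w. u = ocode w"
    then obtain w where "u = ocode w" by blast
    then show "u = 0 \<or> (\<exists>t. ?is_tcode t \<and> u = Suc t)" by (cases w) auto
  next
    assume "u = 0 \<or> (\<exists>t. ?is_tcode t \<and> u = Suc t)"
    then show "\<exists>w. u = ocode w" by (metis ocode.simps)
  qed
  have "subst_axiom c \<longleftrightarrow> (\<exists>k w n. c = quint 0 k (ocode w) (pair 0 n) (tcode (usub k w n)))
    \<or> (\<exists>k u. (\<exists>w. u = ocode w) \<and>
        (c = quint 0 k u (pair 1 0) (pair 1 0) \<or> c = quint 1 k u (pair 2 0) (pair 2 0)))"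
    for c unfolding subst_axiom_def by blast
  then show ?thesis
    unfolding var w by (simp only:) (intro sigma_intros sigma_lifted sigma_is_tcode)
qed

definition substituted :: "nat \<Rightarrow> nat \<Rightarrow> nat \<Rightarrow> bool" where
  "substituted u a b \<longleftrightarrow> subst_closure (quint 1 0 u a b)"

lemma substituted_iff:
  "substituted u a b \<longleftrightarrow> (\<exists>w A. u = ocode w \<and> a = code A \<and> b = code (subst (usub 0 w) A))"
  unfolding substituted_def
  using subst_closure_fm[of 0] subst_closureD[of "quint 1 0 u a b"] by auto

lemma substituted_shift: "substituted 0 a b \<longleftrightarrow> (\<exists>A. a = code A \<and> b = code (subst shift A))"
proof -
  have "0 = ocode w \<longleftrightarrow> w = None" for w by (cases w) auto
  then show ?thesis by (auto simp: substituted_iff usub_0)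
qed

lemma substituted_inst:
  "substituted (Suc u) a b \<longleftrightarrow> (\<exists>t A. u = tcode t \<and> a = code A \<and> b = code (subst (inst t) A))"
proof -
  have "Suc u = ocode w \<longleftrightarrow> (\<exists>t. w = Some t \<and> u = tcode t)" for w by (cases w) auto
  then show ?thesis by (auto simp: substituted_iff usub_0)
qed

lemma sigma_substituted:
  assumes "sigma_fun f" "sigma_fun g" "sigma_fun h"
  shows "sigma (\<lambda>e. substituted (f e) (g e) (h e))"
proof -
  have "sigma (\<lambda>e. subst_rule (e 0) (e 1) (e 2))"
    unfolding subst_rule_def by (intro sigma_intros)
  with sigma_subst_axiom have "sigma (\<lambda>e. subst_closure (e 0))" by (rule sigma_closure)
  then show ?thesis unfolding substituted_def
    by (rule sigma_rel1) (intro sigma_fun_prod_encode sigma_fun_const assms)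
qed

text \<open>The codes of formulas form the domain of the coded shift.\<close>

lemma sigma_is_code:
  assumes "sigma_fun f" shows "sigma (\<lambda>e. \<exists>A. f e = code A)"
proof -
  have "sigma (\<lambda>e. \<exists>b. substituted 0 (f e) b)"
    by (intro sigma_ex sigma_substituted sigma_fun_var sigma_fun_const sigma_fun_rename[OF assms])
  then show ?thesis by (simp add: substituted_shift)
qed


section \<open>The set of codes of theorems\<close>

definition hilbert_axiom :: "fm set \<Rightarrow> nat \<Rightarrow> bool" where
  "hilbert_axiom T c \<longleftrightarrow> c \<in> code ` T
     \<or> (\<exists>A B C. c \<in> {code (Imp A (Imp B A)),
          code (Imp (Imp A (Imp B C)) (Imp (Imp A B) (Imp A C))),
          code (Imp Bot A), code (Imp A (Imp B (And A B))), code (Imp (And A B) A),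
          code (Imp (And A B) B), code (Imp A (Or A B)), code (Imp B (Or A B)),
          code (Imp (Imp A C) (Imp (Imp B C) (Imp (Or A B) C)))})
     \<or> (\<exists>A t. c \<in> {code (Imp (Forall A) (subst (inst t) A)), code (Imp (subst (inst t) A) (Exists A))})
     \<or> (\<exists>t. c = code (Eq t t))
     \<or> (\<exists>A s t. c = code (Imp (Eq s t) (Imp (subst (inst s) A) (subst (inst t) A))))"

text \<open>5, 6 and 7 are the tags of \<open>Imp\<close>, \<open>Forall\<close> and
  \<open>Exists\<close>. The eigenvariable condition appears as \<open>substituted 0 x y\<close>:
  here \<open>y\<close> codes the shift of the formula coded by \<open>x\<close>.\<close>

definition hilbert_rule :: "nat \<Rightarrow> nat \<Rightarrow> nat \<Rightarrow> bool" where
  "hilbert_rule a b c \<longleftrightarrow> a = pair 5 (pair b c) \<or>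
     (\<exists>x y z. substituted 0 x y \<and>
        (a = pair 5 (pair y z) \<and> c = pair 5 (pair x (pair 6 z)) \<or>
         a = pair 5 (pair z y) \<and> c = pair 5 (pair (pair 7 z) x)))"

lemma closure_hilbertD:
  "closure (hilbert_axiom T) hilbert_rule c \<Longrightarrow> \<exists>A. c = code A \<and> hilbert T A"
proof (induction rule: closure.induct)
  case (base c)
  then show ?case unfolding hilbert_axiom_def insert_iff empty_iff simp_thms
    by (elim disjE exE imageE; blast intro: hilbert.Ax hilbert.K hilbert.S hilbert.BotE hilbert.AndI
        hilbert.AndE1 hilbert.AndE2 hilbert.OrI1 hilbert.OrI2 hilbert.OrE hilbert.ForallE
        hilbert.ExistsI hilbert.EqRefl hilbert.EqSubst)
next
  case (step a b c)
  then obtain A B where A: "a = code A" "hilbert T A" and B: "b = code B" "hilbert T B" by blast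
  have imp: "\<exists>E F. A = Imp E F \<and> x = code E \<and> y = code F" if "a = pair 5 (pair x y)" for x y
    using that A(1) by (cases A) auto
  from step.hyps(3) consider "a = pair 5 (pair b c)"
    | C z where "a = pair 5 (pair (code (subst shift C)) z)" "c = pair 5 (pair (code C) (pair 6 z))"
    | C z where "a = pair 5 (pair z (code (subst shift C)))" "c = pair 5 (pair (pair 7 z) (code C))"
    unfolding hilbert_rule_def substituted_shift by blast
  then show ?case
  proof cases
    case 1
    with imp[OF 1] A B show ?thesis by (auto intro: hilbert.MP)
  next
    case 2
    with imp[OF 2(1)] obtain F where "A = Imp (subst shift C) F" "z = code F" by auto
    with A(2) 2(2) have "c = code (Imp C (Forall F))" "hilbert T (Imp C (Forall F))"
      by (simp_all add: hilbert.ForallI)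
    then show ?thesis by blast
  next
    case 3
    with imp[OF 3(1)] obtain F where "A = Imp F (subst shift C)" "z = code F" by auto
    with A(2) 3(2) have "c = code (Imp (Exists F) C)" "hilbert T (Imp (Exists F) C)"
      by (simp_all add: hilbert.ExistsE)
    then show ?thesis by blast
  qed
qed

lemma closure_hilbertI: "hilbert T A \<Longrightarrow> closure (hilbert_axiom T) hilbert_rule (code A)"
proof (induction rule: hilbert.induct)
  case (MP A B)
  show ?case by (rule closure.step[OF MP.IH]) (simp add: hilbert_rule_def)
next
  case (ForallI B A)
  show ?case
    by (rule closure.step[OF ForallI.IH ForallI.IH])
      (force simp: hilbert_rule_def substituted_shift)
next
  case (ExistsE A B)
  show ?case
    by (rule closure.step[OF ExistsE.IH ExistsE.IH])
      (force simp: hilbert_rule_def substituted_shift)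
qed (rule closure.base; unfold hilbert_axiom_def insert_iff; blast)+

lemma sigma_hilbert:
  assumes "sigma (\<lambda>e. e 0 \<in> code ` T)"
  shows "sigma (\<lambda>e. \<exists>A. e 0 = code A \<and> hilbert T A)"
proof -
  let ?fm = "\<lambda>a. \<exists>A. a = code A" and ?tm = "\<lambda>a. \<exists>t. a = tcode t"
  \<comment> \<open>Each schema is restated with numerical variables that are constrained to be
    codes; in that form the closure properties of \<open>sigma\<close> apply.\<close>
  have 1: "(\<exists>A B C. c \<in> {code (Imp A (Imp B A)),
          code (Imp (Imp A (Imp B C)) (Imp (Imp A B) (Imp A C))),
          code (Imp Bot A), code (Imp A (Imp B (And A B))), code (Imp (And A B) A),
          code (Imp (And A B) B), code (Imp A (Or A B)), code (Imp B (Or A B)),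
          code (Imp (Imp A C) (Imp (Imp B C) (Imp (Or A B) C)))}) \<longleftrightarrow>
    (\<exists>x y z. ?fm x \<and> ?fm y \<and> ?fm z \<and>
      (c = pair 5 (pair x (pair 5 (pair y x))) \<or>
       c = pair 5 (pair (pair 5 (pair x (pair 5 (pair y z))))
             (pair 5 (pair (pair 5 (pair x y)) (pair 5 (pair x z))))) \<or>
       c = pair 5 (pair (pair 2 0) x) \<or>
       c = pair 5 (pair x (pair 5 (pair y (pair 3 (pair x y))))) \<or>
       c = pair 5 (pair (pair 3 (pair x y)) x) \<or>
       c = pair 5 (pair (pair 3 (pair x y)) y) \<or>
       c = pair 5 (pair x (pair 4 (pair x y))) \<or>
       c = pair 5 (pair y (pair 4 (pair x y))) \<or>
       c = pair 5 (pair (pair 5 (pair x z)) (pair 5 (pair (pair 5 (pair y z))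
             (pair 5 (pair (pair 4 (pair x y)) z)))))))" for c
    unfolding insert_iff empty_iff code.simps by blast
  have 2: "(\<exists>A t. c \<in> {code (Imp (Forall A) (subst (inst t) A)), code (Imp (subst (inst t) A) (Exists A))})
    \<longleftrightarrow> (\<exists>t x y. substituted (Suc t) x y \<and>
       (c = pair 5 (pair (pair 6 x) y) \<or> c = pair 5 (pair y (pair 7 x))))" for c
    unfolding insert_iff empty_iff code.simps substituted_inst by blast
  have 3: "(\<exists>t. c = code (Eq t t)) \<longleftrightarrow> (\<exists>t. ?tm t \<and> c = pair 0 (pair t t))" for c
    by auto
  have 4: "(\<exists>A s t. c = code (Imp (Eq s t) (Imp (subst (inst s) A) (subst (inst t) A)))) \<longleftrightarrow>
    (\<exists>s t x y z. substituted (Suc s) x y \<and> substituted (Suc t) x z \<and>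
       c = pair 5 (pair (pair 0 (pair s t)) (pair 5 (pair y z))))" for c
    unfolding code.simps substituted_inst by (auto; blast)
  have "sigma (\<lambda>e. hilbert_axiom T (e 0))"
    unfolding hilbert_axiom_def 1 2 3 4
    by (intro sigma_intros sigma_substituted sigma_is_code sigma_is_tcode assms)
  moreover have "sigma (\<lambda>e. hilbert_rule (e 0) (e 1) (e 2))"
    unfolding hilbert_rule_def by (intro sigma_intros sigma_substituted)
  ultimately have "sigma (\<lambda>e. closure (hilbert_axiom T) hilbert_rule (e 0))" by (rule sigma_closure)
  moreover have "closure (hilbert_axiom T) hilbert_rule c \<longleftrightarrow> (\<exists>A. c = code A \<and> hilbert T A)" for c
    using closure_hilbertD closure_hilbertI by blast
  ultimately show ?thesis by simp
qed

lemma sigma_rec_enum: "rec_enum X \<Longrightarrow> sigma (\<lambda>e. e 0 \<in> X)"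
proof -
  assume "rec_enum X"
  then consider "X = {}" | f where "total_recursive 1 f" "X = range (\<lambda>n. f [n])"
    by (auto simp: rec_enum_def)
  then show ?thesis
  proof cases
    case 1
    have "sigma (\<lambda>e. e 0 = Suc (e 0))" by (intro sigma_intros)
    with 1 show ?thesis by simp
  next
    case 2
    have "sigma_fun (\<lambda>e. f [e 0])" using total_recursive_sigma[OF 2(1)] by simp
    then have "sigma (\<lambda>e. \<exists>n. f [n] = e 0)"
      unfolding sigma_fun_def
      by (intro sigma_ex) (use sigma_rename[of "\<lambda>e. f [e (Suc 0)] = e 0" "case_nat 1 (\<lambda>_. 0)"] in simp)
    with 2(2) show ?thesis by (simp add: image_iff eq_commute)
  qed
qed

lemma sigma_provable:
  assumes "\<And>A. A \<in> T \<Longrightarrow> sentence A" "re_theory T"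
  shows "sigma (\<lambda>e. \<exists>A. e 0 = code A \<and> T \<turnstile>\<^sub>i A)"
proof -
  have "sigma (\<lambda>e. \<exists>A. e 0 = code A \<and> hilbert T A)"
    using assms(2) unfolding re_theory_def by (intro sigma_hilbert sigma_rec_enum)
  moreover have "hilbert T A \<longleftrightarrow> T \<turnstile>\<^sub>i A" for A by (rule hilbert_iff_iprov[OF assms(1)])
  ultimately show ?thesis by simp
qed

lemma sigma_fun_numeral: "sigma_fun f \<Longrightarrow> sigma_fun (\<lambda>e. tcode (numeral_tm (f e)))"
proof -
  have "tcode (numeral_tm n) = rec_nat (pair 1 0) (\<lambda>n r. pair 2 r) n" for n
    by (induction n) auto
  moreover have "sigma_fun (\<lambda>e. rec_nat (pair 1 0) (\<lambda>n r. pair 2 (case_nat n (case_nat r e) 1)) (f e))"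
    if "sigma_fun f"
    by (rule sigma_fun_rec_nat[where G = "\<lambda>e. pair 2 (e 1)"]) (intro sigma_intros that)+
  ultimately show "sigma_fun f \<Longrightarrow> sigma_fun (\<lambda>e. tcode (numeral_tm (f e)))" by simp
qed

section \<open>The Rosser argument\<close>

text \<open>
  In \<open>\<phi>\<close> and \<open>\<psi>\<close> below, the free variables 0 and 1 stand for their own codes; inside \<open>c\<close> and
  \<open>d\<close>, which sit below two quantifiers, these are the variables 2 and 3. Substituting the
  numerals for them produces the fixed point, and no diagonal lemma inside HA is needed.
\<close>

lemma diagonal_pair:
  assumes T: "\<And>A. A \<in> T \<Longrightarrow> sentence A" and re: "re_theory T"
    and \<Phi>: "\<And>\<sigma> c d. subst \<sigma> (\<Phi> c d) = \<Phi> (subst (up (up \<sigma>)) c) (subst (up (up \<sigma>)) d)"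
    and \<Psi>: "\<And>\<sigma> c d. subst \<sigma> (\<Psi> c d) = \<Psi> (subst (up (up \<sigma>)) c) (subst (up (up \<sigma>)) d)"
  obtains c d C D where
    "fv c \<subseteq> {0}" "fv d \<subseteq> {0}" "peano_axioms \<turnstile>\<^sub>i Dec c" "peano_axioms \<turnstile>\<^sub>i Dec d"
    "\<And>n. peano_axioms \<turnstile>\<^sub>i (if C n then subst (inst (numeral_tm n)) c else Neg (subst (inst (numeral_tm n)) c))"
    "\<And>n. peano_axioms \<turnstile>\<^sub>i (if D n then subst (inst (numeral_tm n)) d else Neg (subst (inst (numeral_tm n)) d))"
    "(\<exists>n. C n) \<longleftrightarrow> T \<turnstile>\<^sub>i \<Phi> c d" "(\<exists>n. D n) \<longleftrightarrow> T \<turnstile>\<^sub>i \<Psi> c d"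
proof -
  \<comment> \<open>The formula coded by \<open>p\<close> has two open places: the numeral of
    \<open>f\<close> is put for variable 0, whereupon variable 1 becomes variable 0 and receives the
    numeral of \<open>h\<close>.\<close>
  define prov where "prov p f h \<longleftrightarrow> (\<exists>q r. substituted (Suc (tcode (numeral_tm f))) p q
    \<and> substituted (Suc (tcode (numeral_tm h))) q r \<and> (\<exists>A. r = code A \<and> T \<turnstile>\<^sub>i A))" for p f h
  have "sigma (\<lambda>e. prov (e 0) (e 1) (e 2))"
    unfolding prov_def
    by (intro sigma_ex sigma_conj sigma_substituted sigma_fun_Suc sigma_fun_numeral sigma_fun_var
        sigma_rel1[OF sigma_provable[OF T re]])
  then obtain Q where Q: "decidable Q" "\<And>e. prov (e 0) (e 1) (e 2) \<longleftrightarrow> (\<exists>y. Q (case_nat y e))"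
    by (rule sigmaE) blast
  then obtain B where B: "represents B Q" by (auto simp: decidable_def)
  \<comment> \<open>\<open>B\<close> has the stage in variable 0 and the three arguments of
    \<open>prov\<close> behind it. Closing all further variables by \<open>Zero\<close> leaves only
    the stage free once the arguments are numerals.\<close>
  define s where "s a b c = case_nat (Var 0) (case_nat a (case_nat b (case_nat c (\<lambda>_. Zero))))" for a b c
  \<comment> \<open>The first argument of \<open>prov\<close> names the formula spoken about:
    \<open>Var 2\<close> makes it \<phi> in the first matrix, \<open>Var 3\<close> makes it \<psi>
    in the second.\<close>
  define \<phi> where "\<phi> = \<Phi> (subst (s (Var 2) (Var 2) (Var 3)) B) (subst (s (Var 3) (Var 2) (Var 3)) B)"
  define \<psi> where "\<psi> = \<Psi> (subst (s (Var 2) (Var 2) (Var 3)) B) (subst (s (Var 3) (Var 2) (Var 3)) B)"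
  define f h where "f = code \<phi>" and "h = code \<psi>"
  define E where "E k = subst (s (numeral_tm k) (numeral_tm f) (numeral_tm h)) B" for k
  \<comment> \<open>The default value 0 matches the \<open>Zero\<close> in \<open>s\<close>.\<close>
  define V where "V k n = Q (case_nat n (case_nat k (case_nat f (case_nat h (\<lambda>_. 0)))))" for k n
  have prov: "prov (code A) f h \<longleftrightarrow> T \<turnstile>\<^sub>i subst (inst (numeral_tm h)) (subst (inst (numeral_tm f)) A)" for A
    unfolding prov_def substituted_inst by (auto simp del: subst_subst)
  have s_subst: "subst (up (up (inst (numeral_tm h)))) (subst (up (up (inst (numeral_tm f)))) (subst (s a (Var 2) (Var 3)) B))
      = subst (s (tsubst (up (up (inst (numeral_tm h)))) (tsubst (up (up (inst (numeral_tm f)))) a))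
          (numeral_tm f) (numeral_tm h)) B" for a
    unfolding subst_subst s_def
    by (rule subst_eqI) (auto simp: numeral_2_eq_2 numeral_3_eq_3 split: nat.split)
  \<comment> \<open>Filling both open places turns the two matrices into \<open>E f\<close> and
    \<open>E h\<close>, which are the required \<open>c\<close> and \<open>d\<close>.\<close>
  have E: "subst (up (up (inst (numeral_tm h)))) (subst (up (up (inst (numeral_tm f)))) (subst (s (Var 2) (Var 2) (Var 3)) B)) = E f"
    "subst (up (up (inst (numeral_tm h)))) (subst (up (up (inst (numeral_tm f)))) (subst (s (Var 3) (Var 2) (Var 3)) B)) = E h"
    unfolding s_subst E_def by (simp_all add: numeral_2_eq_2 numeral_3_eq_3)
  have "fv (E k) \<subseteq> {0}" for k
    unfolding E_def fv_subst by (auto simp: s_def split: nat.splits)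
  moreover have "peano_axioms \<turnstile>\<^sub>i Dec (E k)" for k
    using peano_axioms_subst[OF represents_Dec[OF B] arith_peano_axioms] by (simp add: E_def)
  moreover have "peano_axioms \<turnstile>\<^sub>i (if V k n then subst (inst (numeral_tm n)) (E k)
      else Neg (subst (inst (numeral_tm n)) (E k)))" for k n
  proof -
    let ?e = "case_nat n (case_nat k (case_nat f (case_nat h (\<lambda>_. 0))))"
    have "subst (inst (numeral_tm n)) (E k) = subst (num ?e) B"
      unfolding E_def subst_subst s_def by (rule subst_eqI) (auto split: nat.split)
    then show ?thesis
      using represents_true[OF B, of ?e] represents_false[OF B, of ?e] by (simp add: V_def)
  qed
  moreover have V: "(\<exists>n. V k n) \<longleftrightarrow> prov k f h" for k
    unfolding V_def using Q(2)[of "case_nat k (case_nat f (case_nat h (\<lambda>_. 0)))"]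
    by (simp add: numeral_2_eq_2)
  have "(\<exists>n. V f n) \<longleftrightarrow> T \<turnstile>\<^sub>i \<Phi> (E f) (E h)"
    unfolding V using prov[of \<phi>] unfolding f_def[symmetric]
    by (simp add: \<phi>_def \<Phi> E del: subst_subst)
  moreover have "(\<exists>n. V h n) \<longleftrightarrow> T \<turnstile>\<^sub>i \<Psi> (E f) (E h)"
    unfolding V using prov[of \<psi>] unfolding h_def[symmetric]
    by (simp add: \<psi>_def \<Psi> E del: subst_subst)
  ultimately show thesis by (intro that[of "E f" "E h" "V f" "V h"])
qed

text \<open>A quantifier bounded by a numeral is a finite disjunction, from which the disjunction
  property splits off the last member at each step. Free variables are tracked because the property
  concerns sentences.\<close>

lemma disjunction_property_bex:
  assumes T: "arith T" "disjunction_property T" and A: "sentence (Exists A)"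
    and "T \<turnstile>\<^sub>i bex (numeral_tm n) A"
  shows "\<exists>k. T \<turnstile>\<^sub>i subst (inst (numeral_tm k)) A"
  using assms(4)
proof (induction n)
  case 0
  then have "T \<turnstile>\<^sub>i subst (inst (numeral_tm 0)) A" using bex_ZeroD[OF T(1)] by simp
  then show ?case by blast
next
  case (Suc n)
  have fv: "fv A \<subseteq> {0}" using A by (auto simp: sentence_def) (metis not0_implies_Suc)
  let ?B = "subst (inst (numeral_tm (Suc n))) A"
  have "fv ?B = {}" unfolding fv_subst using fv by auto
  then have "sentence (Or (bex (numeral_tm n) A) ?B)" using A by (auto simp: sentence_def fv_bex)
  moreover have "T \<turnstile>\<^sub>i Or (bex (numeral_tm n) A) ?B" using bex_SuccD[OF T(1)] Suc.prems by simp
  ultimately have "T \<turnstile>\<^sub>i bex (numeral_tm n) A \<or> T \<turnstile>\<^sub>i ?B"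
    using T(2) unfolding disjunction_property_def by blast
  then show ?case using Suc.IH by blast
qed

text \<open>
  The sentences \<open>rosser1\<close> (\<open>d\<close> becomes true strictly before \<open>c\<close>) and \<open>rosser0\<close> (\<open>c\<close> becomes true
  no later than \<open>d\<close>) are phrased by bounded existential quantifiers, which grow with the bound.
  This makes the least number principle a plain induction over the stages.
\<close>

definition rosser1 :: "fm \<Rightarrow> fm \<Rightarrow> fm" where
  "rosser1 c d = Exists (And (bex (Var 0) d) (Neg (bex (Var 0) c)))"

definition rosser0 :: "fm \<Rightarrow> fm \<Rightarrow> fm" where
  "rosser0 c d = Exists (Or (And (Eq (Var 0) Zero) (bex (Var 0) c))
     (And (bex (Succ (Var 0)) c) (Neg (bex (Var 0) d))))"

definition early :: "fm \<Rightarrow> fm \<Rightarrow> fm \<Rightarrow> fm" where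
  "early A c d = Exists (And A (And (Neg (bex (Var 0) c)) (Neg (bex (Var 0) d))))"

lemma subst_rosser:
  "subst \<sigma> (rosser0 c d) = rosser0 (subst (up (up \<sigma>)) c) (subst (up (up \<sigma>)) d)"
  "subst \<sigma> (rosser1 c d) = rosser1 (subst (up (up \<sigma>)) c) (subst (up (up \<sigma>)) d)"
  "subst \<sigma> (early A c d) = early (subst (up \<sigma>) A) (subst (up (up \<sigma>)) c) (subst (up (up \<sigma>)) d)"
  by (simp_all add: rosser0_def rosser1_def early_def)

lemma subst_fv0:
  assumes "fv A \<subseteq> {0}" "\<sigma> 0 = Var 0" shows "subst \<sigma> A = A"
proof -
  have "subst \<sigma> A = subst Var A"
  proof (rule subst_cong)
    fix n assume "n \<in> fv A"
    then have "n = 0" using assms(1) by blast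
    then show "\<sigma> n = Var n" using assms(2) by simp
  qed
  then show ?thesis by simp
qed

lemma subst_up_fv0: "fv A \<subseteq> {0} \<Longrightarrow> subst (up \<sigma>) A = A"
  by (rule subst_fv0) simp_all

section \<open>Comparison of stages inside HA\<close>

context
  fixes c d :: fm
  assumes c: "fv c \<subseteq> {0}" and d: "fv d \<subseteq> {0}"
begin

text \<open>Variable 0 of \<open>c\<close> and \<open>d\<close> is bound by the enclosing
  \<open>bex\<close>, so no substitution from outside reaches them.\<close>

lemma subst_up_cd: "subst (up \<sigma>) c = c" "subst (up \<sigma>) d = d"
  using c d by (simp_all add: subst_up_fv0)

lemma rosser_closed: "subst \<sigma> (rosser0 c d) = rosser0 c d" "subst \<sigma> (rosser1 c d) = rosser1 c d"
  by (simp_all add: subst_rosser subst_up_cd)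

lemma rosser1I:
  assumes "\<Gamma> \<turnstile>\<^sub>i bex t d" "\<Gamma> \<turnstile>\<^sub>i Neg (bex t c)" shows "\<Gamma> \<turnstile>\<^sub>i rosser1 c d"
  unfolding rosser1_def
  by (rule iprov.ExistsI[of _ t]) (simp add: subst_up_cd assms iprov.AndI)

text \<open>Stage 0 has no earlier stage at which \<open>d\<close> could be refuted, which is why
  \<open>rosser0\<close> gives it a disjunct of its own.\<close>

lemma rosser0I_Zero:
  assumes "\<Gamma> \<turnstile>\<^sub>i bex Zero c" shows "\<Gamma> \<turnstile>\<^sub>i rosser0 c d"
  unfolding rosser0_def
  by (rule iprov.ExistsI[of _ Zero])
    (simp add: subst_up_cd assms iprov.OrI1 iprov.AndI iprov.EqRefl)

lemma rosser0I_Succ: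
  assumes "\<Gamma> \<turnstile>\<^sub>i bex (Succ t) c" "\<Gamma> \<turnstile>\<^sub>i Neg (bex t d)" shows "\<Gamma> \<turnstile>\<^sub>i rosser0 c d"
  unfolding rosser0_def
  by (rule iprov.ExistsI[of _ t]) (simp add: subst_up_cd assms iprov.OrI2 iprov.AndI)

text \<open>Let \<open>y\<close> witness \<open>rosser0\<close> and \<open>z\<close> witness
  \<open>rosser1\<close>. If \<open>c\<close> is true by stage 0, it is true by \<open>z\<close>.
  Otherwise \<open>z \<le> y\<close> makes \<open>d\<close> true by \<open>y\<close>, and
  \<open>y + 1 \<le> z\<close> makes \<open>c\<close> true by \<open>z\<close>. All three are
  excluded.\<close>

lemma rosser_inconsistent:
  assumes \<Gamma>: "arith \<Gamma>" and r0: "\<Gamma> \<turnstile>\<^sub>i rosser0 c d" and r1: "\<Gamma> \<turnstile>\<^sub>i rosser1 c d"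
  shows "\<Gamma> \<turnstile>\<^sub>i C"
proof -
  \<comment> \<open>Opening \<open>rosser0\<close> first and \<open>rosser1\<close> second leaves
    their witnesses as variables 1 and 0.\<close>
  let ?y = "Var 1" and ?z = "Var 0"
  let ?E = "\<lambda>y. Or (And (Eq y Zero) (bex y c)) (And (bex (Succ y) c) (Neg (bex y d)))"
  let ?F = "And (bex ?z d) (Neg (bex ?z c))"
  let ?\<Delta> = "insert ?F (insert (?E ?y) (subst shift ` subst shift ` \<Gamma>))"
  have z: "\<Theta> \<turnstile>\<^sub>i bex ?z d" "\<Theta> \<turnstile>\<^sub>i Neg (bex ?z c)" if "?\<Delta> \<subseteq> \<Theta>" for \<Theta>
  proof -
    have "\<Theta> \<turnstile>\<^sub>i ?F" using that by (intro iprov.Assm) auto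
    then show "\<Theta> \<turnstile>\<^sub>i bex ?z d" "\<Theta> \<turnstile>\<^sub>i Neg (bex ?z c)"
      by (rule iprov.AndE1, rule iprov.AndE2)
  qed
  have "?\<Delta> \<turnstile>\<^sub>i Bot"
  proof (rule iprov.OrE[of _ "And (Eq ?y Zero) (bex ?y c)" "And (bex (Succ ?y) c) (Neg (bex ?y d))"])
    let ?\<Theta> = "insert (And (Eq ?y Zero) (bex ?y c)) ?\<Delta>"
    have g: "arith ?\<Theta>" by (simp add: \<Gamma>)
    have "?\<Theta> \<turnstile>\<^sub>i Leq ?y ?z"
      by (rule Leq_Eq_left[OF Leq_Zero_left[OF g] Eq_sym[OF iprov.AndE1[OF iprov_Assm]]])
    then have "?\<Theta> \<turnstile>\<^sub>i bex ?z c" by (rule bex_mono[OF g _ iprov.AndE2[OF iprov_Assm]])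
    then show "?\<Theta> \<turnstile>\<^sub>i Bot" by (intro iprov.ImpE[OF z(2)]) auto
    let ?\<Theta> = "insert (And (bex (Succ ?y) c) (Neg (bex ?y d))) ?\<Delta>"
    have g: "arith ?\<Theta>" by (simp add: \<Gamma>)
    show "?\<Theta> \<turnstile>\<^sub>i Bot"
    proof (rule iprov.OrE[OF Leq_linear[OF g]])
      let ?\<Xi> = "insert (Leq ?z ?y) ?\<Theta>"
      have "?\<Xi> \<turnstile>\<^sub>i bex ?y d" by (rule bex_mono[OF _ iprov_Assm z(1)]) (auto simp: \<Gamma>)
      then show "?\<Xi> \<turnstile>\<^sub>i Bot" by (rule iprov.ImpE[OF iprov.AndE2[OF iprov_Assm2]])
      let ?\<Xi> = "insert (Leq (Succ ?y) ?z) ?\<Theta>"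
      have "?\<Xi> \<turnstile>\<^sub>i bex ?z c" 
        by (rule bex_mono[OF _ iprov_Assm iprov.AndE1[OF iprov_Assm2]]) (simp add: \<Gamma>)
      then show "?\<Xi> \<turnstile>\<^sub>i Bot" by (intro iprov.ImpE[OF z(2)]) auto
    qed
  qed simp
  then have "?\<Delta> \<turnstile>\<^sub>i subst shift (subst shift C)" by (rule iprov.BotE)
  then have "insert ?F (subst shift ` insert (?E (Var 0)) (subst shift ` \<Gamma>))
      \<turnstile>\<^sub>i subst shift (subst shift C)"
    by (simp add: subst_up_cd)
  moreover have "insert (?E (Var 0)) (subst shift ` \<Gamma>) \<turnstile>\<^sub>i Exists ?F"
    using iprov_subst[OF r1, of shift] rosser_closed(2)[of shift]
    by (simp add: rosser1_def iprov_weaken)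
  ultimately have "insert (?E (Var 0)) (subst shift ` \<Gamma>) \<turnstile>\<^sub>i subst shift C"
    by (rule iprov.ExistsE[rotated])
  then show ?thesis by (rule iprov.ExistsE[OF r0[unfolded rosser0_def]])
qed

text \<open>If a witness of \<open>early\<close> were at least \<open>n\<close>, then
  \<open>c\<close> would be true up to it; by linearity the witness lies below
  \<open>n\<close>.\<close>

lemma early_bound:
  assumes \<Gamma>: "arith \<Gamma>" and n: "\<Gamma> \<turnstile>\<^sub>i bex (numeral_tm n) c" and e: "\<Gamma> \<turnstile>\<^sub>i early A c d"
  shows "\<Gamma> \<turnstile>\<^sub>i bex (numeral_tm n) A"
proof (rule iprov.ExistsE[OF e[unfolded early_def]])
  let ?x = "Var 0"
  let ?\<Delta> = "insert (And A (And (Neg (bex ?x c)) (Neg (bex ?x d)))) (subst shift ` \<Gamma>)"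
  have g: "arith ?\<Delta>" by (simp add: \<Gamma>)
  have n': "?\<Delta> \<turnstile>\<^sub>i bex (numeral_tm n) c"
    using iprov_subst[OF n, of shift] by (simp add: subst_up_cd iprov_weaken)
  have "?\<Delta> \<turnstile>\<^sub>i bex (numeral_tm n) (subst (up shift) A)"
  proof (rule iprov.OrE[OF Leq_linear[OF g, of "numeral_tm n" ?x]])
    let ?\<Theta> = "insert (Leq (numeral_tm n) ?x) ?\<Delta>"
    have "?\<Theta> \<turnstile>\<^sub>i bex ?x c" by (rule bex_mono[OF _ iprov_Assm iprov_weaken[OF n']]) (simp add: \<Gamma>)
    then show "?\<Theta> \<turnstile>\<^sub>i bex (numeral_tm n) (subst (up shift) A)"
      by (rule NegE[OF iprov.AndE1[OF iprov.AndE2[OF iprov_Assm2]]])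
    let ?\<Theta> = "insert (Leq (Succ ?x) (numeral_tm n)) ?\<Delta>"
    have g: "arith ?\<Theta>" by (simp add: \<Gamma>)
    have "?\<Theta> \<turnstile>\<^sub>i Leq ?x (numeral_tm n)"
      by (rule Leq_trans[OF g Leq_SuccI[OF g Leq_refl[OF g]] iprov_Assm])
    moreover have "tsubst (inst (Var 0)) (up shift n) = Var n" for n
      by (cases n) auto
    moreover have "?\<Theta> \<turnstile>\<^sub>i A" by (rule iprov.AndE1[OF iprov_Assm2])
    ultimately show "?\<Theta> \<turnstile>\<^sub>i bex (numeral_tm n) (subst (up shift) A)"
      by (simp add: bexI[of _ ?x])
  qed
  then show "?\<Delta> \<turnstile>\<^sub>i subst shift (bex (numeral_tm n) A)" by simp
qed

context
  assumes Dec_c: "peano_axioms \<turnstile>\<^sub>i Dec c" and Dec_d: "peano_axioms \<turnstile>\<^sub>i Dec d"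
begin

text \<open>Induction on the stage: as long as neither formula has become true the comparison stays
  open, and the first stage at which this changes settles it.\<close>

lemma rosser_stages:
  assumes \<Gamma>: "arith \<Gamma>"
  shows "\<Gamma> \<turnstile>\<^sub>i Or (And (Neg (bex t c)) (Neg (bex t d))) (Or (rosser0 c d) (rosser1 c d))"
proof -
  let ?R = "\<lambda>t. Or (And (Neg (bex t c)) (Neg (bex t d))) (Or (rosser0 c d) (rosser1 c d))"
  \<comment> \<open>Only the case that \<open>c\<close> is true by \<open>t\<close> depends on how
    the stage is reached. If \<open>c\<close> is false and \<open>d\<close> true by
    \<open>t\<close>, then \<open>t\<close> itself witnesses \<open>rosser1\<close>.\<close>
  have cases: "\<Delta> \<turnstile>\<^sub>i ?R t"
    if \<Delta>: "arith \<Delta>" and "insert (bex t c) \<Delta> \<turnstile>\<^sub>i rosser0 c d" for \<Delta> t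
  proof (rule Dec_cases[OF Dec_bex[OF Dec_c \<Delta>]])
    show "insert (bex t c) \<Delta> \<turnstile>\<^sub>i ?R t" using that(2) by (intro iprov.OrI2 iprov.OrI1)
    let ?\<Delta> = "insert (Neg (bex t c)) \<Delta>"
    have d: "arith ?\<Delta>" by (simp add: \<Delta>)
    show "?\<Delta> \<turnstile>\<^sub>i ?R t"
    proof (rule Dec_cases[OF Dec_bex[OF Dec_d d]])
      show "insert (bex t d) ?\<Delta> \<turnstile>\<^sub>i ?R t"
        by (rule iprov.OrI2, rule iprov.OrI2, rule rosser1I[OF iprov_Assm iprov_Assm2])
      show "insert (Neg (bex t d)) ?\<Delta> \<turnstile>\<^sub>i ?R t"
        by (rule iprov.OrI1, rule iprov.AndI[OF iprov_Assm2 iprov_Assm])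
    qed
  qed
  have "\<Gamma> \<turnstile>\<^sub>i subst (inst t) (?R (Var 0))"
  proof (rule arith_induct[OF \<Gamma>])
    have "\<Gamma> \<turnstile>\<^sub>i ?R Zero" by (rule cases[OF \<Gamma> rosser0I_Zero[OF iprov_Assm]])
    then show "\<Gamma> \<turnstile>\<^sub>i subst (inst Zero) (?R (Var 0))" by (simp add: subst_up_cd rosser_closed)
    let ?\<Delta> = "insert (?R (Var 0)) (subst shift ` \<Gamma>)"
    have "?\<Delta> \<turnstile>\<^sub>i ?R (Succ (Var 0))"
    proof (rule iprov.OrE[OF iprov_Assm])
      let ?N = "And (Neg (bex (Var 0) c)) (Neg (bex (Var 0) d))"
      show "insert ?N ?\<Delta> \<turnstile>\<^sub>i ?R (Succ (Var 0))"
        by (rule cases, simp add: \<Gamma>, rule rosser0I_Succ[OF iprov_Assm iprov.AndE2[OF iprov_Assm2]])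
      show "insert (Or (rosser0 c d) (rosser1 c d)) ?\<Delta> \<turnstile>\<^sub>i ?R (Succ (Var 0))"
        by (rule iprov.OrI2) simp
    qed
    then show "?\<Delta> \<turnstile>\<^sub>i subst (case_nat (Succ (Var 0)) shift) (?R (Var 0))"
      by (simp add: subst_up_cd rosser_closed)
  qed
  then show ?thesis by (simp add: subst_up_cd rosser_closed)
qed

text \<open>The stages are examined at a witness of \<open>A\<close>: a comparison still open there
  is exactly what \<open>early\<close> asserts.\<close>

lemma rosser_disjunction:
  assumes \<Gamma>: "arith \<Gamma>" and A: "fv A \<subseteq> {0}" and ex: "\<Gamma> \<turnstile>\<^sub>i Exists A"
  shows "\<Gamma> \<turnstile>\<^sub>i Or (Or (early A c d) (rosser1 c d)) (rosser0 c d)" (is "_ \<turnstile>\<^sub>i ?C")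
proof (rule iprov.ExistsE[OF ex])
  let ?\<Delta> = "insert A (subst shift ` \<Gamma>)" and ?N = "And (Neg (bex (Var 0) c)) (Neg (bex (Var 0) d))"
  have "?\<Delta> \<turnstile>\<^sub>i ?C"
  proof (rule iprov.OrE[OF rosser_stages])
    show "arith ?\<Delta>" by (simp add: \<Gamma>)
    have "insert ?N ?\<Delta> \<turnstile>\<^sub>i early A c d"
      unfolding early_def
    proof (rule iprov.ExistsI[of _ "Var 0"])
      have "subst (inst (Var 0)) A = A"
        by (rule subst_fv0[OF A]) simp
      then show "insert ?N ?\<Delta> \<turnstile>\<^sub>i subst (inst (Var 0)) (And A ?N)"
        by (simp add: subst_up_cd iprov.AndI)
    qed
    then show "insert ?N ?\<Delta> \<turnstile>\<^sub>i ?C" by (intro iprov.OrI1)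
    show "insert (Or (rosser0 c d) (rosser1 c d)) ?\<Delta> \<turnstile>\<^sub>i ?C"
      by (rule iprov.OrE[OF iprov_Assm])
        (rule iprov.OrI2[OF iprov_Assm], rule iprov.OrI1[OF iprov.OrI2[OF iprov_Assm]])
  qed
  \<comment> \<open>The disjunction is closed, so the eigenvariable that witnesses \<open>A\<close>
    does not occur in it.\<close>
  moreover have "subst shift ?C = ?C"
    using A by (simp add: subst_rosser subst_up_cd subst_up_fv0)
  ultimately show "?\<Delta> \<turnstile>\<^sub>i subst shift ?C" by simp
qed

end

end

section \<open>From the disjunction property to numerical existence\<close>

lemma disjunction_imp_numerical_existence:
  assumes re: "re_theory T" and HA: "extends_HA T" and DP: "disjunction_property T"
  shows "numerical_existence_property T"
  unfolding numerical_existence_property_def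
proof (intro allI impI)
  fix A assume A: "sentence (Exists A)" and ex: "T \<turnstile>\<^sub>i Exists A"
  have T: "\<And>A. A \<in> T \<Longrightarrow> sentence A" and arith: "arith T"
    using HA by (auto simp: extends_HA_def arith_def)
  have A0: "fv A \<subseteq> {0}" using A by (auto simp: sentence_def) (metis not0_implies_Suc)
  obtain c d C D where c: "fv c \<subseteq> {0}" and d: "fv d \<subseteq> {0}"
    and Dec: "peano_axioms \<turnstile>\<^sub>i Dec c" "peano_axioms \<turnstile>\<^sub>i Dec d"
    and C: "\<And>n. peano_axioms \<turnstile>\<^sub>i (if C n then subst (inst (numeral_tm n)) c else Neg (subst (inst (numeral_tm n)) c))"
    and D: "\<And>n. peano_axioms \<turnstile>\<^sub>i (if D n then subst (inst (numeral_tm n)) d else Neg (subst (inst (numeral_tm n)) d))"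
    and prov: "(\<exists>n. C n) \<longleftrightarrow> T \<turnstile>\<^sub>i Or (early A c d) (rosser1 c d)" "(\<exists>n. D n) \<longleftrightarrow> T \<turnstile>\<^sub>i rosser0 c d"
    by (rule diagonal_pair[OF T re, of "\<lambda>c d. Or (early A c d) (rosser1 c d)" rosser0])
      (simp_all add: subst_rosser subst_up_fv0[OF A0], blast)
  have c_true: "T \<turnstile>\<^sub>i bex (numeral_tm n) c" if "C n" for n
    using C[of n] that by (intro bex_numeralI[OF arith order_refl] arith_cut[OF arith]) simp
  have d_true: "T \<turnstile>\<^sub>i bex (numeral_tm n) d" if "D n" for n
    using D[of n] that by (intro bex_numeralI[OF arith order_refl] arith_cut[OF arith]) simp
  \<comment> \<open>Falsity up to \<open>n\<close> consists of finitely many instances, each refuted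
    in HA.\<close>
  have c_false: "T \<turnstile>\<^sub>i Neg (bex (numeral_tm n) c)" if "\<And>k. k \<le> n \<Longrightarrow> \<not> C k" for n
  proof (rule bex_numeralD[OF arith arith_cut[OF arith]])
    show "peano_axioms \<turnstile>\<^sub>i Neg (subst (inst (numeral_tm k)) c)" if "k \<le> n" for k
      using C[of k] \<open>\<And>k. k \<le> n \<Longrightarrow> \<not> C k\<close>[OF that] by simp
  qed
  have d_false: "T \<turnstile>\<^sub>i Neg (bex (numeral_tm n) d)" if "\<And>k. k \<le> n \<Longrightarrow> \<not> D k" for n
  proof (rule bex_numeralD[OF arith arith_cut[OF arith]])
    show "peano_axioms \<turnstile>\<^sub>i Neg (subst (inst (numeral_tm k)) d)" if "k \<le> n" for k
      using D[of k] \<open>\<And>k. k \<le> n \<Longrightarrow> \<not> D k\<close>[OF that] by simp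
  qed
  let ?\<phi> = "Or (early A c d) (rosser1 c d)"
  have "sentence (Or ?\<phi> (rosser0 c d))"
    using c d A0 by (auto simp: sentence_def early_def rosser0_def rosser1_def fv_bex)
  with DP rosser_disjunction[OF c d Dec arith A0 ex] have "\<exists>n. C n \<or> D n"
    using prov unfolding disjunction_property_def by blast
  \<comment> \<open>The first stage at which either formula is true; the disjunction property,
    through \<open>prov\<close>, has just shown that there is one.\<close>
  define m where "m = (LEAST n. C n \<or> D n)"
  have m: "C m \<or> D m" unfolding m_def using \<open>\<exists>n. C n \<or> D n\<close> by (rule LeastI_ex)
  have least: "\<not> C k" "\<not> D k" if "k < m" for k
    using not_less_Least[OF that[unfolded m_def]] by auto
  show "\<exists>n. T \<turnstile>\<^sub>i subst (inst (numeral_tm n)) A"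
  proof (cases "C m")
    case True
    have r0: "T \<turnstile>\<^sub>i rosser0 c d"
    proof (cases m)
      case 0
      with c_true[OF True] show ?thesis by (intro rosser0I_Zero[OF c d]) simp
    next
      case (Suc k)
      \<comment> \<open>\<open>d\<close> has to be refuted only up to the stage before
        \<open>m\<close>, so \<open>rosser0\<close> also covers a tie at \<open>m\<close>.\<close>
      with c_true[OF True] show ?thesis
        by (intro rosser0I_Succ[OF c d _ d_false[of k]] least) simp_all
    qed
    have "T \<turnstile>\<^sub>i ?\<phi>" using True prov(1) by blast
    then have "T \<turnstile>\<^sub>i bex (numeral_tm m) A"
    proof (rule iprov.OrE)
      show "insert (early A c d) T \<turnstile>\<^sub>i bex (numeral_tm m) A"
        by (rule early_bound[OF c d _ iprov_weaken[OF c_true[OF True]] iprov_Assm]) (simp add: arith)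
      show "insert (rosser1 c d) T \<turnstile>\<^sub>i bex (numeral_tm m) A"
        by (rule rosser_inconsistent[OF c d _ iprov_weaken[OF r0] iprov_Assm]) (simp add: arith)
    qed
    then show ?thesis by (rule disjunction_property_bex[OF arith DP A])
  next
    case False
    then have "D m" using m by simp
    then have "T \<turnstile>\<^sub>i rosser0 c d" using prov(2) by blast
    \<comment> \<open>Strictness: \<open>C m\<close> fails as well, so \<open>c\<close> can be
      refuted up to \<open>m\<close> itself.\<close>
    moreover have "\<not> C k" if "k \<le> m" for k using that False least(1) by (cases "k = m") auto
    then have "T \<turnstile>\<^sub>i rosser1 c d"
      by (intro rosser1I[OF c d d_true[OF \<open>D m\<close>]] c_false)
    \<comment> \<open>T proves both outcomes of the comparison and is inconsistent, so the choice of
      the numeral is arbitrary.\<close>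
    ultimately have "T \<turnstile>\<^sub>i subst (inst (numeral_tm 0)) A"
      by (rule rosser_inconsistent[OF c d arith])
    then show ?thesis by blast
  qed
qed

theorem theorem8p5:
  assumes FS: "\<And>S :: mfm set.
      \<lbrakk> re_mtheory S;
        includes_PA S;
        \<forall>A. S \<turnstile>\<^sub>m MImp (Box A) (Box (Box A));
        \<forall>A. Delta0 A \<longrightarrow> S \<turnstile>\<^sub>m MImp (embed A) (Box (embed A));
        \<forall>A. Delta0 A \<longrightarrow> S \<turnstile>\<^sub>m Box (MImp (Box (embed A)) (embed A));
        \<forall>A. S \<turnstile>\<^sub>m Box A \<longrightarrow> S \<turnstile>\<^sub>m A;
        \<forall>As B. S \<union> set As \<turnstile>\<^sub>m B \<longrightarrow> S \<turnstile>\<^sub>m MImp (mconj (map Box As)) (Box B) \<rbrakk>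
      \<Longrightarrow> modal_disjunction_property S \<longleftrightarrow> modal_numerical_existence_property S"
  shows "\<And>T :: fm set.
      \<lbrakk> re_theory T; extends_HA T; disjunction_property T \<rbrakk>
      \<Longrightarrow> numerical_existence_property T"
  by (rule disjunction_imp_numerical_existence)

end
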